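(* Suppose that the near-monotonicity condition (C) stated in the context holds. Then the set $\mathfrak{M}^\star$ of optimal ergodic occupation measures is nonempty. In addition, if $\zeta^\star\in\mathfrak{M}^\star$ is disintegrated as $\zeta^\star(dx,du)=\pi_{\zeta^\star}(dx)\,v_{\zeta^\star}(du\,|\,x)$, and $\hat v\in\mathfrak{U}_{\mathrm{sm}}$ agrees $\pi_{\zeta^\star}$-a.e. with $v_{\zeta^\star}$, then $$\lim_{N\to\infty}\frac1N\,\mathbb{E}^{\hat v}_x\Bigl[\sum_{n=0}^{N-1}c_{\hat v}(X_n)\Bigr]=J(x)=\beta\qquad\text{for }\pi_{\zeta^\star}\text{-a.e. }x\in\mathbb{X}.$$
   Context: Notation. For a Polish space $\mathbb{Y}$, $\mathfrak{B}(\mathbb{Y})$ is its Borel $\sigma$-algebra, $\mathfrak{P}(\mathbb{Y})$ the space of Borel probability measures with the Prokhorov topology, and $C_b(\mathbb{Y})$ the bounded continuous real functions. Model. A Markov decision process $(\mathbb{X},\mathbb{U},\mathcal{U},P,c)$: the state space $\mathbb{X}$ and the action space $\mathbb{U}$ are Polish; $\mathcal{U}:\mathbb{X}\to\mathfrak{B}(\mathbb{U})$ is a strict (nonempty-valued) measurable multifunction; $\mathbb{K}=\{(x,u):x\in\mathbb{X},\,u\in\mathcal{U}(x)\}$ has the relative topology of $\mathbb{X}\times\mathbb{U}$; $P(\cdot\,|\,x,u)$ is a stochastic kernel on $\mathbb{K}\times\mathfrak{B}(\mathbb{X})$; $c:\mathbb{K}\to[1,\infty]$ is the measurable running cost. Admissible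 strategies $\xi=\{\xi_t\}\in\mathfrak{U}$ are sequences of stochastic kernels on $\mathbb{U}$ given the history $h_t=(x_0,u_0,\dots,u_{t-1},x_t)$ with $\xi_t(\mathcal{U}(x_t)\,|\,h_t)=1$; $\mathbb{P}^\xi_\mu$, $\mathbb{E}^\xi_\mu$ are the induced law and expectation of the state/action process $(X_t,U_t)_{t\ge0}$ with $X_0\sim\mu$ ($\mathbb{P}^\xi_x$, $\mathbb{E}^\xi_x$ if $\mu$ is the Dirac mass at $x$). $\mathfrak{U}_{\mathrm{sm}}$ is the set of stationary Markov randomized strategies, i.e. stochastic kernels $v(du\,|\,x)$ with $v(\mathcal{U}(x)\,|\,x)=1$. For $v\in\mathfrak{U}_{\mathrm{sm}}$, $P_v(A\,|\,x)=\int P(A\,|\,x,u)v(du\,|\,x)$ and $c_v(x)=\int c(x,u)v(du\,|\,x)$. Standing assumptions: (i) $(x,u)\mapsto\int f(y)P(dy\,|\,x,u)$ is continuous on $\mathbb{K}$ for every $f\in C_b(\mathbb{X})$; (ii) $\mathcal{U}$ is upper semicontinuous and closed-valued; (iii) $c:\mathbb{K}\to[1,\infty]$ is lower semicontinuous. Average cost. $\mathcal{E}(\mu,\xi)=\limsup_{N\to\infty}\frac1N\mathbb{E}^\xi_\mu[\sum_{n=0}^{N-1}c(X_n,U_n)]$, $J(\mu)=\inf_{\xi\in\mathfrak{U}}\mathcal{E}(\mu,\xi)$, $\beta=\inf_{\mu\in\mathfrak{P}(\mathbb{X})}J(\mu)$; $J(x)$ denotes $J$ at the Dirac mass at $x$.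 Ergodic occupation measures. $\zeta\in\mathfrak{P}(\mathbb{K})$ is an ergodic occupation measure if $\int_{\mathbb{K}}\bigl(f(x)-\int_{\mathbb{X}}f(y)P(dy\,|\,x,u)\bigr)\zeta(dx,du)=0$ for all $f\in C_b(\mathbb{X})$. It is disintegrated as $\zeta(dx,du)=\pi_\zeta(dx)v_\zeta(du\,|\,x)$ with $\pi_\zeta\in\mathfrak{P}(\mathbb{X})$ and $v_\zeta$ a stochastic kernel, defined $\pi_\zeta$-a.e., with $v_\zeta(\mathcal{U}(x)\,|\,x)=1$. It is optimal if $\int_{\mathbb{K}}c\,d\zeta=\beta$; $\mathfrak{M}^\star$ is the set of optimal ones. Condition (C). There is a continuous one-one embedding $\Psi$ of $\mathbb{K}$ into a Polish space with $\overline{\Psi(\mathbb{K})}$ compact; $\mathbb{K}$ is identified with $\Psi(\mathbb{K})$, $\mathbb{K}^*$ denotes $\overline{\Psi(\mathbb{K})}$, and $\partial\mathbb{K}=\mathbb{K}^*\setminus\mathbb{K}$. Moreover $\mathbb{K}^*$ is taken to be the closure of $\mathbb{K}$ embedded in $\mathbb{X}^*\times\mathbb{U}^*$, where $\mathbb{X}^*,\mathbb{U}^*$ are compact dense embeddings of $\mathbb{X},\mathbb{U}$ into suitable Polish spaces, assumed to exist. Furthermore there exist a compact set $\widetilde K\subset\mathbb{K}$ and $\varepsilon_0>0$ such that $c(x,u)\ge\beta+\varepsilon_0$ for all $(x,u)\in\mathbb{K}\setminus\widetilde K$ (in particular $\liminf_n c(x_n,u_n)\ge\beta+\varepsilon_0$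 whenever $(x_n,u_n)\in\mathbb{K}$ converges to $\partial\mathbb{K}$).
   Formalization: Nonemptiness of M* is proved under the added assumption that {(x,u) in K: x in C, c(x,u)<=r} is compact for all compact C in X and finite r (it fails without this: mass can escape along actions), and β<∞ is assumed throughout. *)

theory Defs
  imports "HOL-Probability.Probability"
begin

section \<open>Markov decision processes with Borel kernels\<close>

text \<open>
  \<open>U\<close> is the multifunction of admissible actions, \<open>P\<close> the transition kernel, \<open>c\<close> the running cost.
  \<open>P\<close> and \<open>c\<close> are total functions, but only their values on the graph of \<open>U\<close> are ever used.
\<close>

definition graph :: "('x \<Rightarrow> 'u set) \<Rightarrow> ('x \<times> 'u) set" where
  "graph U = {(x, u). u \<in> U x}"

abbreviation borel_graph ::
  "('x::polish_space \<Rightarrow> 'u::polish_space set) \<Rightarrow> ('x \<times> 'u) measure" where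
  "borel_graph U \<equiv> restrict_space borel (graph U)"

abbreviation Prob :: "'a::topological_space measure set" where
  "Prob \<equiv> space (prob_algebra borel)"

definition measurable_multifunction ::
  "('x::topological_space \<Rightarrow> 'u::topological_space set) \<Rightarrow> bool" where
  "measurable_multifunction U \<longleftrightarrow> (\<forall>G. open G \<longrightarrow> {x. U x \<inter> G \<noteq> {}} \<in> sets borel)"

definition usc_multifunction ::
  "('x::topological_space \<Rightarrow> 'u::topological_space set) \<Rightarrow> bool" where
  "usc_multifunction U \<longleftrightarrow> (\<forall>F. closed F \<longrightarrow> closed {x. U x \<inter> F \<noteq> {}})"

definition lsc_on :: "'a::topological_space set \<Rightarrow> ('a \<Rightarrow> ennreal) \<Rightarrow> bool" where
  "lsc_on S f \<longleftrightarrow> (\<forall>a. openin (top_of_set S) {z \<in> S. a < f z})"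

locale mdp =
  fixes U :: "'x::polish_space \<Rightarrow> 'u::polish_space set"
    and P :: "'x \<times> 'u \<Rightarrow> 'x measure"
    and c :: "'x \<times> 'u \<Rightarrow> ennreal"
  assumes U_strict: "U x \<noteq> {}"
    and U_borel: "U x \<in> sets borel"
    and U_measurable: "measurable_multifunction U"
    and P_kernel: "P \<in> borel_graph U \<rightarrow>\<^sub>M prob_algebra borel"
    and c_measurable: "c \<in> borel_measurable (borel_graph U)"
    and c_ge_1: "z \<in> graph U \<Longrightarrow> 1 \<le> c z"

locale feller_mdp = mdp U P c
  for U :: "'x::polish_space \<Rightarrow> 'u::polish_space set"
    and P :: "'x \<times> 'u \<Rightarrow> 'x measure"
    and c :: "'x \<times> 'u \<Rightarrow> ennreal" +
  assumes P_feller: "continuous_on UNIV (f :: 'x \<Rightarrow> real) \<Longrightarrow> bounded (range f) \<Longrightarrow>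
      continuous_on (graph U) (\<lambda>z. \<integral>y. f y \<partial>P z)"
    and U_usc: "usc_multifunction U"
    and U_closed: "closed (U x)"
    and c_lsc: "lsc_on (graph U) c"

section \<open>Strategies and the controlled process\<close>

text \<open>
  A history \<open>(x\<^sub>0, u\<^sub>0, \<dots>, u\<^bsub>t-1\<^esub>, x\<^sub>t)\<close> is encoded as a pair \<open>(h, x\<^sub>t)\<close> with
  \<open>h i = (x\<^sub>i, u\<^sub>i)\<close> in the graph of \<open>U\<close> for \<open>i < t\<close>.
\<close>

type_synonym ('x, 'u) strategy = "nat \<Rightarrow> (nat \<Rightarrow> 'x \<times> 'u) \<times> 'x \<Rightarrow> 'u measure"

definition histories ::
  "('x::polish_space \<Rightarrow> 'u::polish_space set) \<Rightarrow> nat \<Rightarrow> ((nat \<Rightarrow> 'x \<times> 'u) \<times> 'x) measure" where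
  "histories U t = PiM {0..<t} (\<lambda>_. borel_graph U) \<Otimes>\<^sub>M borel"

definition strategies ::
  "('x::polish_space \<Rightarrow> 'u::polish_space set) \<Rightarrow> ('x, 'u) strategy set" where
  "strategies U = {\<xi>. \<forall>t. \<xi> t \<in> histories U t \<rightarrow>\<^sub>M prob_algebra borel \<and>
     (\<forall>(h, x) \<in> space (histories U t). emeasure (\<xi> t (h, x)) (U x) = 1)}"

definition sm_strategies ::
  "('x::polish_space \<Rightarrow> 'u::polish_space set) \<Rightarrow> ('x \<Rightarrow> 'u measure) set" where
  "sm_strategies U = {v. v \<in> borel \<rightarrow>\<^sub>M prob_algebra borel \<and> (\<forall>x. emeasure (v x) (U x) = 1)}"

definition stationary :: "('x \<Rightarrow> 'u measure) \<Rightarrow> ('x, 'u) strategy" where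
  "stationary v = (\<lambda>t (h, x). v x)"

text \<open>The measure \<open>\<pi>(dx) v(du | x)\<close> on the graph, for \<open>v\<close> with \<open>v(U x | x) = 1\<close> almost everywhere.\<close>

definition compose_kernel ::
  "('x::polish_space \<Rightarrow> 'u::polish_space set) \<Rightarrow> 'x measure \<Rightarrow> ('x \<Rightarrow> 'u measure) \<Rightarrow>
   ('x \<times> 'u) measure" where
  "compose_kernel U \<pi> v = restrict_space (\<pi> \<bind> (\<lambda>x. distr (v x) borel (Pair x))) (graph U)"

text \<open>Conditional law of \<open>(X\<^sub>t, U\<^sub>t)\<close> given \<open>(X\<^sub>0, U\<^sub>0), \<dots>, (X\<^bsub>t-1\<^esub>, U\<^bsub>t-1\<^esub>)\<close>.\<close>

definition step_kernel ::
  "('x::polish_space \<Rightarrow> 'u::polish_space set) \<Rightarrow> ('x \<times> 'u \<Rightarrow> 'x measure) \<Rightarrow> ('x, 'u) strategy \<Rightarrow>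
   'x measure \<Rightarrow> nat \<Rightarrow> (nat \<Rightarrow> 'x \<times> 'u) \<Rightarrow> ('x \<times> 'u) measure" where
  "step_kernel U P \<xi> \<mu> t h =
     compose_kernel U (if t = 0 then \<mu> else P (h (t - 1))) (\<lambda>x. \<xi> t (h, x))"

text \<open>
  Law of the state/action process \<open>\<omega> t = (X\<^sub>t, U\<^sub>t)\<close>, the measure given by the Ionescu-Tulcea theorem.
\<close>

definition path_law ::
  "('x::polish_space \<Rightarrow> 'u::polish_space set) \<Rightarrow> ('x \<times> 'u \<Rightarrow> 'x measure) \<Rightarrow> ('x, 'u) strategy \<Rightarrow>
   'x measure \<Rightarrow> (nat \<Rightarrow> 'x \<times> 'u) measure" where
  "path_law U P \<xi> \<mu> = projective_family.lim UNIV
     (Ionescu_Tulcea.CI (step_kernel U P \<xi> \<mu>) (\<lambda>_. borel_graph U)) (\<lambda>_. borel_graph U)"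

section \<open>Average cost\<close>

definition avg_cost ::
  "('x::polish_space \<Rightarrow> 'u::polish_space set) \<Rightarrow> ('x \<times> 'u \<Rightarrow> 'x measure) \<Rightarrow> ('x \<times> 'u \<Rightarrow> ennreal) \<Rightarrow>
   'x measure \<Rightarrow> ('x, 'u) strategy \<Rightarrow> ennreal" where
  "avg_cost U P c \<mu> \<xi> =
     limsup (\<lambda>N. (\<integral>\<^sup>+\<omega>. (\<Sum>n<N. c (\<omega> n)) \<partial>path_law U P \<xi> \<mu>) / of_nat N)"

definition value_fn ::
  "('x::polish_space \<Rightarrow> 'u::polish_space set) \<Rightarrow> ('x \<times> 'u \<Rightarrow> 'x measure) \<Rightarrow> ('x \<times> 'u \<Rightarrow> ennreal) \<Rightarrow>
   'x measure \<Rightarrow> ennreal" where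
  "value_fn U P c \<mu> = (INF \<xi>\<in>strategies U. avg_cost U P c \<mu> \<xi>)"

definition opt_value ::
  "('x::polish_space \<Rightarrow> 'u::polish_space set) \<Rightarrow> ('x \<times> 'u \<Rightarrow> 'x measure) \<Rightarrow> ('x \<times> 'u \<Rightarrow> ennreal) \<Rightarrow>
   ennreal" where
  "opt_value U P c = (INF \<mu>\<in>Prob. value_fn U P c \<mu>)"

definition cost_under ::
  "('x \<Rightarrow> 'u set) \<Rightarrow> ('x \<times> 'u \<Rightarrow> ennreal) \<Rightarrow> ('x \<Rightarrow> 'u measure) \<Rightarrow> 'x \<Rightarrow> ennreal" where
  "cost_under U c v x = (\<integral>\<^sup>+u\<in>U x. c (x, u) \<partial>v x)"

section \<open>Ergodic occupation measures\<close>

definition ergodic_occupation_measures ::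
  "('x::polish_space \<Rightarrow> 'u::polish_space set) \<Rightarrow> ('x \<times> 'u \<Rightarrow> 'x measure) \<Rightarrow>
   ('x \<times> 'u) measure set" where
  "ergodic_occupation_measures U P = {\<zeta> \<in> space (prob_algebra (borel_graph U)).
     \<forall>f :: 'x \<Rightarrow> real. continuous_on UNIV f \<longrightarrow> bounded (range f) \<longrightarrow>
       (\<integral>z. f (fst z) - (\<integral>y. f y \<partial>P z) \<partial>\<zeta>) = 0}"

definition optimal_eoms ::
  "('x::polish_space \<Rightarrow> 'u::polish_space set) \<Rightarrow> ('x \<times> 'u \<Rightarrow> 'x measure) \<Rightarrow> ('x \<times> 'u \<Rightarrow> ennreal) \<Rightarrow>
   ('x \<times> 'u) measure set" where
  "optimal_eoms U P c =
     {\<zeta> \<in> ergodic_occupation_measures U P. (\<integral>\<^sup>+z. c z \<partial>\<zeta>) = opt_value U P c}"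

definition disintegrates ::
  "('x::polish_space \<Rightarrow> 'u::polish_space set) \<Rightarrow> ('x \<times> 'u) measure \<Rightarrow> 'x measure \<Rightarrow>
   ('x \<Rightarrow> 'u measure) \<Rightarrow> bool" where
  "disintegrates U \<zeta> \<pi> v \<longleftrightarrow> \<pi> \<in> Prob \<and> v \<in> borel \<rightarrow>\<^sub>M prob_algebra borel \<and>
     (AE x in \<pi>. emeasure (v x) (U x) = 1) \<and> \<zeta> = compose_kernel U \<pi> v"

section \<open>Near-monotonicity\<close>

text \<open>
  \<open>\<phi>\<close> and \<open>\<psi>\<close> embed the state and action spaces into Polish spaces; the compactifications are the
  closures of their ranges, and \<open>compactified_graph\<close> is the closure of the graph of \<open>U\<close> under the
  induced embedding \<open>\<Psi> = map_prod \<phi> \<psi>\<close>.  Only continuity and injectivity of the embeddings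
  are demanded.
\<close>

definition compact_embedding :: "('a::polish_space \<Rightarrow> 'b::polish_space) \<Rightarrow> bool" where
  "compact_embedding \<phi> \<longleftrightarrow> continuous_on UNIV \<phi> \<and> inj \<phi> \<and> compact (closure (range \<phi>))"

definition compactified_graph ::
  "('x::polish_space \<Rightarrow> 'u::polish_space set) \<Rightarrow> ('x \<Rightarrow> 'xs::polish_space) \<Rightarrow>
   ('u \<Rightarrow> 'us::polish_space) \<Rightarrow> ('xs \<times> 'us) set" where
  "compactified_graph U \<phi> \<psi> = closure (map_prod \<phi> \<psi> ` graph U)"

definition near_monotone ::
  "('x::polish_space \<Rightarrow> 'u::polish_space set) \<Rightarrow> ('x \<times> 'u \<Rightarrow> 'x measure) \<Rightarrow> ('x \<times> 'u \<Rightarrow> ennreal) \<Rightarrow>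
   ('x \<Rightarrow> 'xs::polish_space) \<Rightarrow> ('u \<Rightarrow> 'us::polish_space) \<Rightarrow> bool" where
  "near_monotone U P c \<phi> \<psi> \<longleftrightarrow>
     compact_embedding \<phi> \<and> compact_embedding \<psi> \<and> compact (compactified_graph U \<phi> \<psi>) \<and>
     (\<exists>K \<epsilon>. K \<subseteq> graph U \<and> compact K \<and> 0 < (\<epsilon>::real) \<and>
        (\<forall>z \<in> graph U - K. opt_value U P c + ennreal \<epsilon> \<le> c z))"

text \<open>
  Near-monotonicity bounds the cost near the boundary of the compactification only by
  \<open>\<beta> + \<epsilon>\<close>, so it lets mass escape along the actions while the state stays in a compact set,
  and then an optimal occupation measure need not exist: take states \<open>{0, 1}\<close>, \<open>U 1 = {0}\<close>,
  \<open>U 0 = \<nat>\<close>, \<open>P({0} | 1, 0) = 1/2\<close>, \<open>P({1} | 0, u) = u/(u+1)\<close> (the kernel staying put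
  otherwise), \<open>c(1, 0) = 1\<close>, \<open>c(0, u) = 100\<close>.  Here \<open>\<beta> = 34\<close> and is not attained.  The following
  condition rules this out; it holds whenever \<open>U\<close> is upper semicontinuous with compact values and
  \<open>c\<close> is lower semicontinuous.
\<close>

definition K_inf_compact ::
  "('x::polish_space \<Rightarrow> 'u::polish_space set) \<Rightarrow> ('x \<times> 'u \<Rightarrow> ennreal) \<Rightarrow> bool" where
  "K_inf_compact U c \<longleftrightarrow>
     (\<forall>C r. compact C \<longrightarrow> compact {z \<in> graph U. fst z \<in> C \<and> c z \<le> ennreal r})"

end

theory Submission
  imports Defs
begin

text \<open>
  Existence: take occupation measures averaged over long finite horizons, nearly invariant and of
  cost close to the optimal value \<open>\<beta>\<close>.  Along a subsequence they are the laws of random points \<open>Z n\<close>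
  that, in effect, converge pointwise in a compactification.  Let \<open>\<delta>\<close> be the probability that they
  converge in the graph.  Off this event the cost is eventually at least \<open>\<beta> + \<epsilon>\<close>, and it tends to
  infinity if only the actions escape.  Cutting off test functions near infinity shows that the
  limit conditioned on convergence is an ergodic occupation measure, hence of cost at least \<open>\<beta>\<close>: it
  disintegrates into a stationary strategy whose average cost is this integral.  Fatou's lemma gives
  \<open>\<delta> \<beta> + (1 - \<delta>) (\<beta> + \<epsilon>) \<le> \<beta>\<close>, so \<open>\<delta> = 1\<close> and the limit is optimal.

  Convergence: the averages of the cost under the stationary strategy converge
  \<open>\<pi>\<close>-almost everywhere by the ergodic theorem for the Markov operator on \<open>L\<^sup>1(\<pi>)\<close>.  The limit is an
  average cost from a point, hence at least \<open>\<beta>\<close>, and its \<open>\<pi>\<close>-integral is at most \<open>\<beta>\<close>.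
\<close>

text \<open>The state space need not be locally compact and the embeddings are only continuous and
  injective, so a bounded continuous function need not extend to the compactification and compactly
  supported cut-offs need not exist. Convergence there is therefore replaced by deciding: along a
  sample sequence each ball of a countable base is eventually always hit or eventually always
  missed, for the pairs and separately for the states. Such a sequence either converges or leaves
  every compact set. A test function is cut off to finitely many small balls of states. Off the
  event of convergence in the graph the cut-off survives in the limit only where the states settle
  in one of these balls; as the radius shrinks, this would make the states converge while the
  actions escape, which \<open>K_inf_compact\<close> and the finiteness of \<beta> exclude. Cutting
  off yields only an inequality, and only for nonnegative functions; the inequality for
  \<open>f + B\<close> and for \<open>B - f\<close> together gives equality.\<close>

section \<open>The pointwise ergodic theorem for Markov kernels\<close>

locale invariant_kernel = prob_space +
  fixes K :: "'a \<Rightarrow> 'a measure"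
  assumes kernel: "K \<in> M \<rightarrow>\<^sub>M prob_algebra M"
    and invariant: "M \<bind> K = M"
begin

definition T :: "('a \<Rightarrow> ennreal) \<Rightarrow> 'a \<Rightarrow> ennreal" where
  "T f x = (\<integral>\<^sup>+y. f y \<partial>K x)"

definition S :: "('a \<Rightarrow> ennreal) \<Rightarrow> nat \<Rightarrow> 'a \<Rightarrow> ennreal" where
  "S f n x = (\<Sum>k<n. (T ^^ k) f x)"

lemma subprob_kernel [measurable]: "K \<in> M \<rightarrow>\<^sub>M subprob_algebra M"
  using kernel by (rule measurable_prob_algebraD)

lemma prob_space_kernel: "x \<in> space M \<Longrightarrow> prob_space (K x)"
  using measurable_space[OF kernel] by (auto simp: space_prob_algebra)

lemma sets_kernel_eq: "x \<in> space M \<Longrightarrow> sets (K x) = sets M"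
  using measurable_space[OF kernel] by (auto simp: space_prob_algebra)

lemma space_kernel_eq: "x \<in> space M \<Longrightarrow> space (K x) = space M"
  by (rule sets_eq_imp_space_eq[OF sets_kernel_eq])

lemma measurable_T [measurable]:
  assumes [measurable]: "f \<in> borel_measurable M"
  shows "T f \<in> borel_measurable M"
  unfolding T_def by measurable

lemma measurable_T_power [measurable]:
  "f \<in> borel_measurable M \<Longrightarrow> (T ^^ k) f \<in> borel_measurable M"
  by (induction k) auto

lemma measurable_S [measurable]:
  "f \<in> borel_measurable M \<Longrightarrow> S f n \<in> borel_measurable M"
  unfolding S_def by measurable

lemma nn_integral_T:
  assumes "f \<in> borel_measurable M"
  shows "(\<integral>\<^sup>+x. T f x \<partial>M) = (\<integral>\<^sup>+x. f x \<partial>M)"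
  unfolding T_def using nn_integral_bind[OF assms subprob_kernel] invariant by simp

lemma nn_integral_T_power:
  "f \<in> borel_measurable M \<Longrightarrow> (\<integral>\<^sup>+x. (T ^^ k) f x \<partial>M) = (\<integral>\<^sup>+x. f x \<partial>M)"
  by (induction k) (auto simp: nn_integral_T)

lemma nn_integral_S:
  "f \<in> borel_measurable M \<Longrightarrow> (\<integral>\<^sup>+x. S f n x \<partial>M) = of_nat n * (\<integral>\<^sup>+x. f x \<partial>M)"
  unfolding S_def by (simp add: nn_integral_sum nn_integral_T_power)

lemma T_mono:
  assumes "x \<in> space M" "\<And>y. y \<in> space M \<Longrightarrow> f y \<le> g y"
  shows "T f x \<le> T g x"
  unfolding T_def using assms by (intro nn_integral_mono) (simp add: space_kernel_eq)

lemma T_cong: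
  assumes "x \<in> space M" "\<And>y. y \<in> space M \<Longrightarrow> f y = g y"
  shows "T f x = T g x"
  using assms by (intro antisym T_mono) auto

lemma T_add:
  assumes "x \<in> space M" "f \<in> borel_measurable M" "g \<in> borel_measurable M"
  shows "T (\<lambda>y. f y + g y) x = T f x + T g x"
  unfolding T_def using assms by (intro nn_integral_add) (simp_all cong: measurable_cong_sets add: sets_kernel_eq)

lemma T_cmult:
  assumes "x \<in> space M" "f \<in> borel_measurable M"
  shows "T (\<lambda>y. c * f y) x = c * T f x"
  unfolding T_def using assms by (intro nn_integral_cmult) (simp_all cong: measurable_cong_sets add: sets_kernel_eq)

lemma T_const: "x \<in> space M \<Longrightarrow> T (\<lambda>_. c) x = c"
  unfolding T_def using prob_space_kernel by (simp add: prob_space.emeasure_space_1)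

lemma T_sum:
  assumes "x \<in> space M" "\<And>i. i \<in> I \<Longrightarrow> f i \<in> borel_measurable M"
  shows "T (\<lambda>y. \<Sum>i\<in>I. f i y) x = (\<Sum>i\<in>I. T (f i) x)"
  unfolding T_def using assms by (intro nn_integral_sum) (simp_all cong: measurable_cong_sets add: sets_kernel_eq)

text \<open>Splitting off the first term rather than the last lets inductions on n run over all
  starting points and matches the recursion of \<open>excess\<close>.\<close>

lemma S_Suc:
  assumes "x \<in> space M" "f \<in> borel_measurable M"
  shows "S f (Suc n) x = f x + T (S f n) x"
proof -
  have "T (S f n) x = (\<Sum>k<n. (T ^^ Suc k) f x)"
    using T_sum[of x "{..<n}" "\<lambda>k. (T ^^ k) f"] assms by (simp add: S_def[abs_def])
  then show ?thesis
    unfolding S_def by (subst sum.lessThan_Suc_shift) simp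
qed

lemma S_add:
  assumes "x \<in> space M" "f \<in> borel_measurable M" "g \<in> borel_measurable M"
  shows "S (\<lambda>y. f y + g y) n x = S f n x + S g n x"
  using assms(1)
proof (induction n arbitrary: x)
  case (Suc n)
  have "T (S (\<lambda>y. f y + g y) n) x = T (\<lambda>y. S f n y + S g n y) x"
    using Suc by (intro T_cong) auto
  then show ?case
    using Suc.prems assms by (simp add: S_Suc T_add algebra_simps)
qed (simp add: S_def)

lemma S_const: "x \<in> space M \<Longrightarrow> S (\<lambda>_. c) n x = of_nat n * c"
proof (induction n arbitrary: x)
  case (Suc n)
  have "T (S (\<lambda>y. c) n) x = T (\<lambda>y. of_nat n * c) x"
    using Suc by (intro T_cong) auto
  then show ?case
    using Suc.prems by (simp add: S_Suc T_const algebra_simps)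
qed (simp add: S_def)

lemma S_mono:
  assumes "x \<in> space M" "f \<in> borel_measurable M" "g \<in> borel_measurable M"
    and "\<And>y. y \<in> space M \<Longrightarrow> f y \<le> g y"
  shows "S f n x \<le> S g n x"
  using assms(1)
proof (induction n arbitrary: x)
  case (Suc n)
  then show ?case
    using Suc.prems assms by (simp add: S_Suc add_mono T_mono)
qed (simp add: S_def)

section \<open>The maximal ergodic inequality\<close>

text \<open>
  The functions below dominate the partial sums \<open>S a n - S b n\<close> while being defined by truncated
  subtraction, so that Garsia's proof of the maximal ergodic lemma needs no signed integrals.
\<close>

primrec excess :: "('a \<Rightarrow> ennreal) \<Rightarrow> ('a \<Rightarrow> ennreal) \<Rightarrow> nat \<Rightarrow> 'a \<Rightarrow> ennreal" where
  "excess a b 0 = (\<lambda>_. 0)"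
| "excess a b (Suc n) = (\<lambda>x. a x + T (excess a b n) x - b x)"

lemma measurable_excess [measurable]:
  assumes [measurable]: "a \<in> borel_measurable M" "b \<in> borel_measurable M"
  shows "excess a b n \<in> borel_measurable M"
  by (induction n) (simp_all del: excess.simps(2) add: excess.simps(2)[abs_def])

text \<open>For finite \<open>a\<close> and \<open>b\<close> the recursion is that of optimal
  stopping: the best expected gain from \<open>a - b\<close> within n steps, stopping being worth 0.
  A longer horizon can only raise it.\<close>

lemma excess_mono_Suc: "x \<in> space M \<Longrightarrow> excess a b n x \<le> excess a b (Suc n) x"
proof (induction n arbitrary: x)
  case (Suc n)
  then show ?case
    by (auto intro!: ennreal_minus_mono add_mono T_mono)
qed simp

lemma S_le_excess:
  assumes [measurable]: "a \<in> borel_measurable M" "b \<in> borel_measurable M" and "x \<in> space M"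
  shows "S a n x \<le> excess a b n x + S b n x"
  using \<open>x \<in> space M\<close>
proof (induction n arbitrary: x)
  case (Suc n)
  have "S a (Suc n) x = a x + T (S a n) x"
    using Suc.prems by (simp add: S_Suc)
  also have "\<dots> \<le> a x + (T (excess a b n) x + T (S b n) x)"
    using Suc by (intro add_left_mono) (subst T_add[symmetric], auto intro!: T_mono)
  \<comment> \<open>Truncation never loses: \<open>p \<le> (p - b) + b\<close> for all extended
    values. This is why \<open>S b\<close> is added on the right of the claim instead of being
    subtracted on the left.\<close>
  also have "\<dots> \<le> (a x + T (excess a b n) x - b x) + b x + T (S b n) x"
    unfolding add.assoc[symmetric] by (intro add_right_mono) (auto simp: diff_add_self_ennreal)
  finally show ?case
    using Suc.prems by (simp add: S_Suc algebra_simps)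
qed (simp add: S_def)

text \<open>Lets the integral of the excess be cancelled at the end of
  \<open>maximal_inequality_step\<close>.\<close>

lemma nn_integral_excess_finite:
  assumes [measurable]: "a \<in> borel_measurable M" "b \<in> borel_measurable M"
    and fin: "(\<integral>\<^sup>+x. a x \<partial>M) < \<infinity>"
  shows "(\<integral>\<^sup>+x. excess a b n x \<partial>M) < \<infinity>"
proof (induction n)
  case (Suc n)
  have "(\<integral>\<^sup>+x. excess a b (Suc n) x \<partial>M) \<le> (\<integral>\<^sup>+x. a x + T (excess a b n) x \<partial>M)"
    by (intro nn_integral_mono) (simp add: diff_le_self_ennreal)
  also have "\<dots> < \<infinity>"
    using Suc fin by (simp add: nn_integral_add nn_integral_T)
  finally show ?case .
qed simp

text \<open>Garsia's argument. On \<open>E\<close> the truncation is inactive, so the excess for n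
  plus \<open>b\<close> equals \<open>a\<close> plus \<open>T\<close> of the excess for n - 1, which
  is at most \<open>a\<close> plus \<open>T\<close> of the excess for n. Integrate over
  \<open>E\<close>, off which the excess vanishes; by invariance the two integrals of the excess
  cancel.\<close>

lemma maximal_inequality_step:
  fixes n :: nat
  assumes [measurable]: "a \<in> borel_measurable M" "b \<in> borel_measurable M"
    and fin: "(\<integral>\<^sup>+x. a x \<partial>M) < \<infinity>"
  defines "E \<equiv> {x \<in> space M. 0 < excess a b n x}"
  shows "(\<integral>\<^sup>+x\<in>E. b x \<partial>M) \<le> (\<integral>\<^sup>+x\<in>E. a x \<partial>M)"
proof (cases n)
  case 0
  then show ?thesis by (simp add: E_def)
next
  case (Suc k)
  have E[measurable]: "E \<in> sets M" unfolding E_def by measurable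
  let ?m = "excess a b n"
  have step: "?m x + b x \<le> a x + T ?m x" if "x \<in> E" for x
  proof -
    have "x \<in> space M" "0 < ?m x" using that by (auto simp: E_def)
    \<comment> \<open>A positive truncated difference means that nothing was cut off, also for
      infinite values.\<close>
    then have "b x \<le> a x + T (excess a b k) x"
      by (simp add: Suc) (metis diff_eq_0_ennreal ennreal_minus_eq_0 linear order_less_irrefl top.not_eq_extremum ennreal_minus_eq_top not_less)
    then have "?m x + b x = a x + T (excess a b k) x"
      by (simp add: Suc diff_add_self_ennreal)
    also have "\<dots> \<le> a x + T ?m x"
      unfolding Suc using \<open>x \<in> space M\<close> by (intro add_left_mono T_mono excess_mono_Suc)
    finally show ?thesis .
  qed
  have supp: "(\<integral>\<^sup>+x\<in>E. ?m x \<partial>M) = (\<integral>\<^sup>+x. ?m x \<partial>M)"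
    by (intro nn_integral_cong) (auto simp: E_def indicator_def zero_less_iff_neq_zero)
  have "(\<integral>\<^sup>+x. ?m x \<partial>M) + (\<integral>\<^sup>+x\<in>E. b x \<partial>M) = (\<integral>\<^sup>+x\<in>E. (?m x + b x) \<partial>M)"
    by (simp add: supp[symmetric] nn_integral_add[symmetric] distrib_right)
  also have "\<dots> \<le> (\<integral>\<^sup>+x\<in>E. (a x + T ?m x) \<partial>M)"
    using step by (intro nn_integral_mono) (auto simp: indicator_def)
  also have "\<dots> = (\<integral>\<^sup>+x\<in>E. a x \<partial>M) + (\<integral>\<^sup>+x\<in>E. T ?m x \<partial>M)"
    by (simp add: nn_integral_add[symmetric] distrib_right)
  \<comment> \<open>On this side \<open>E\<close> may be enlarged to the whole space, where
    invariance applies, since \<open>T\<close> of the excess is nonnegative.\<close>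
  also have "\<dots> \<le> (\<integral>\<^sup>+x\<in>E. a x \<partial>M) + (\<integral>\<^sup>+x. T ?m x \<partial>M)"
    by (intro add_left_mono nn_integral_mono) (auto simp: indicator_def)
  also have "\<dots> = (\<integral>\<^sup>+x. ?m x \<partial>M) + (\<integral>\<^sup>+x\<in>E. a x \<partial>M)"
    by (simp add: nn_integral_T add.commute)
  finally show ?thesis
    using nn_integral_excess_finite[OF assms(1-3), of n] by (simp add: less_top[symmetric])
qed

definition excess_set :: "('a \<Rightarrow> ennreal) \<Rightarrow> ('a \<Rightarrow> ennreal) \<Rightarrow> 'a set" where
  "excess_set a b = {x \<in> space M. \<exists>n. 0 < excess a b n x}"

lemma sets_excess_set [measurable]:
  assumes [measurable]: "a \<in> borel_measurable M" "b \<in> borel_measurable M"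
  shows "excess_set a b \<in> sets M"
  unfolding excess_set_def by measurable

text \<open>The sets for finite horizons increase to \<open>excess_set a b\<close>. The left side
  converges by continuity from below of the measure with density \<open>b\<close>; the right side
  only grows with the set.\<close>

lemma maximal_inequality:
  assumes [measurable]: "a \<in> borel_measurable M" "b \<in> borel_measurable M"
    and fin: "(\<integral>\<^sup>+x. a x \<partial>M) < \<infinity>"
  shows "(\<integral>\<^sup>+x\<in>excess_set a b. b x \<partial>M) \<le> (\<integral>\<^sup>+x\<in>excess_set a b. a x \<partial>M)"
proof -
  define E where "E n = {x \<in> space M. 0 < excess a b n x}" for n
  have E[measurable]: "E n \<in> sets M" for n unfolding E_def by measurable
  have "incseq E"
    by (intro incseq_SucI) (auto simp: E_def simp del: excess.simps intro: less_le_trans[OF _ excess_mono_Suc])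
  have un: "excess_set a b = (\<Union>n. E n)"
    by (auto simp: excess_set_def E_def)
  have "(\<integral>\<^sup>+x\<in>excess_set a b. b x \<partial>M) = emeasure (density M b) (\<Union>n. E n)"
    by (simp add: emeasure_density un)
  also have "\<dots> = (SUP n. emeasure (density M b) (E n))"
    using \<open>incseq E\<close> by (intro SUP_emeasure_incseq[symmetric]) auto
  also have "\<dots> \<le> (\<integral>\<^sup>+x\<in>excess_set a b. a x \<partial>M)"
  proof (rule SUP_least)
    fix n
    have "emeasure (density M b) (E n) = (\<integral>\<^sup>+x\<in>E n. b x \<partial>M)"
      by (simp add: emeasure_density)
    also have "\<dots> \<le> (\<integral>\<^sup>+x\<in>E n. a x \<partial>M)"
      unfolding E_def by (intro maximal_inequality_step assms)
    also have "\<dots> \<le> (\<integral>\<^sup>+x\<in>excess_set a b. a x \<partial>M)"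
      by (intro nn_integral_mono) (auto simp: un indicator_def)
    finally show "emeasure (density M b) (E n) \<le> (\<integral>\<^sup>+x\<in>excess_set a b. a x \<partial>M)" .
  qed
  finally show ?thesis .
qed

lemma mem_excess_set:
  assumes "a \<in> borel_measurable M" "b \<in> borel_measurable M" "x \<in> space M" "S b n x < S a n x"
  shows "x \<in> excess_set a b"
  using S_le_excess[of a b x n] assms
  by (auto simp: excess_set_def intro!: exI[of _ n]) (metis add_0 leD zero_less_iff_neq_zero)

text \<open>By invariance an M-null set is null for \<open>K x\<close> at almost every x, so
  \<open>T\<close> respects equality almost everywhere.\<close>

lemma T_cong_AE:
  assumes [measurable]: "f \<in> borel_measurable M" "g \<in> borel_measurable M"
    and "AE x in M. f x = g x"
  shows "AE x in M. T f x = T g x"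
proof -
  have "AE x in M \<bind> K. f x = g x"
    unfolding invariant by (rule assms(3))
  then have "AE x in M. AE y in K x. f y = g y"
    by (subst (asm) AE_bind[OF subprob_kernel]) auto
  then show ?thesis
    by eventually_elim (auto simp: T_def intro: nn_integral_cong_AE)
qed

text \<open>The nonnegative function \<open>f - T f\<close> has integral 0 by invariance,
  \<open>f\<close> being integrable.\<close>

lemma harmonic_if_superharmonic:
  assumes [measurable]: "f \<in> borel_measurable M" and fin: "(\<integral>\<^sup>+x. f x \<partial>M) < \<infinity>"
    and le: "\<And>x. x \<in> space M \<Longrightarrow> T f x \<le> f x"
  shows "AE x in M. T f x = f x"
proof -
  have "(\<integral>\<^sup>+x. f x - T f x \<partial>M) = 0"
    using le fin by (subst nn_integral_diff) (auto simp: nn_integral_T)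
  then have "AE x in M. f x - T f x = 0"
    by (subst (asm) nn_integral_0_iff_AE) auto
  then show ?thesis
    using AE_space by eventually_elim (use le in \<open>auto intro!: antisym simp: diff_eq_0_iff_ennreal\<close>)
qed

lemma S_harmonic:
  assumes [measurable]: "f \<in> borel_measurable M" and "AE x in M. T f x = f x"
  shows "AE x in M. \<forall>n. S f n x = of_nat n * f x"
proof -
  have "AE x in M. (T ^^ k) f x = f x" for k
  proof (induction k)
    case (Suc k)
    then have "AE x in M. T ((T ^^ k) f) x = T f x"
      by (intro T_cong_AE) auto
    with assms(2) show ?case by eventually_elim simp
  qed simp
  then have "AE x in M. \<forall>k. (T ^^ k) f x = f x"
    by (simp add: AE_all_countable)
  then show ?thesis
    by eventually_elim (simp add: S_def)
qed

section \<open>Lower and upper limits of the averages\<close>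

definition low :: "('a \<Rightarrow> ennreal) \<Rightarrow> 'a \<Rightarrow> ennreal" where
  "low f x = liminf (\<lambda>n. S f n x / of_nat n)"

definition upp :: "('a \<Rightarrow> ennreal) \<Rightarrow> 'a \<Rightarrow> ennreal" where
  "upp f x = limsup (\<lambda>n. S f n x / of_nat n)"

lemma measurable_average [measurable]:
  "f \<in> borel_measurable M \<Longrightarrow> (\<lambda>x. S f n x / of_nat n) \<in> borel_measurable M"
  unfolding divide_ennreal_def
  by (rule borel_measurable_times_ennreal[OF measurable_S measurable_const]) simp_all

lemma measurable_low [measurable]: "f \<in> borel_measurable M \<Longrightarrow> low f \<in> borel_measurable M"
  unfolding low_def[abs_def] by measurable

lemma measurable_upp [measurable]: "f \<in> borel_measurable M \<Longrightarrow> upp f \<in> borel_measurable M"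
  unfolding upp_def[abs_def] by measurable

lemma low_le_upp: "low f x \<le> upp f x"
  unfolding low_def upp_def by (intro Liminf_le_Limsup) simp

lemma nn_integral_average:
  assumes [measurable]: "f \<in> borel_measurable M" and "0 < n"
  shows "(\<integral>\<^sup>+x. S f n x / of_nat n \<partial>M) = (\<integral>\<^sup>+x. f x \<partial>M)"
  using \<open>0 < n\<close> by (simp add: nn_integral_divide nn_integral_S mult.commute[of "of_nat n"] mult_divide_eq_ennreal)

lemma nn_integral_low_le:
  assumes [measurable]: "f \<in> borel_measurable M"
  shows "(\<integral>\<^sup>+x. low f x \<partial>M) \<le> (\<integral>\<^sup>+x. f x \<partial>M)"
proof -
  have "(\<integral>\<^sup>+x. low f x \<partial>M) \<le> liminf (\<lambda>n. \<integral>\<^sup>+x. S f n x / of_nat n \<partial>M)"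
    unfolding low_def[abs_def] by (intro nn_integral_liminf) auto
  also have "\<dots> = liminf (\<lambda>n. \<integral>\<^sup>+x. f x \<partial>M)"
    by (intro Liminf_eq) (auto intro!: eventually_sequentiallyI[of 1] nn_integral_average)
  finally show ?thesis by (simp add: Liminf_const)
qed

text \<open>Fatou moves \<open>T\<close> inside the lower limit, and
  \<open>T (S f n) \<le> S f (Suc n)\<close> leads back to averages at x itself, up to the factor
  (n+1)/n.\<close>

lemma low_superharmonic:
  assumes f[measurable]: "f \<in> borel_measurable M" and x: "x \<in> space M"
  shows "T (low f) x \<le> low f x"
proof (rule dense_ge)
  fix c assume "low f x < c"
  \<comment> \<open>The gap between \<open>d\<close> and \<open>c\<close> makes room for that
    factor, which appears below as 1 + 1/n.\<close>
  then obtain d where d: "low f x < d" "d < c" using dense by blast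
  have "(\<lambda>n. d * ennreal (1 + 1 / real n)) \<longlonglongrightarrow> d * ennreal (1 + 0)"
    using d(2) by (intro ennreal_tendsto_cmult tendsto_ennrealI tendsto_add tendsto_const lim_1_over_n)
      (auto intro: less_le_trans)
  then have ev: "\<forall>\<^sub>F n in sequentially. d * ennreal (1 + 1 / real n) < c"
    using d(2) by (intro order_tendstoD) auto
  \<comment> \<open>Averages below \<open>d\<close> are sought at index n + 1, because
    \<open>T (S f n)\<close> is bounded by the sum of n + 1 terms.\<close>
  have fr: "\<exists>\<^sub>F n in sequentially. S f (Suc n) x / of_nat (Suc n) < d"
  proof (rule ccontr)
    assume "\<not> ?thesis"
    then have "\<forall>\<^sub>F n in sequentially. d \<le> S f (Suc n) x / of_nat (Suc n)"
      by (simp add: not_frequently not_less)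
    then have "\<forall>\<^sub>F n in sequentially. d \<le> S f n x / of_nat n"
      by (subst (asm) eventually_sequentially_Suc)
    then have "d \<le> low f x"
      unfolding low_def by (rule Liminf_bounded)
    with d(1) show False by simp
  qed
  have "T (low f) x \<le> liminf (\<lambda>n. T (\<lambda>y. S f n y / of_nat n) x)"
    unfolding T_def low_def[abs_def] using x
    by (intro nn_integral_liminf) (simp cong: measurable_cong_sets add: sets_kernel_eq)
  also have "\<dots> \<le> c"
  proof (rule ccontr)
    assume "\<not> ?thesis"
    then have "\<forall>\<^sub>F n in sequentially. c < T (\<lambda>y. S f n y / of_nat n) x"
      by (intro less_LiminfD) simp
    from frequently_ex[OF frequently_eventually_frequently[OF fr
        eventually_conj[OF this eventually_conj[OF ev eventually_gt_at_top[of 0]]]]]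
    obtain n where n: "S f (Suc n) x / of_nat (Suc n) < d" "c < T (\<lambda>y. S f n y / of_nat n) x"
        "d * ennreal (1 + 1 / real n) < c" "0 < n"
      by auto
    have "T (\<lambda>y. S f n y / of_nat n) x = T (S f n) x / of_nat n"
      using T_cmult[OF x, of "S f n" "inverse (of_nat n)"] by (simp add: divide_ennreal_def mult.commute)
    also have "\<dots> \<le> S f (Suc n) x / of_nat n"
      using x by (simp add: S_Suc divide_right_mono_ennreal)
    also have "\<dots> = S f (Suc n) x / of_nat (Suc n) * ennreal (1 + 1 / real n)"
    proof -
      have "ennreal (1 + 1 / real n) = of_nat (Suc n) / of_nat n"
        using \<open>0 < n\<close> by (simp add: ennreal_of_nat_eq_real_of_nat divide_ennreal field_simps del: of_nat_Suc)
      moreover have "S f (Suc n) x / of_nat (Suc n) * of_nat (Suc n) = S f (Suc n) x"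
        by (metis ennreal_times_divide mult.commute mult_divide_eq_ennreal of_nat_0_neq of_nat_eq_0_iff ennreal_of_nat_neq_top Zero_not_Suc)
      ultimately show ?thesis
        by (simp add: ennreal_times_divide del: of_nat_Suc)
    qed
    also have "\<dots> \<le> d * ennreal (1 + 1 / real n)"
      using n(1) by (intro mult_right_mono) auto
    also have "\<dots> < c" by fact
    finally have False using n(2) by simp
    then show False .
  qed
  finally show "T (low f) x \<le> c" .
qed

text \<open>
  Since \<open>low f\<close> is harmonic almost everywhere, the sums of \<open>low f + \<epsilon>\<close> eventually exceed those of
  \<open>f\<close>, so the maximal inequality applies on the whole space; no invariant sets are needed.
\<close>

lemma nn_integral_low:
  assumes [measurable]: "f \<in> borel_measurable M" and fin: "(\<integral>\<^sup>+x. f x \<partial>M) < \<infinity>"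
  shows "(\<integral>\<^sup>+x. low f x \<partial>M) = (\<integral>\<^sup>+x. f x \<partial>M)"
proof (rule antisym)
  show "(\<integral>\<^sup>+x. f x \<partial>M) \<le> (\<integral>\<^sup>+x. low f x \<partial>M)"
  proof (rule ennreal_le_epsilon)
    fix e :: real assume e: "0 < e"
    have fin_low: "(\<integral>\<^sup>+x. low f x \<partial>M) < \<infinity>"
      using nn_integral_low_le[OF assms(1)] fin by (rule le_less_trans)
    define a where "a x = low f x + ennreal e" for x
    have [measurable]: "a \<in> borel_measurable M" unfolding a_def by measurable
    have "AE x in M. \<forall>n. S (low f) n x = of_nat n * low f x"
      using fin_low by (intro S_harmonic harmonic_if_superharmonic low_superharmonic) auto
    moreover have "AE x in M. low f x \<noteq> \<infinity>"
      using fin_low by (intro nn_integral_noteq_infinite) auto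
    ultimately have full: "AE x in M. x \<in> excess_set a f"
      using AE_space
    proof eventually_elim
      fix x assume x: "\<forall>n. S (low f) n x = of_nat n * low f x" "low f x \<noteq> \<infinity>" "x \<in> space M"
      have "low f x < a x"
        using x(2) e unfolding a_def by (metis add.right_neutral ennreal_add_left_cancel_less ennreal_less_zero_iff)
      then have "\<exists>\<^sub>F n in sequentially. S f n x / of_nat n < a x"
        unfolding low_def by (auto simp: frequently_def not_less dest: Liminf_bounded)
      from frequently_ex[OF frequently_eventually_frequently[OF this eventually_gt_at_top[of 0]]]
      obtain n where n: "S f n x / of_nat n < a x" "0 < n" by auto
      have "S f n x = S f n x / of_nat n * of_nat n"
        using n by (metis ennreal_times_divide mult.commute mult_divide_eq_ennreal of_nat_eq_0_iff ennreal_of_nat_neq_top less_not_refl)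
      also have "\<dots> < a x * of_nat n"
        using n by (intro ennreal_mult_strict_right_mono) (auto simp: of_nat_less_top)
      also have "\<dots> = S a n x"
        using x unfolding a_def by (simp add: S_add S_const distrib_left mult.commute)
      finally show "x \<in> excess_set a f"
        using x(3) by (intro mem_excess_set) auto
    qed
    have "(\<integral>\<^sup>+x. f x \<partial>M) = (\<integral>\<^sup>+x\<in>excess_set a f. f x \<partial>M)"
      using full by (intro nn_integral_cong_AE, eventually_elim) simp
    also have "\<dots> \<le> (\<integral>\<^sup>+x\<in>excess_set a f. a x \<partial>M)"
      using fin_low by (intro maximal_inequality) (auto simp: a_def nn_integral_add emeasure_space_1)
    also have "\<dots> \<le> (\<integral>\<^sup>+x. a x \<partial>M)"
      by (intro nn_integral_mono) (auto simp: indicator_def)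
    also have "\<dots> = (\<integral>\<^sup>+x. low f x \<partial>M) + ennreal e"
      by (simp add: a_def nn_integral_add emeasure_space_1)
    finally show "(\<integral>\<^sup>+x. f x \<partial>M) \<le> (\<integral>\<^sup>+x. low f x \<partial>M) + ennreal e" .
  qed
qed (rule nn_integral_low_le[OF assms(1)])

text \<open>Apply \<open>nn_integral_low\<close> to \<open>f\<close> and to \<open>B - f\<close>,
  whose lower average is \<open>B\<close> minus the upper average of \<open>f\<close>. Hence
  \<open>upp f\<close> and \<open>low f\<close> have the same finite integral and, being ordered,
  agree almost everywhere.\<close>

lemma upp_eq_low_bounded:
  assumes f[measurable]: "f \<in> borel_measurable M" and B: "B < \<infinity>" "\<And>x. x \<in> space M \<Longrightarrow> f x \<le> B"
  shows "AE x in M. upp f x = low f x"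
proof -
  let ?g = "\<lambda>x. B - f x"
  have g[measurable]: "?g \<in> borel_measurable M" by measurable
  have avg_le: "S f n x / of_nat n \<le> B" and avg_g: "0 < n \<Longrightarrow> S ?g n x / of_nat n = B - S f n x / of_nat n"
    if x: "x \<in> space M" for x n
  proof -
    have "S f n x + S ?g n x = S (\<lambda>x. f x + (B - f x)) n x"
      using x by (simp add: S_add)
    also have "\<dots> = S (\<lambda>_. B) n x"
      using x B(2) by (intro antisym S_mono) (auto simp: add_diff_self_ennreal)
    also have "\<dots> = of_nat n * B"
      using x by (rule S_const)
    finally have sum: "S f n x + S ?g n x = of_nat n * B" .
    have eq: "0 < n \<Longrightarrow> S f n x / of_nat n + S ?g n x / of_nat n = B"
      unfolding add_divide_distrib_ennreal[symmetric] sum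
      by (metis ennreal_of_nat_neq_top less_not_refl mult.commute mult_divide_eq_ennreal of_nat_eq_0_iff)
    show "S f n x / of_nat n \<le> B"
      by (cases "n = 0") (simp add: S_def, metis eq le_iff_add not_gr_zero)
    assume "0 < n"
    with eq have *: "S f n x / of_nat n + S ?g n x / of_nat n = B" by simp
    then have "S f n x / of_nat n \<noteq> top" using B(1) by auto
    then show "S ?g n x / of_nat n = B - S f n x / of_nat n"
      using * by (metis ennreal_add_diff_cancel_left)
  qed
  have low_g: "low ?g x = B - upp f x" if x: "x \<in> space M" for x
  proof -
    have "low ?g x = liminf (\<lambda>n. B - S f n x / of_nat n)"
      unfolding low_def by (intro Liminf_eq eventually_sequentiallyI[of 1]) (auto simp: avg_g x)
    also have "\<dots> = B - upp f x"
      unfolding upp_def by (intro ennreal_liminf_minus avg_le x)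
    finally show ?thesis .
  qed
  have upp_le: "upp f x \<le> B" if "x \<in> space M" for x
    unfolding upp_def using avg_le[OF that] by (intro Limsup_bounded) auto
  have int_le: "(\<integral>\<^sup>+x. h x \<partial>M) \<le> B" if "\<And>x. x \<in> space M \<Longrightarrow> h x \<le> B" for h
    using nn_integral_mono[of M h "\<lambda>_. B"] that by (simp add: emeasure_space_1)
  have upp_int: "(\<integral>\<^sup>+x. upp f x \<partial>M) \<le> B"
    by (rule int_le) (rule upp_le)
  have low_int: "(\<integral>\<^sup>+x. low f x \<partial>M) \<le> B"
    by (rule order_trans[OF nn_integral_mono upp_int]) (rule low_le_upp)
  have diff: "(\<integral>\<^sup>+x. B - h x \<partial>M) = B - (\<integral>\<^sup>+x. h x \<partial>M)"
    if [measurable]: "h \<in> borel_measurable M" and "\<And>x. x \<in> space M \<Longrightarrow> h x \<le> B" for h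
    using that int_le[of h] B(1) by (subst nn_integral_diff) (auto simp: emeasure_space_1 top_unique)
  have "B - (\<integral>\<^sup>+x. upp f x \<partial>M) = (\<integral>\<^sup>+x. low ?g x \<partial>M)"
    by (simp add: diff[symmetric] upp_le low_g cong: nn_integral_cong)
  also have "\<dots> = (\<integral>\<^sup>+x. ?g x \<partial>M)"
    using int_le[of ?g] B(1) by (intro nn_integral_low) (auto simp: le_less_trans diff_le_self_ennreal)
  also have "\<dots> = B - (\<integral>\<^sup>+x. f x \<partial>M)"
    by (simp add: diff B)
  also have "\<dots> = B - (\<integral>\<^sup>+x. low f x \<partial>M)"
    using int_le[of f] B by (subst nn_integral_low) (auto simp: le_less_trans)
  finally have "(\<integral>\<^sup>+x. upp f x \<partial>M) = (\<integral>\<^sup>+x. low f x \<partial>M)"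
    using ennreal_minus_cancel[OF _ upp_int low_int] B(1) by simp
  moreover have "(\<integral>\<^sup>+x. low f x \<partial>M) < \<infinity>"
    using low_int B(1) by (rule le_less_trans)
  ultimately have "(\<integral>\<^sup>+x. upp f x - low f x \<partial>M) = 0"
    by (subst nn_integral_diff) (simp_all add: low_le_upp)
  then have "AE x in M. upp f x - low f x = 0"
    by (subst (asm) nn_integral_0_iff_AE) auto
  then show ?thesis
    by eventually_elim (auto intro!: antisym simp: low_le_upp diff_eq_0_iff_ennreal)
qed

text \<open>A Markov inequality with the running averages of \<open>f\<close> in place of
  \<open>f\<close>: it bounds the effect of the unbounded part of a function at all times at
  once.\<close>

lemma weak_type_inequality:
  assumes [measurable]: "f \<in> borel_measurable M" and fin: "(\<integral>\<^sup>+x. f x \<partial>M) < \<infinity>"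
  shows "c * emeasure M (excess_set f (\<lambda>_. c)) \<le> (\<integral>\<^sup>+x. f x \<partial>M)"
proof -
  have "c * emeasure M (excess_set f (\<lambda>_. c)) = (\<integral>\<^sup>+x\<in>excess_set f (\<lambda>_. c). c \<partial>M)"
    by (simp add: nn_integral_cmult_indicator)
  also have "\<dots> \<le> (\<integral>\<^sup>+x\<in>excess_set f (\<lambda>_. c). f x \<partial>M)"
    using fin by (intro maximal_inequality) auto
  also have "\<dots> \<le> (\<integral>\<^sup>+x. f x \<partial>M)"
    by (intro nn_integral_mono) (auto simp: indicator_def)
  finally show ?thesis .
qed

text \<open>Truncate at height k. The bounded part \<open>min f k\<close> has equal upper and lower
  averages. The averages of the rest stay below e outside a set of measure at most 1/e times the
  integral of \<open>f - k\<close>, and this integral tends to 0 as k grows.\<close>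

lemma upp_le_low_eps:
  assumes f[measurable]: "f \<in> borel_measurable M" and fin: "(\<integral>\<^sup>+x. f x \<partial>M) < \<infinity>" and e: "0 < e"
  shows "AE x in M. upp f x \<le> low f x + ennreal e"
proof -
  define N where "N = {x \<in> space M. \<not> upp f x \<le> low f x + ennreal e}"
  have [measurable]: "N \<in> sets M" unfolding N_def by measurable
  have bound: "ennreal e * emeasure M N \<le> (\<integral>\<^sup>+x. f x - of_nat k \<partial>M)" for k :: nat
  proof -
    let ?h = "\<lambda>x. min (f x) (of_nat k)" and ?g = "\<lambda>x. f x - of_nat k"
    let ?E = "excess_set ?g (\<lambda>_. ennreal e)"
    \<comment> \<open>Exact also where \<open>f\<close> is infinite, because k is finite.\<close>
    have split: "f x = ?h x + ?g x" for x
    proof (cases "f x \<le> of_nat k")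
      case True
      then show ?thesis
        using le_less_trans[OF True of_nat_less_top] by (simp add: min_def diff_eq_0_iff_ennreal)
    qed (auto simp: min_def add_diff_self_ennreal)
    have g[measurable]: "?g \<in> borel_measurable M" and h[measurable]: "?h \<in> borel_measurable M" by measurable
    have "(\<integral>\<^sup>+x. ?g x \<partial>M) \<le> (\<integral>\<^sup>+x. f x \<partial>M)"
      by (intro nn_integral_mono diff_le_self_ennreal)
    then have fin_g: "(\<integral>\<^sup>+x. ?g x \<partial>M) < \<infinity>" using fin by (rule le_less_trans)
    have "AE x in M. upp ?h x = low ?h x"
      by (rule upp_eq_low_bounded[where B="of_nat k"]) (auto simp: of_nat_less_top)
    then have "AE x in M. x \<in> N \<longrightarrow> x \<in> ?E"
      using AE_space
    proof eventually_elim
      fix x assume x: "upp ?h x = low ?h x" "x \<in> space M"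
      have "upp f x \<le> low f x + ennreal e" if "x \<notin> ?E"
      proof -
        have avg: "S f n x / of_nat n \<le> ennreal e + S ?h n x / of_nat n" for n
        proof (cases "n = 0")
          case False
          have "S f n x = S ?h n x + S ?g n x"
            using x(2) S_add[of x ?h ?g n] by (simp add: split[symmetric])
          also have "S ?g n x \<le> S (\<lambda>_. ennreal e) n x"
            using mem_excess_set[of ?g "\<lambda>_. ennreal e" x n] x(2) that by (auto simp: not_less[symmetric])
          also have "\<dots> = of_nat n * ennreal e"
            using x(2) by (rule S_const)
          finally have "S f n x / of_nat n \<le> (of_nat n * ennreal e + S ?h n x) / of_nat n"
            by (intro divide_right_mono_ennreal) (simp add: add_left_mono add.commute)
          also have "\<dots> = ennreal e + S ?h n x / of_nat n"
            unfolding add_divide_distrib_ennreal using False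
            by (metis ennreal_of_nat_neq_top mult.commute mult_divide_eq_ennreal of_nat_eq_0_iff)
          finally show ?thesis .
        qed (simp add: S_def)
        have "upp f x \<le> limsup (\<lambda>n. ennreal e + S ?h n x / of_nat n)"
          unfolding upp_def by (intro Limsup_mono always_eventually allI avg)
        also have "\<dots> = ennreal e + low ?h x"
          unfolding x(1)[symmetric] upp_def by (rule Limsup_const_add) simp
        also have "low ?h x \<le> low f x"
          unfolding low_def using x(2)
          by (intro Liminf_mono always_eventually allI divide_right_mono_ennreal S_mono) auto
        finally show ?thesis by (simp add: add.commute add_left_mono)
      qed
      then show "x \<in> N \<longrightarrow> x \<in> ?E" by (auto simp: N_def)
    qed
    then have "emeasure M N \<le> emeasure M ?E"
      by (intro emeasure_mono_AE) auto
    then have "ennreal e * emeasure M N \<le> ennreal e * emeasure M ?E"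
      by (intro mult_left_mono) auto
    also have "\<dots> \<le> (\<integral>\<^sup>+x. ?g x \<partial>M)"
      using fin_g by (intro weak_type_inequality) auto
    finally show ?thesis .
  qed
  have "AE x in M. f x \<noteq> \<infinity>"
    using fin by (intro nn_integral_noteq_infinite) auto
  then have "(\<lambda>k. \<integral>\<^sup>+x. f x - of_nat k \<partial>M) \<longlonglongrightarrow> (\<integral>\<^sup>+x. 0 \<partial>M)"
  proof (intro nn_integral_dominated_convergence[where w=f])
    assume "AE x in M. f x \<noteq> \<infinity>"
    then show "AE x in M. (\<lambda>k. f x - of_nat k) \<longlonglongrightarrow> 0"
    proof eventually_elim
      fix x assume "f x \<noteq> \<infinity>"
      then obtain m :: nat where "f x < of_nat m"
        using ennreal_Ex_less_of_nat less_top by (auto simp: infinity_ennreal_def)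
      then have "\<forall>\<^sub>F k in sequentially. f x - of_nat k = 0"
        by (intro eventually_sequentiallyI[of m])
          (auto simp: diff_eq_0_iff_ennreal intro: order_trans[OF less_imp_le] less_trans of_nat_less_top)
      then show "(\<lambda>k. f x - of_nat k) \<longlonglongrightarrow> 0"
        by (rule tendsto_eventually)
    qed
  qed (use fin in \<open>auto intro: AE_I2 diff_le_self_ennreal\<close>)
  then have "ennreal e * emeasure M N \<le> 0"
    using bound by (intro LIMSEQ_le_const[of _ 0]) auto
  then have "emeasure M N = 0" using e by (simp add: ennreal_eq_0_iff)
  then show ?thesis
    by (intro AE_I'[of N]) (auto simp: N_def null_sets_def)
qed

theorem pointwise_ergodic:
  assumes f[measurable]: "f \<in> borel_measurable M" and fin: "(\<integral>\<^sup>+x. f x \<partial>M) < \<infinity>"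
  shows "AE x in M. (\<lambda>n. S f n x / of_nat n) \<longlonglongrightarrow> low f x"
proof -
  have "AE x in M. \<forall>k. upp f x \<le> low f x + ennreal (1 / Suc k)"
    unfolding AE_all_countable by (intro allI upp_le_low_eps assms) simp
  then show ?thesis
  proof eventually_elim
    fix x assume le: "\<forall>k. upp f x \<le> low f x + ennreal (1 / Suc k)"
    have "upp f x \<le> low f x"
    proof (rule ennreal_le_epsilon)
      fix e :: real assume "0 < e"
      then obtain k where "1 / Suc k < e" by (meson nat_approx_posE)
      then show "upp f x \<le> low f x + ennreal e"
        using le by (meson add_left_mono ennreal_leI less_imp_le order_trans)
    qed
    then have "upp f x = low f x" using low_le_upp by (rule antisym)
    then show "(\<lambda>n. S f n x / of_nat n) \<longlonglongrightarrow> low f x"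
      unfolding upp_def low_def by (metis tendsto_iff_Liminf_eq_Limsup sequentially_bot)
  qed
qed

end

section \<open>Random points deciding a countable family of sets\<close>

text \<open>In base 4 the digits 0 and 1 never cause a carry, so \<open>encode\<close> is invertible.\<close>

definition encode :: "(nat \<Rightarrow> 'a set) \<Rightarrow> 'a \<Rightarrow> real" where
  "encode B z = (\<Sum>k. indicat_real (B k) z / 4 ^ Suc k)"

text \<open>Reads off one base-4 digit: in the integer part of \<open>4 ^ Suc k * t\<close> all
  earlier digits contribute multiples of 4, so its parity is that of the digit at place k.\<close>

definition digit :: "nat \<Rightarrow> real \<Rightarrow> bool" where
  "digit k t \<longleftrightarrow> odd \<lfloor>4 ^ Suc k * t\<rfloor>"

lemma summable_encode: "summable (\<lambda>k. indicat_real (B k) z / 4 ^ Suc k)"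
proof (rule summable_comparison_test'[where N=0])
  show "summable (\<lambda>k. (1 / 4) * (1 / 4 :: real) ^ k)"
    by (intro summable_mult summable_geometric) auto
qed (auto simp: indicator_def power_divide)

text \<open>The bound 1/3 is the sum of all place values. What follows any digit therefore fills at
  most a third of a unit interval, and the remaining gap makes decoding stable.\<close>

lemma encode_bounds: "0 \<le> encode B z" "encode B z \<le> 1 / 3"
proof -
  show "0 \<le> encode B z"
    unfolding encode_def by (intro suminf_nonneg summable_encode) auto
  have "(\<lambda>k. (1 / 4) * (1 / 4 :: real) ^ k) sums ((1 / 4) * (1 / (1 - 1 / 4)))"
    by (intro sums_mult geometric_sums) auto
  then have s: "(\<lambda>k. 1 / 4 ^ Suc k :: real) sums (1 / 3)"
    by (simp add: power_divide)
  show "encode B z \<le> 1 / 3"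
    unfolding encode_def sums_unique[OF s]
    by (intro suminf_le summable_encode sums_summable[OF s]) (auto simp: indicator_def divide_right_mono)
qed

lemma encode_Suc: "4 * encode B z = indicat_real (B 0) z + encode (\<lambda>k. B (Suc k)) z"
proof -
  have "encode B z = indicat_real (B 0) z / 4 + (\<Sum>k. indicat_real (B (Suc k)) z / 4 ^ Suc (Suc k))"
    unfolding encode_def by (subst suminf_split_head[OF summable_encode]) simp
  also have "(\<Sum>k. indicat_real (B (Suc k)) z / 4 ^ Suc (Suc k)) = encode (\<lambda>k. B (Suc k)) z / 4"
    unfolding encode_def
    by (subst suminf_divide[symmetric, OF summable_encode]) (simp add: mult.commute)
  finally show ?thesis by simp
qed

text \<open>Multiplication by 4 drops the first set of the family (\<open>encode_Suc\<close>), so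
  the induction runs over all families; the remainder \<open>r\<close> is again a code, hence at
  most 1/3.\<close>

lemma encode_digits:
  "\<exists>N::int. \<exists>r. 4 ^ Suc k * encode B z = of_int N + r \<and> 0 \<le> r \<and> r \<le> 1 / 3 \<and> (odd N \<longleftrightarrow> z \<in> B k)"
proof (induction k arbitrary: B)
  case 0
  show ?case
    using encode_Suc[of B z] encode_bounds[of "\<lambda>k. B (Suc k)" z]
    by (intro exI[of _ "if z \<in> B 0 then 1 else 0"] exI[of _ "encode (\<lambda>k. B (Suc k)) z"]) auto
next
  case (Suc k)
  from Suc[of "\<lambda>k. B (Suc k)"] obtain N :: int and r
    where N: "4 ^ Suc k * encode (\<lambda>k. B (Suc k)) z = of_int N + r" "0 \<le> r" "r \<le> 1 / 3" "odd N \<longleftrightarrow> z \<in> B (Suc k)"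
    by blast
  have "4 ^ Suc (Suc k) * encode B z = 4 ^ Suc k * (4 * encode B z)" by simp
  also have "\<dots> = of_int ((if z \<in> B 0 then 4 ^ Suc k else 0) + N) + r"
    unfolding encode_Suc by (auto simp: distrib_left N(1)[simplified])
  finally show ?case
    using N by (intro exI[of _ "(if z \<in> B 0 then 4 ^ Suc k else 0) + N"] exI[of _ r]) auto
qed

lemma digit_encode: "digit k (encode B z) \<longleftrightarrow> z \<in> B k"
proof -
  obtain N :: int and r where N: "4 ^ Suc k * encode B z = of_int N + r" "0 \<le> r" "r \<le> 1 / 3" "odd N \<longleftrightarrow> z \<in> B k"
    using encode_digits[of k B z] by blast
  have "\<lfloor>4 ^ Suc k * encode B z\<rfloor> = N"
    unfolding N(1) using N(2,3) by (intro floor_unique) auto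
  then show ?thesis unfolding digit_def using N(4) by simp
qed

text \<open>Integer parts jump in general, but here both remainders lie in [0, 1/3] and the scaled
  values are less than 1/3 apart, so the integer parts differ by less than 2/3.\<close>

lemma encode_close:
  assumes "\<bar>encode B z - encode B z'\<bar> < 1 / 3 / 4 ^ Suc k"
  shows "z \<in> B k \<longleftrightarrow> z' \<in> B k"
proof -
  obtain N :: int and r where N: "4 ^ Suc k * encode B z = of_int N + r" "0 \<le> r" "r \<le> 1 / 3" "odd N \<longleftrightarrow> z \<in> B k"
    using encode_digits[of k B z] by blast
  obtain N' :: int and r' where N': "4 ^ Suc k * encode B z' = of_int N' + r'" "0 \<le> r'" "r' \<le> 1 / 3" "odd N' \<longleftrightarrow> z' \<in> B k"
    using encode_digits[of k B z'] by blast
  have "\<bar>4 ^ Suc k * encode B z - 4 ^ Suc k * encode B z'\<bar> = 4 ^ Suc k * \<bar>encode B z - encode B z'\<bar>"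
    unfolding right_diff_distrib[symmetric] abs_mult by simp
  also have "\<dots> < 1 / 3"
    using assms by (simp add: field_simps)
  finally have "\<bar>(of_int N + r) - (of_int N' + r')\<bar> < 1 / 3"
    unfolding N(1) N'(1) .
  then have "\<bar>of_int N - of_int N' :: real\<bar> < 1"
    using N(2,3) N'(2,3) by linarith
  then have "N = N'" by linarith
  then show ?thesis using N(4) N'(4) by simp
qed

lemma measurable_encode [measurable]:
  assumes [measurable]: "\<And>k. B k \<in> sets M"
  shows "encode B \<in> borel_measurable M"
  unfolding encode_def[abs_def] by measurable

lemma measurable_digit [measurable]: "Measurable.pred borel (digit k)"
proof -
  have "(\<lambda>t::real. \<lfloor>4 ^ Suc k * t\<rfloor>) \<in> borel \<rightarrow>\<^sub>M count_space UNIV"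
    by measurable
  then show ?thesis
    unfolding digit_def[abs_def] by (rule measurable_compose) simp
qed

text \<open>Equivalently, the indicator of \<open>A\<close> converges along \<open>z\<close>. For a
  countable family of sets this is convergence in the compactification generated by their
  indicators.\<close>

abbreviation eventually_decided :: "(nat \<Rightarrow> 'a) \<Rightarrow> 'a set \<Rightarrow> bool" where
  "eventually_decided z A \<equiv> (\<forall>\<^sub>F n in sequentially. z n \<in> A) \<or> (\<forall>\<^sub>F n in sequentially. z n \<notin> A)"

text \<open>The limit \<open>y\<close> need not be the code of a point: the Cauchy property
  suffices, so escaping sequences are covered too.\<close>

lemma encode_convergent_eventually_decided:
  assumes "(\<lambda>n. encode B (z n)) \<longlonglongrightarrow> y"
  shows "eventually_decided z (B k)"
proof -
  have "Cauchy (\<lambda>n. encode B (z n))"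
    using assms by (rule LIMSEQ_imp_Cauchy)
  then obtain N where N: "\<And>m n. m \<ge> N \<Longrightarrow> n \<ge> N \<Longrightarrow> \<bar>encode B (z m) - encode B (z n)\<bar> < 1 / 3 / 4 ^ Suc k"
    unfolding Cauchy_def dist_real_def by (meson divide_pos_pos zero_less_numeral zero_less_one zero_less_power)
  then have "n \<ge> N \<Longrightarrow> z n \<in> B k \<longleftrightarrow> z N \<in> B k" for n
    by (intro encode_close) auto
  then show ?thesis
    unfolding eventually_sequentially by metis
qed

section \<open>A countable base of balls and the recovery of points from codes\<close>

definition dense_seq :: "nat \<Rightarrow> 'a::second_countable_topology" where
  "dense_seq = from_nat_into (SOME D. countable D \<and> (\<forall>X. open X \<longrightarrow> X \<noteq> {} \<longrightarrow> (\<exists>d\<in>D. d \<in> X)))"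

lemma dense_seq_in_open:
  fixes X :: "'a::second_countable_topology set"
  assumes "open X" "X \<noteq> {}"
  shows "\<exists>i. dense_seq i \<in> X"
proof -
  define D :: "'a set" where "D = (SOME D. countable D \<and> (\<forall>X. open X \<longrightarrow> X \<noteq> {} \<longrightarrow> (\<exists>d\<in>D. d \<in> X)))"
  have D: "countable D \<and> (\<forall>X. open X \<longrightarrow> X \<noteq> {} \<longrightarrow> (\<exists>d\<in>D. d \<in> X))"
    unfolding D_def by (rule someI_ex) (rule countable_dense_exists)
  then obtain d where "d \<in> D" "d \<in> X" using assms by blast
  then show ?thesis
    using from_nat_into_surj[of D d] D unfolding dense_seq_def D_def[symmetric] by auto
qed

definition sball :: "nat \<Rightarrow> nat \<Rightarrow> 'a::{metric_space, second_countable_topology} set" where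
  "sball i n = ball (dense_seq i) (inverse (real (Suc n)))"

lemma mem_sball: "\<exists>i. z \<in> sball i n"
  using dense_seq_in_open[of "ball z (inverse (real (Suc n)))"]
  by (auto simp: sball_def dist_commute)

lemma sets_sball [measurable]: "sball i n \<in> sets borel"
  by (simp add: sball_def)

text \<open>\<open>c i n\<close> is the position of \<open>sball i n\<close> in the encoded family.
  The point is approached by the first centres whose balls of radius 1/(n+1) are recorded as
  containing it; the default makes the map total on reals that are not codes.\<close>

definition decode :: "(nat \<Rightarrow> nat \<Rightarrow> nat) \<Rightarrow> real \<Rightarrow> 'a::{complete_space, second_countable_topology}" where
  "decode c t = (let s = (\<lambda>n. dense_seq (LEAST i. digit (c i n) t)) in if Cauchy s then lim s else dense_seq 0)"

lemma measurable_decode [measurable]: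
  "(decode c :: real \<Rightarrow> 'a::{complete_space, second_countable_topology}) \<in> borel_measurable borel"
proof -
  define s :: "nat \<Rightarrow> real \<Rightarrow> 'a" where "s n t = dense_seq (LEAST i. digit (c i n) t)" for n t
  have [measurable]: "s n \<in> borel_measurable borel" for n
  proof -
    have "(\<lambda>t. LEAST i. digit (c i n) t) \<in> borel \<rightarrow>\<^sub>M count_space UNIV"
      by measurable
    then show ?thesis
      unfolding s_def by (rule measurable_compose) simp
  qed
  have "(decode c t :: 'a) = (if Cauchy (\<lambda>n. s n t) then lim (\<lambda>n. s n t) else dense_seq 0)" for t
    by (simp add: decode_def s_def Let_def)
  then have "(decode c :: real \<Rightarrow> 'a) = (\<lambda>t. if Cauchy (\<lambda>n. s n t) then lim (\<lambda>n. s n t) else dense_seq 0)"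
    by auto
  moreover have "\<dots> \<in> borel_measurable borel"
  proof (rule borel_measurable_LIMSEQ_metric)
    show "(\<lambda>t. if Cauchy (\<lambda>n. s n t) then s i t else dense_seq 0) \<in> borel_measurable borel" for i
      by measurable
    show "(\<lambda>i. if Cauchy (\<lambda>n. s n t) then s i t else dense_seq 0)
        \<longlonglongrightarrow> (if Cauchy (\<lambda>n. s n t) then lim (\<lambda>n. s n t) else dense_seq 0)" for t
      by (simp add: Cauchy_convergent_iff convergent_LIMSEQ_iff)
  qed
  ultimately show ?thesis by simp
qed

lemma decode_encode:
  fixes z :: "'a::{complete_space, second_countable_topology}"
  assumes c: "\<And>i n. B (c i n) = sball i n"
  shows "decode c (encode B z) = z"
proof -
  define s :: "nat \<Rightarrow> 'a" where "s n = dense_seq (LEAST i. z \<in> sball i n)" for n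
  have "dist (s n) z < inverse (real (Suc n))" for n
    using LeastI_ex[OF mem_sball[of z n]] by (simp add: s_def sball_def)
  then have "s \<longlonglongrightarrow> z"
    by (intro metric_tendsto_imp_tendsto[OF LIMSEQ_inverse_real_of_nat])
      (auto intro!: always_eventually less_imp_le simp: dist_real_def)
  then show ?thesis
    by (auto simp: decode_def digit_encode c s_def[symmetric, abs_def] Let_def limI dest: LIMSEQ_imp_Cauchy)
qed

text \<open>
  Replaces weak compactness of the laws on a metrizable compactification: the encoding by reals
  reduces it to the theorems of Helly and Skorohod on the line.
\<close>

lemma eventually_deciding_representation:
  fixes \<mu> :: "nat \<Rightarrow> 'a::{complete_space, second_countable_topology} measure"
    and B :: "nat \<Rightarrow> 'a set"
  assumes \<mu>: "\<And>n. prob_space (\<mu> n)" "\<And>n. sets (\<mu> n) = sets borel"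
    and B: "\<And>k. B k \<in> sets borel" and c: "\<And>i n. B (c i n) = sball i n"
  obtains \<Omega> :: "real measure" and r :: "nat \<Rightarrow> nat" and Z :: "nat \<Rightarrow> real \<Rightarrow> 'a"
  where "prob_space \<Omega>" "strict_mono r" "\<And>n. Z n \<in> \<Omega> \<rightarrow>\<^sub>M borel" "\<And>n. distr \<Omega> borel (Z n) = \<mu> (r n)"
    "AE \<omega> in \<Omega>. \<forall>k. eventually_decided (\<lambda>n. Z n \<omega>) (B k)"
proof -
  have e[measurable]: "encode B \<in> borel_measurable borel"
    using B by (rule measurable_encode)
  have e'[measurable]: "encode B \<in> borel_measurable (\<mu> n)" for n
    using e by (simp cong: measurable_cong_sets add: \<mu>)
  define \<nu> where "\<nu> n = distr (\<mu> n) borel (encode B)" for n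
  have prob: "prob_space (\<nu> n)" for n
    unfolding \<nu>_def by (intro prob_space.prob_space_distr \<mu> e')
  have real: "real_distribution (\<nu> n)" for n
    by (intro real_distribution.intro prob real_distribution_axioms.intro) (simp add: \<nu>_def)
  have "measure (\<nu> n) {-1<..1} = 1" for n
  proof -
    have "encode B -` {-1<..1} \<inter> space (\<mu> n) = space (\<mu> n)"
    proof -
      have "-1 < encode B z" "encode B z \<le> 1" for z
        using encode_bounds[of B z] by linarith+
      then show ?thesis by auto
    qed
    then show ?thesis
      by (simp add: \<nu>_def measure_distr prob_space.prob_space[OF \<mu>(1)])
  qed
  then have "\<exists>a b. a < b \<and> (\<forall>n. 1 - \<epsilon> < measure (\<nu> n) {a<..b})" if "0 < \<epsilon>" for \<epsilon>
    using that by (intro exI[of _ "-1"] exI[of _ 1]) simp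
  \<comment> \<open>Codes lie in [0, 1/3], so tightness on the line is automatic, however much mass
    the measures \<open>\<mu> n\<close> send to infinity in the original space.\<close>
  then have "tight \<nu>"
    unfolding tight_def using real by auto
  then obtain r M where r: "strict_mono r" and M: "real_distribution M" "weak_conv_m (\<nu> \<circ> id \<circ> r) M"
    using tight_imp_convergent_subsubsequence[of \<nu> id] by (auto simp: strict_mono_def)
  obtain \<Omega> :: "real measure" and Y :: "nat \<Rightarrow> real \<Rightarrow> real" and Y' where
    \<Omega>: "prob_space \<Omega>" "\<And>n. Y n \<in> borel_measurable \<Omega>" "\<And>n. distr \<Omega> borel (Y n) = \<nu> (r n)"
      "\<And>\<omega>. \<omega> \<in> space \<Omega> \<Longrightarrow> (\<lambda>n. Y n \<omega>) \<longlonglongrightarrow> Y' \<omega>"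
    using Skorohod[OF _ M] real by (auto simp: measurable_lborel1 comp_def)  metis
  note \<Omega>(2)[measurable]
  define Z where "Z n \<omega> = (decode c (Y n \<omega>) :: 'a)" for n \<omega>
  have Z[measurable]: "Z n \<in> \<Omega> \<rightarrow>\<^sub>M borel" for n
    unfolding Z_def by measurable
  \<comment> \<open>\<open>Y n\<close> has the law of a code, so almost surely it is one and
    survives decoding followed by encoding.\<close>
  have "AE \<omega> in \<Omega>. \<forall>n. encode B (Z n \<omega>) = Y n \<omega>"
    unfolding AE_all_countable
  proof
    fix n
    have "AE t in \<nu> (r n). encode B (decode c t :: 'a) = t"
      unfolding \<nu>_def by (subst AE_distr_iff) (auto simp: decode_encode[OF c])
    then show "AE \<omega> in \<Omega>. encode B (Z n \<omega>) = Y n \<omega>"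
      unfolding \<Omega>(3)[symmetric] Z_def by (subst (asm) AE_distr_iff) auto
  qed
  then have dec: "AE \<omega> in \<Omega>. \<forall>k. eventually_decided (\<lambda>n. Z n \<omega>) (B k)"
    using AE_space
  proof eventually_elim
    fix \<omega> assume "\<forall>n. encode B (Z n \<omega>) = Y n \<omega>" "\<omega> \<in> space \<Omega>"
    then have "(\<lambda>n. encode B (Z n \<omega>)) \<longlonglongrightarrow> Y' \<omega>"
      using \<Omega>(4) by simp
    then show "\<forall>k. eventually_decided (\<lambda>n. Z n \<omega>) (B k)"
      by (intro allI encode_convergent_eventually_decided)
  qed
  have law: "distr \<Omega> borel (Z n) = \<mu> (r n)" for n
  proof -
    have "distr \<Omega> borel (Z n) = distr (distr \<Omega> borel (Y n)) borel (decode c)"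
      by (simp add: distr_distr comp_def Z_def[abs_def])
    also have "\<dots> = distr (\<mu> (r n)) borel (\<lambda>z. decode c (encode B z))"
      by (simp add: \<Omega>(3) \<nu>_def distr_distr comp_def)
    also have "\<dots> = distr (\<mu> (r n)) (\<mu> (r n)) (\<lambda>z. z)"
      by (intro distr_cong) (auto simp: decode_encode[OF c] \<mu>)
    finally show ?thesis by simp
  qed
  show thesis by (rule that[OF \<Omega>(1) r Z law dec])
qed

section \<open>Disintegration of measures\<close>

text \<open>On the set where \<open>g < f\<close> the hypothesis forces the integral of the positive
  function \<open>f - g\<close> to vanish, so this set is null.\<close>

lemma AE_le_if_nn_integral_le:
  assumes [measurable]: "f \<in> borel_measurable M" "g \<in> borel_measurable M"
    and fin: "(\<integral>\<^sup>+x. f x \<partial>M) < \<infinity>"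
    and le: "\<And>A. A \<in> sets M \<Longrightarrow> (\<integral>\<^sup>+x\<in>A. f x \<partial>M) \<le> (\<integral>\<^sup>+x\<in>A. g x \<partial>M)"
  shows "AE x in M. f x \<le> g x"
proof -
  define A where "A = {x \<in> space M. g x < f x}"
  have [measurable]: "A \<in> sets M" unfolding A_def by measurable
  have "(\<integral>\<^sup>+x\<in>A. g x \<partial>M) \<le> (\<integral>\<^sup>+x. f x \<partial>M)"
    by (intro nn_integral_mono) (auto simp: A_def indicator_def)
  then have "(\<integral>\<^sup>+x\<in>A. g x \<partial>M) < \<infinity>"
    using fin by (rule le_less_trans)
  then have "(\<integral>\<^sup>+x. f x * indicator A x - g x * indicator A x \<partial>M) =
      (\<integral>\<^sup>+x\<in>A. f x \<partial>M) - (\<integral>\<^sup>+x\<in>A. g x \<partial>M)"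
    by (intro nn_integral_diff) (auto simp: A_def indicator_def)
  also have "\<dots> = 0"
    using le[of A] by (simp add: diff_eq_0_iff_ennreal) (metis le infinity_ennreal_def fin \<open>(\<integral>\<^sup>+x\<in>A. g x \<partial>M) < \<infinity>\<close> \<open>A \<in> sets M\<close> le_less_trans)
  finally have "AE x in M. f x * indicator A x - g x * indicator A x = 0"
    by (subst (asm) nn_integral_0_iff_AE) auto
  then show ?thesis
    using AE_space
  proof eventually_elim
    fix x assume x: "f x * indicator A x - g x * indicator A x = 0" "x \<in> space M"
    show "f x \<le> g x"
    proof (rule ccontr)
      assume "\<not> f x \<le> g x"
      with x show False
        by (auto simp: A_def diff_eq_0_iff_ennreal)
    qed
  qed
qed

text \<open>Radon-Nikodym supplies conditional probabilities of the half-lines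
  \<open>{q<..}\<close>. Restricting to rational q keeps the union of the exceptional null sets
  null. The kernel is the image of Lebesgue measure under a quantile function, hence a probability
  measure at every x without corrections on null sets.\<close>

lemma disintegration_real_measure:
  fixes N :: "('a \<times> real) measure"
  assumes N: "prob_space N" "sets N = sets (M \<Otimes>\<^sub>M borel)"
    and bnd: "AE z in N. 0 \<le> snd z \<and> snd z \<le> 1"
  obtains v where "v \<in> M \<rightarrow>\<^sub>M prob_algebra borel"
    "N = distr N M fst \<bind> (\<lambda>x. distr (v x) (M \<Otimes>\<^sub>M borel) (Pair x))"
proof -
  define \<pi> where "\<pi> = distr N M fst"
  interpret N: prob_space N by fact
  note [measurable_cong] = N(2)
  have fst_N[measurable]: "fst \<in> N \<rightarrow>\<^sub>M M" and snd_N[measurable]: "snd \<in> N \<rightarrow>\<^sub>M borel"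
    by measurable
  have space_N: "space N = space M \<times> UNIV"
    using sets_eq_imp_space_eq[OF N(2)] by (simp add: space_pair_measure)
  interpret \<pi>: prob_space \<pi> unfolding \<pi>_def by (intro N.prob_space_distr fst_N)
  have sets_\<pi>[measurable_cong, simp]: "sets \<pi> = sets M" by (simp add: \<pi>_def)
  have space_\<pi>[simp]: "space \<pi> = space M" by (simp add: \<pi>_def)
  have rect[measurable]: "A \<times> B \<in> sets N" if "A \<in> sets M" "B \<in> sets borel" for A and B :: "real set"
    using that unfolding N(2) by auto
  have \<pi>_eq: "emeasure \<pi> A = emeasure N (A \<times> UNIV)" if "A \<in> sets M" for A
    unfolding \<pi>_def using that sets.sets_into_space[OF that]
    by (subst emeasure_distr) (auto simp: space_N intro!: arg_cong[where f="emeasure N"])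

  \<comment> \<open>The first marginal of \<open>N\<close> restricted to \<open>q < snd\<close>; its
    density with respect to \<open>\<pi>\<close> is the conditional probability of
    \<open>{q<..}\<close>.\<close>
  define \<nu> where "\<nu> q = distr (density N (indicator {z \<in> space N. q < snd z})) M fst" for q :: real
  have \<nu>: "emeasure (\<nu> q) A = emeasure N (A \<times> {q<..})" if A: "A \<in> sets M" for q A
  proof -
    have "emeasure (\<nu> q) A = emeasure (density N (indicator {z \<in> space N. q < snd z})) (fst -` A \<inter> space N)"
      using A by (simp add: \<nu>_def emeasure_distr)
    also have "\<dots> = emeasure N ({z \<in> space N. q < snd z} \<inter> (fst -` A \<inter> space N))"
      using A by (subst emeasure_density) (auto simp: nn_integral_indicator[symmetric] indicator_def intro!: nn_integral_cong simp del: nn_integral_indicator)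
    also have "{z \<in> space N. q < snd z} \<inter> (fst -` A \<inter> space N) = A \<times> {q<..}"
      using sets.sets_into_space[OF A] by (auto simp: space_N)
    finally show ?thesis .
  qed
  have ac: "absolutely_continuous \<pi> (\<nu> q)" for q
  proof (unfold absolutely_continuous_def, intro subsetI)
    fix A assume "A \<in> null_sets \<pi>"
    then have A: "A \<in> sets M" "emeasure N (A \<times> UNIV) = 0"
      by (auto simp: null_sets_def \<pi>_eq)
    have "emeasure N (A \<times> {q<..}) \<le> emeasure N (A \<times> UNIV)"
      using A(1) by (intro emeasure_mono) (auto simp: N(2))
    then show "A \<in> null_sets (\<nu> q)"
      using A by (auto simp: null_sets_def \<nu>) (simp add: \<nu>_def)
  qed
  define f where "f q = RN_deriv \<pi> (\<nu> q)" for q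
  have [measurable]: "f q \<in> borel_measurable M" for q
    using borel_measurable_RN_deriv[of \<pi> "\<nu> q"] by (simp add: f_def cong: measurable_cong_sets)
  have f: "(\<integral>\<^sup>+x\<in>A. f q x \<partial>\<pi>) = emeasure N (A \<times> {q<..})" if [measurable]: "A \<in> sets M" for A q
  proof -
    have "density \<pi> (f q) = \<nu> q"
      unfolding f_def by (intro \<pi>.density_RN_deriv ac) (simp add: \<nu>_def)
    then show ?thesis
      by (simp add: \<nu>[OF that, symmetric] emeasure_density flip: \<open>density \<pi> (f q) = \<nu> q\<close>)
  qed
  have f_le: "AE x in \<pi>. f q x \<le> 1" for q
  proof (rule AE_le_if_nn_integral_le)
    have "(\<integral>\<^sup>+x. f q x \<partial>\<pi>) = (\<integral>\<^sup>+x\<in>space M. f q x \<partial>\<pi>)"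
      by (intro nn_integral_cong) auto
    then show "(\<integral>\<^sup>+x. f q x \<partial>\<pi>) < \<infinity>"
      using N.emeasure_finite by (simp add: f less_top[symmetric])
    show "(\<integral>\<^sup>+x\<in>A. f q x \<partial>\<pi>) \<le> (\<integral>\<^sup>+x\<in>A. 1 \<partial>\<pi>)" if "A \<in> sets \<pi>" for A
      using that by (simp add: f \<pi>_eq) (intro emeasure_mono, auto simp: N(2))
  qed measurable
  \<comment> \<open>a version of the conditional probability of \<open>{q<..}\<close>; \<open>J\<close> below is its quantile transform\<close>
  define F where "F q x = (if q < 0 then 1 else if 1 \<le> q then 0 else min 1 (f q x))" for q x
  have [measurable]: "F q \<in> borel_measurable M" for q unfolding F_def[abs_def] by measurable
  have F_le: "F q x \<le> 1" for q x by (simp add: F_def)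
  have F: "(\<integral>\<^sup>+x\<in>A. F q x \<partial>\<pi>) = emeasure N (A \<times> {q<..})" if A[measurable]: "A \<in> sets M" for A q
  proof -
    consider "q < 0" | "1 \<le> q" | "0 \<le> q" "q < 1" by linarith
    then show ?thesis
    proof cases
      case 1
      have "emeasure N (A \<times> {q<..}) = emeasure N (A \<times> UNIV)"
        using bnd by (intro emeasure_eq_AE) (use 1 in \<open>auto simp: N(2) elim!: eventually_mono\<close>)
      with 1 show ?thesis by (simp add: F_def \<pi>_eq)
    next
      case 2
      have "emeasure N (A \<times> {q<..}) = emeasure N {}"
      proof (rule emeasure_eq_AE)
        show "AE z in N. (z \<in> A \<times> {q<..}) = (z \<in> {})"
          using bnd by eventually_elim (use 2 in auto)
      qed auto
      with 2 show ?thesis by (simp add: F_def)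
    next
      case 3
      have "(\<integral>\<^sup>+x\<in>A. F q x \<partial>\<pi>) = (\<integral>\<^sup>+x\<in>A. f q x \<partial>\<pi>)"
        using f_le[of q] by (intro nn_integral_cong_AE, eventually_elim) (use 3 in \<open>auto simp: F_def\<close>)
      with 3 show ?thesis by (simp add: f)
    qed
  qed
  have "AE x in \<pi>. F r x \<le> F q x" if "q \<le> r" for q r
  proof (rule AE_le_if_nn_integral_le)
    have "(\<integral>\<^sup>+x. F r x \<partial>\<pi>) \<le> (\<integral>\<^sup>+x. 1 \<partial>\<pi>)"
      by (intro nn_integral_mono F_le)
    then show "(\<integral>\<^sup>+x. F r x \<partial>\<pi>) < \<infinity>"
      using \<pi>.emeasure_space_1 by (simp add: le_less_trans)
    show "(\<integral>\<^sup>+x\<in>A. F r x \<partial>\<pi>) \<le> (\<integral>\<^sup>+x\<in>A. F q x \<partial>\<pi>)" if "A \<in> sets \<pi>" for A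
      using that \<open>q \<le> r\<close> by (simp add: F) (intro emeasure_mono, auto simp: N(2))
  qed measurable
  then have "AE x in \<pi>. q \<le> r \<longrightarrow> F r x \<le> F q x" for q r by (cases "q \<le> r") auto
  then have anti: "AE x in \<pi>. \<forall>q\<in>\<rat>. \<forall>r\<in>\<rat>. q \<le> r \<longrightarrow> F r x \<le> F q x"
    by (simp add: AE_ball_countable countable_rat)

  let ?L = "restrict_space lborel {0<..<1::real}"
  define J where "J x \<omega> = Sup {q \<in> \<rat>. ennreal \<omega> < F q x}" for x and \<omega> :: real
  \<comment> \<open>The prescribed values of \<open>F\<close> outside [0, 1) keep the set under the
    supremum nonempty (it contains -1) and bounded above by 1, at every x.\<close>
  have J_less: "s < J x \<omega> \<longleftrightarrow> (\<exists>q\<in>\<rat>. s < q \<and> ennreal \<omega> < F q x)" if "0 < \<omega>" "\<omega> < 1" for s x \<omega>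
  proof -
    have "-1 \<in> {q \<in> \<rat>. ennreal \<omega> < F q x}" using that by (simp add: F_def ennreal_less_one_iff)
    moreover have "bdd_above {q \<in> \<rat>. ennreal \<omega> < F q x}"
      by (intro bdd_aboveI[of _ 1]) (auto simp: F_def not_less split: if_splits)
    ultimately show ?thesis
      unfolding J_def using less_cSup_iff[of "{q \<in> \<rat>. ennreal \<omega> < F q x}" s] by blast
  qed
  have prob_L: "prob_space ?L"
    by (auto simp: emeasure_restrict_space space_restrict_space intro!: prob_spaceI)
  have J_meas: "(\<lambda>(x, \<omega>). J x \<omega>) \<in> borel_measurable (M \<Otimes>\<^sub>M ?L)"
  proof (rule borel_measurableI_greater)
    fix s :: real
    have sp: "\<omega> \<in> {0<..<1}" if "z \<in> space (M \<Otimes>\<^sub>M ?L)" "z = (x, \<omega>)" for z x \<omega>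
      using that by (auto simp: space_pair_measure space_restrict_space)
    have [measurable]: "(\<lambda>z. snd z) \<in> borel_measurable (M \<Otimes>\<^sub>M ?L)"
      by (rule measurable_compose[OF measurable_snd]) (simp add: measurable_restrict_space1)
    have "{z \<in> space (M \<Otimes>\<^sub>M ?L). s < (case z of (x, \<omega>) \<Rightarrow> J x \<omega>)} =
        (\<Union>q\<in>\<rat> \<inter> {s<..}. {z \<in> space (M \<Otimes>\<^sub>M ?L). ennreal (snd z) < F q (fst z)})"
      using sp by (fastforce simp: J_less)
    also have "\<dots> \<in> sets (M \<Otimes>\<^sub>M ?L)"
      by (intro sets.countable_UN') (auto simp: countable_rat)
    finally show "{z \<in> space (M \<Otimes>\<^sub>M ?L). s < (case z of (x, \<omega>) \<Rightarrow> J x \<omega>)} \<in> sets (M \<Otimes>\<^sub>M ?L)" .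
  qed
  define v where "v x = distr ?L borel (J x)" for x
  have v: "v \<in> M \<rightarrow>\<^sub>M prob_algebra borel"
    unfolding v_def
    by (rule measurable_distr_prob_space2[where M="?L"]) (auto intro!: J_meas simp: space_prob_algebra prob_L)
  \<comment> \<open>The event \<open>s < J x \<omega>\<close> is the interval from 0 to
    \<open>m\<close>, of Lebesgue measure \<open>m\<close>. This holds at every x; almost sure
    monotonicity of \<open>F\<close> in q enters only afterwards.\<close>
  have v_eq: "emeasure (v x) {s<..} = (SUP q\<in>\<rat> \<inter> {s<..}. F q x)" if x: "x \<in> space M" for x s
  proof -
    define m where "m = (SUP q\<in>\<rat> \<inter> {s<..}. F q x)"
    have "m \<le> 1" unfolding m_def by (intro SUP_least F_le)
    then obtain c where c: "m = ennreal c" "0 \<le> c" "c \<le> 1"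
      by (cases m) (auto simp: top_unique)
    have "J x \<in> borel_measurable ?L"
      using measurable_compose_Pair1[OF x J_meas] by simp
    then have "emeasure (v x) {s<..} = emeasure ?L (J x -` {s<..} \<inter> {0<..<1})"
      by (simp add: v_def emeasure_distr space_restrict_space)
    also have "J x -` {s<..} \<inter> {0<..<1} = {0<..<c}"
    proof -
      have "s < J x \<omega> \<longleftrightarrow> \<omega> < c" if "\<omega> \<in> {0<..<1}" for \<omega>
      proof -
        have "s < J x \<omega> \<longleftrightarrow> ennreal \<omega> < m"
          using that by (auto simp: J_less m_def less_SUP_iff)
        also have "\<dots> \<longleftrightarrow> \<omega> < c"
          using that by (simp add: c(1) ennreal_less_iff)
        finally show ?thesis .
      qed
      with c show ?thesis by auto
    qed
    also have "emeasure ?L {0<..<c} = ennreal c"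
      using c by (subst emeasure_restrict_space) auto
    finally show ?thesis unfolding c(1)[symmetric] m_def .
  qed
  have eq: "emeasure N (A \<times> {s<..}) = (\<integral>\<^sup>+x\<in>A. emeasure (v x) {s<..} \<partial>\<pi>)"
    if A[measurable]: "A \<in> sets M" for A s
  proof -
    \<comment> \<open>Rationals squeezed between s + 1/(n+2) and s + 1/(n+1) decrease to s. Along
      them the supremum over all rationals above s is a monotone limit, which passes through the
      integral.\<close>
    have "\<exists>q. q \<in> \<rat> \<and> s + inverse (real (Suc (Suc n))) < q \<and> q < s + inverse (real (Suc n))" for n
      using Rats_dense_in_real[of "s + inverse (real (Suc (Suc n)))" "s + inverse (real (Suc n))"] by auto
    then obtain q where q: "\<And>n. q n \<in> \<rat>" "\<And>n. s + inverse (real (Suc (Suc n))) < q n" "\<And>n. q n < s + inverse (real (Suc n))"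
      by metis
    have dec: "q (Suc n) \<le> q n" for n
      using q(2)[of n] q(3)[of "Suc n"] by linarith
    have q_gt: "s < q n" for n
      using q(2)[of n] by (rule less_trans[rotated]) simp
    have q_ev: "\<exists>n. q n < t" if st: "s < t" for t
    proof -
      obtain n where "inverse (real (Suc n)) < t - s"
        using reals_Archimedean[of "t - s"] st by auto
      then have "q n < t" using q(3)[of n] by linarith
      then show ?thesis ..
    qed
    have "(\<integral>\<^sup>+x\<in>A. emeasure (v x) {s<..} \<partial>\<pi>) = (\<integral>\<^sup>+x. (SUP n. F (q n) x * indicator A x) \<partial>\<pi>)"
    proof (intro nn_integral_cong_AE)
      show "AE x in \<pi>. emeasure (v x) {s<..} * indicator A x = (SUP n. F (q n) x * indicator A x)"
        using anti AE_space
      proof eventually_elim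
        fix x assume x: "\<forall>q\<in>\<rat>. \<forall>r\<in>\<rat>. q \<le> r \<longrightarrow> F r x \<le> F q x" "x \<in> space \<pi>"
        have "(SUP q\<in>\<rat> \<inter> {s<..}. F q x) = (SUP n. F (q n) x)"
        proof (intro antisym SUP_least)
          fix t assume t: "t \<in> \<rat> \<inter> {s<..}"
          then obtain n where "q n < t" using q_ev by auto
          then show "F t x \<le> (SUP n. F (q n) x)"
            using x(1) q(1)[of n] t by (intro SUP_upper2[of n]) auto
        qed (use q(1) q_gt in \<open>auto intro: SUP_upper\<close>)
        with x(2) show "emeasure (v x) {s<..} * indicator A x = (SUP n. F (q n) x * indicator A x)"
          by (simp add: v_eq SUP_mult_right_ennreal indicator_def)
      qed
    qed
    also have "\<dots> = (SUP n. \<integral>\<^sup>+x\<in>A. F (q n) x \<partial>\<pi>)"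
    proof (rule nn_integral_monotone_convergence_SUP_AE)
      show "AE x in \<pi>. F (q i) x * indicator A x \<le> F (q (Suc i)) x * indicator A x" for i
        using anti by eventually_elim (use q(1) dec in \<open>auto intro!: mult_right_mono\<close>)
    qed measurable
    also have "\<dots> = (SUP n. emeasure N (A \<times> {q n<..}))"
      by (simp add: F)
    also have "\<dots> = emeasure N (\<Union>n. A \<times> {q n<..})"
    proof (rule SUP_emeasure_incseq)
      show "incseq (\<lambda>n. A \<times> {q n<..})"
        using dec by (intro incseq_SucI) (auto intro: le_less_trans)
    qed auto
    also have "(\<Union>n. A \<times> {q n<..}) = A \<times> {s<..}"
      using q_ev q_gt by (auto intro: less_trans)
    finally show ?thesis ..
  qed
  note [measurable] = measurable_prob_algebraD[OF v]
  have ne: "space M \<noteq> {}" using \<pi>.not_empty by simp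
  have eqB: "emeasure N (A \<times> B) = (\<integral>\<^sup>+x\<in>A. emeasure (v x) B \<partial>\<pi>)"
    if A[measurable]: "A \<in> sets M" and B[measurable]: "B \<in> sets borel" for A B
  proof -
    \<comment> \<open>For fixed \<open>A\<close> both sides are finite measures in \<open>B\<close>;
      agreeing on half-lines, they agree on all Borel sets.\<close>
    define N1 where "N1 = distr (density N (indicator (A \<times> UNIV))) borel snd"
    define N2 where "N2 = density \<pi> (indicator A) \<bind> v"
    have N1: "emeasure N1 B = emeasure N (A \<times> B)" if [measurable]: "B \<in> sets borel" for B
    proof -
      have "emeasure N1 B = emeasure N ((A \<times> UNIV) \<inter> (snd -` B \<inter> space N))"
        unfolding N1_def
        by (subst emeasure_distr) (auto intro!: emeasure_restricted)
      also have "(A \<times> UNIV) \<inter> (snd -` B \<inter> space N) = A \<times> B"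
        using sets.sets_into_space[OF A] by (auto simp: space_N)
      finally show ?thesis .
    qed
    have N2: "emeasure N2 B = (\<integral>\<^sup>+x\<in>A. emeasure (v x) B \<partial>\<pi>)" if [measurable]: "B \<in> sets borel" for B
      unfolding N2_def using ne
      by (subst emeasure_bind[where N=borel]) (auto simp: nn_integral_density mult.commute)
    have "N1 = N2"
    proof (rule measure_eqI_lessThan)
      show "sets N1 = sets borel" by (simp add: N1_def)
      show "sets N2 = sets borel"
        unfolding N2_def using ne by (intro sets_bind_measurable) auto
      show "emeasure N1 {x<..} < \<infinity>" for x
        using N.emeasure_finite by (simp add: N1 less_top[symmetric])
      show "emeasure N1 {x<..} = emeasure N2 {x<..}" for x
        by (simp add: N1 N2 eq)
    qed
    then show ?thesis using N1[OF B] N2[OF B] by simp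
  qed
  define R where "R = \<pi> \<bind> (\<lambda>x. distr (v x) (M \<Otimes>\<^sub>M borel) (Pair x))"
  have K: "(\<lambda>x. distr (v x) (M \<Otimes>\<^sub>M borel) (Pair x)) \<in> M \<rightarrow>\<^sub>M prob_algebra (M \<Otimes>\<^sub>M borel)"
    using v by measurable
  then have K': "(\<lambda>x. distr (v x) (M \<Otimes>\<^sub>M borel) (Pair x)) \<in> \<pi> \<rightarrow>\<^sub>M subprob_algebra (M \<Otimes>\<^sub>M borel)"
    by (intro measurable_prob_algebraD) (simp cong: measurable_cong_sets)
  have sets_R: "sets R = sets (M \<Otimes>\<^sub>M borel)"
    unfolding R_def using ne by (intro sets_bind_measurable[OF K']) auto
  let ?E = "{A \<times> B | A B. A \<in> sets M \<and> B \<in> sets (borel :: real measure)}"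
  have "N = R"
  proof (rule measure_eqI_generator_eq[where E="?E" and A="\<lambda>_. space M \<times> UNIV" and \<Omega>="space M \<times> UNIV"])
    show "Int_stable ?E" by (rule Int_stable_pair_measure_generator)
    show "?E \<subseteq> Pow (space M \<times> UNIV)"
      using sets.sets_into_space[of _ M] by blast
    show "sets N = sigma_sets (space M \<times> UNIV) ?E" "sets R = sigma_sets (space M \<times> UNIV) ?E"
      unfolding N(2) sets_R sets_pair_measure by simp_all
    show "range (\<lambda>_::nat. space M \<times> UNIV) \<subseteq> ?E"
      by (auto intro!: exI[of _ "space M"] exI[of _ "UNIV :: real set"])
    show "emeasure N (space M \<times> UNIV) \<noteq> \<infinity>" by simp
    fix X assume "X \<in> ?E"
    then obtain A B where X: "X = A \<times> B" and [measurable]: "A \<in> sets M" "B \<in> sets borel" by auto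
    have "emeasure R X = (\<integral>\<^sup>+x. emeasure (distr (v x) (M \<Otimes>\<^sub>M borel) (Pair x)) X \<partial>\<pi>)"
      unfolding R_def using ne by (subst emeasure_bind[OF _ K']) (auto simp: X)
    also have "\<dots> = (\<integral>\<^sup>+x\<in>A. emeasure (v x) B \<partial>\<pi>)"
    proof (rule nn_integral_cong)
      fix x assume "x \<in> space \<pi>"
      then have x: "x \<in> space M" by simp
      have sets_v: "sets (v x) = sets borel"
        using measurable_space[OF v x] by (simp add: space_prob_algebra)
      have "Pair x \<in> v x \<rightarrow>\<^sub>M M \<Otimes>\<^sub>M borel"
        using x sets_v by (simp cong: measurable_cong_sets)
      then have "emeasure (distr (v x) (M \<Otimes>\<^sub>M borel) (Pair x)) X = emeasure (v x) (Pair x -` X \<inter> space (v x))"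
        by (subst emeasure_distr) (auto simp: X)
      also have "Pair x -` X \<inter> space (v x) = (if x \<in> A then B else {})"
        using sets_eq_imp_space_eq[OF sets_v] by (auto simp: X)
      finally show "emeasure (distr (v x) (M \<Otimes>\<^sub>M borel) (Pair x)) X = emeasure (v x) B * indicator A x"
        by simp
    qed
    finally show "emeasure N X = emeasure R X"
      by (simp add: X eqB)
  qed auto
  then show thesis
    using that[OF v] unfolding R_def \<pi>_def by simp
qed

text \<open>Points of the second factor are recovered measurably from their real codes, so the real
  case transfers: encode the second component, disintegrate, and decode the kernel.\<close>

lemma disintegration:
  fixes \<zeta> :: "('a \<times> 'u::{complete_space, second_countable_topology}) measure"
  assumes \<zeta>: "prob_space \<zeta>" "sets \<zeta> = sets (M \<Otimes>\<^sub>M borel)"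
  obtains v where "v \<in> M \<rightarrow>\<^sub>M prob_algebra borel"
    "\<zeta> = distr \<zeta> M fst \<bind> (\<lambda>x. distr (v x) (M \<Otimes>\<^sub>M borel) (Pair x))"
proof -
  interpret \<zeta>: prob_space \<zeta> by fact
  note [measurable_cong] = \<zeta>(2)
  define B :: "nat \<Rightarrow> 'u set" where "B k = (case prod_decode k of (i, n) \<Rightarrow> sball i n)" for k
  define c where "c i n = prod_encode (i, n)" for i n
  have c: "B (c i n) = sball i n" for i n by (simp add: B_def c_def)
  have [measurable]: "encode B \<in> borel_measurable borel"
    by (rule measurable_encode) (simp add: B_def split: prod.split)
  define e where "e = (\<lambda>z::'a \<times> 'u. (fst z, encode B (snd z)))"
  define d where "d = (\<lambda>z::'a \<times> real. (fst z, decode c (snd z) :: 'u))"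
  have e[measurable]: "e \<in> M \<Otimes>\<^sub>M borel \<rightarrow>\<^sub>M M \<Otimes>\<^sub>M borel" unfolding e_def by measurable
  have d[measurable]: "d \<in> M \<Otimes>\<^sub>M borel \<rightarrow>\<^sub>M M \<Otimes>\<^sub>M borel" unfolding d_def by measurable
  have e'[measurable]: "e \<in> \<zeta> \<rightarrow>\<^sub>M M \<Otimes>\<^sub>M borel" by measurable
  define N where "N = distr \<zeta> (M \<Otimes>\<^sub>M borel) e"
  have N: "prob_space N" "sets N = sets (M \<Otimes>\<^sub>M borel)"
    unfolding N_def by (intro \<zeta>.prob_space_distr e') simp
  have bnd: "AE z in N. 0 \<le> snd z \<and> snd z \<le> 1"
  proof -
    have "0 \<le> encode B u \<and> encode B u \<le> 1" for u
      using encode_bounds[of B u] by simp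
    then show ?thesis
      unfolding N_def by (subst AE_distr_iff) (auto simp: e_def)
  qed
  obtain v where v: "v \<in> M \<rightarrow>\<^sub>M prob_algebra borel"
    and N_eq: "N = distr N M fst \<bind> (\<lambda>x. distr (v x) (M \<Otimes>\<^sub>M borel) (Pair x))"
    using disintegration_real_measure[OF N bnd] by blast
  define w where "w x = distr (v x) borel (decode c :: real \<Rightarrow> 'u)" for x
  have w: "w \<in> M \<rightarrow>\<^sub>M prob_algebra borel"
    unfolding w_def using v by measurable
  have fst_N: "distr N M fst = distr \<zeta> M fst"
    unfolding N_def by (simp add: distr_distr comp_def e_def)
  have ne: "space (distr \<zeta> M fst) \<noteq> {}"
    using \<zeta>.not_empty sets_eq_imp_space_eq[OF \<zeta>(2)] by (auto simp: space_pair_measure)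
  have K: "(\<lambda>x. distr (v x) (M \<Otimes>\<^sub>M borel) (Pair x)) \<in> distr \<zeta> M fst \<rightarrow>\<^sub>M subprob_algebra (M \<Otimes>\<^sub>M borel)"
  proof -
    have "(\<lambda>x. distr (v x) (M \<Otimes>\<^sub>M borel) (Pair x)) \<in> M \<rightarrow>\<^sub>M prob_algebra (M \<Otimes>\<^sub>M borel)"
      using v by measurable
    then show ?thesis by (intro measurable_prob_algebraD) simp
  qed
  have "distr \<zeta> \<zeta> (\<lambda>z. z) = distr \<zeta> (M \<Otimes>\<^sub>M borel) (d \<circ> e)"
    by (intro distr_cong) (auto simp: \<zeta>(2) d_def e_def decode_encode[OF c])
  also have "\<dots> = distr N (M \<Otimes>\<^sub>M borel) d"
    unfolding N_def by (subst distr_distr) auto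
  also have "\<dots> = distr \<zeta> M fst \<bind> (\<lambda>x. distr (distr (v x) (M \<Otimes>\<^sub>M borel) (Pair x)) (M \<Otimes>\<^sub>M borel) d)"
    by (subst N_eq, unfold fst_N) (rule distr_bind[OF K ne d])
  also have "\<dots> = distr \<zeta> M fst \<bind> (\<lambda>x. distr (w x) (M \<Otimes>\<^sub>M borel) (Pair x))"
  proof (rule bind_cong[OF refl])
    fix x assume "x \<in> space (distr \<zeta> M fst)"
    then have x: "x \<in> space M" by simp
    have sets_v[measurable_cong]: "sets (v x) = sets borel"
      using measurable_space[OF v x] by (simp add: space_prob_algebra)
    have P: "Pair x \<in> borel \<rightarrow>\<^sub>M M \<Otimes>\<^sub>M (borel :: 'u measure)" "Pair x \<in> v x \<rightarrow>\<^sub>M M \<Otimes>\<^sub>M borel"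
      using x sets_v by (simp_all cong: measurable_cong_sets)
    have D: "decode c \<in> v x \<rightarrow>\<^sub>M (borel :: 'u measure)"
      using sets_v by (simp cong: measurable_cong_sets)
    have "distr (distr (v x) (M \<Otimes>\<^sub>M borel) (Pair x)) (M \<Otimes>\<^sub>M borel) d = distr (v x) (M \<Otimes>\<^sub>M borel) (d \<circ> Pair x)"
      by (rule distr_distr[OF d P(2)])
    also have "d \<circ> Pair x = Pair x \<circ> decode c"
      by (auto simp: d_def)
    also have "distr (v x) (M \<Otimes>\<^sub>M borel) (Pair x \<circ> decode c) = distr (w x) (M \<Otimes>\<^sub>M borel) (Pair x)"
      unfolding w_def by (rule distr_distr[OF P(1) D, symmetric])
    finally show "distr (distr (v x) (M \<Otimes>\<^sub>M borel) (Pair x)) (M \<Otimes>\<^sub>M borel) d = distr (w x) (M \<Otimes>\<^sub>M borel) (Pair x)" .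
  qed
  finally have eq: "distr \<zeta> \<zeta> (\<lambda>z. z) = distr \<zeta> M fst \<bind> (\<lambda>x. distr (w x) (M \<Otimes>\<^sub>M borel) (Pair x))" .
  show thesis
    by (rule that[OF w trans[OF _ eq]]) (rule distr_id[symmetric])
qed

section \<open>The law of the controlled process\<close>

text \<open>If the limit u were outside the closed set \<open>U x\<close>, some closed ball around u
  would miss \<open>U x\<close>. The states whose action sets meet this ball form a closed set by
  upper semicontinuity and eventually include those of the sequence, so x would be among
  them.\<close>

lemma (in feller_mdp) closed_graph: "closed (graph U)"
  unfolding closed_sequential_limits
proof (intro allI impI, elim conjE)
  fix z and l :: "'x \<times> 'u" assume z: "\<forall>n. z n \<in> graph U" and lim: "z \<longlonglongrightarrow> l"
  obtain x u where l: "l = (x, u)" by (cases l)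
  have lim_x: "(\<lambda>n. fst (z n)) \<longlonglongrightarrow> x" and lim_u: "(\<lambda>n. snd (z n)) \<longlonglongrightarrow> u"
    using tendsto_fst[OF lim] tendsto_snd[OF lim] by (simp_all add: l)
  have "u \<in> U x"
  proof (rule ccontr)
    assume "u \<notin> U x"
    then obtain e where e: "0 < e" "ball u e \<inter> U x = {}"
      using U_closed[of x] open_contains_ball[of "- U x"] by (auto simp: open_Compl disjoint_eq_subset_Compl)
    \<comment> \<open>Half the radius keeps the closed ball inside the open ball that misses
      \<open>U x\<close>.\<close>
    have cl: "closed {y. U y \<inter> cball u (e / 2) \<noteq> {}}"
      using U_usc by (auto simp: usc_multifunction_def)
    have "\<forall>\<^sub>F n in sequentially. dist (snd (z n)) u < e / 2"
      using tendstoD[OF lim_u, of "e / 2"] e(1) by simp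
    then have "\<forall>\<^sub>F n in sequentially. fst (z n) \<in> {y. U y \<inter> cball u (e / 2) \<noteq> {}}"
    proof eventually_elim
      case (elim n)
      have "snd (z n) \<in> U (fst (z n))"
        using z by (simp add: graph_def case_prod_beta)
      with elim show ?case by (auto simp: dist_commute intro!: less_imp_le)
    qed
    then have "x \<in> {y. U y \<inter> cball u (e / 2) \<noteq> {}}"
      by (rule Lim_in_closed_set[OF cl _ _ lim_x]) simp
    moreover have "cball u (e / 2) \<subseteq> ball u e"
      using e(1) by auto
    ultimately show False using e(2) by auto
  qed
  then show "l \<in> graph U" by (simp add: l graph_def)
qed

context feller_mdp
begin

lemma sets_graph [measurable]: "graph U \<in> sets borel"
  using closed_graph by (rule borel_closed)

lemma graph_nonempty: "graph U \<noteq> {}"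
  using U_strict by (auto simp: graph_def)

lemma space_borel_graph [simp]: "space (borel_graph U) = graph U"
  by (simp add: space_restrict_space)

lemma measurable_fst_borel_graph [measurable]: "fst \<in> borel_graph U \<rightarrow>\<^sub>M borel"
  by (intro measurable_restrict_space1) (simp flip: borel_prod)

lemma borel_measurable_borel_graph_iff:
  fixes f :: "_ \<Rightarrow> ennreal"
  shows "f \<in> borel_measurable (borel_graph U) \<longleftrightarrow> (\<lambda>z. f z * indicator (graph U) z) \<in> borel_measurable borel"
  by (intro borel_measurable_restrict_space_iff_ennreal) simp

lemma measurable_Pair_borel [measurable]: "Pair x \<in> borel \<rightarrow>\<^sub>M (borel :: ('x \<times> 'u) measure)"
  by (simp flip: borel_prod)

text \<open>Lives on the whole product, where the Borel structure is a product structure and binds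
  are easily measurable; restriction to the graph comes last.\<close>

definition glue :: "'x measure \<Rightarrow> ('x \<Rightarrow> 'u measure) \<Rightarrow> ('x \<times> 'u) measure" where
  "glue \<pi> v = \<pi> \<bind> (\<lambda>x. distr (v x) borel (Pair x))"

lemma compose_kernel_eq: "compose_kernel U \<pi> v = restrict_space (glue \<pi> v) (graph U)"
  by (simp add: compose_kernel_def glue_def)

lemma measurable_glue_kernel:
  assumes "w \<in> M \<Otimes>\<^sub>M borel \<rightarrow>\<^sub>M prob_algebra borel"
  shows "(\<lambda>(h, x). distr (w (h, x)) borel (Pair x)) \<in> M \<Otimes>\<^sub>M borel \<rightarrow>\<^sub>M prob_algebra (borel :: ('x \<times> 'u) measure)"
proof -
  have "(\<lambda>p. distr (w p) (borel :: ('x \<times> 'u) measure) (\<lambda>u. (snd p, u))) \<in> M \<Otimes>\<^sub>M borel \<rightarrow>\<^sub>M prob_algebra borel"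
    by (rule measurable_distr_prob_space2[OF assms]) (simp flip: borel_prod)
  then show ?thesis by (simp add: case_prod_unfold)
qed

lemma measurable_glue:
  assumes "Q \<in> M \<rightarrow>\<^sub>M prob_algebra borel" "w \<in> M \<Otimes>\<^sub>M borel \<rightarrow>\<^sub>M prob_algebra borel"
  shows "(\<lambda>h. glue (Q h) (\<lambda>x. w (h, x))) \<in> M \<rightarrow>\<^sub>M prob_algebra borel"
  unfolding glue_def
  by (rule measurable_bind_prob_space2[OF assms(1) measurable_glue_kernel[OF assms(2)]])

lemma glue_kernel:
  assumes "v \<in> borel \<rightarrow>\<^sub>M prob_algebra borel"
  shows "(\<lambda>x. distr (v x) borel (Pair x)) \<in> borel \<rightarrow>\<^sub>M prob_algebra (borel :: ('x \<times> 'u) measure)"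
  by (rule measurable_distr_prob_space2[OF assms]) (simp flip: borel_prod)

lemma nn_integral_glue:
  assumes \<pi>: "\<pi> \<in> Prob" and v: "v \<in> borel \<rightarrow>\<^sub>M prob_algebra borel" and f[measurable]: "f \<in> borel_measurable borel"
  shows "(\<integral>\<^sup>+z. f z \<partial>glue \<pi> v) = (\<integral>\<^sup>+x. \<integral>\<^sup>+u. f (x, u) \<partial>v x \<partial>\<pi>)"
proof -
  have sets_\<pi>: "sets \<pi> = sets borel" using \<pi> by (simp add: space_prob_algebra)
  have "(\<lambda>x. distr (v x) borel (Pair x)) \<in> \<pi> \<rightarrow>\<^sub>M subprob_algebra (borel :: ('x \<times> 'u) measure)"
    using measurable_prob_algebraD[OF glue_kernel[OF v]] by (simp add: sets_\<pi> cong: measurable_cong_sets)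
  then have "(\<integral>\<^sup>+z. f z \<partial>glue \<pi> v) = (\<integral>\<^sup>+x. \<integral>\<^sup>+z. f z \<partial>distr (v x) borel (Pair x) \<partial>\<pi>)"
    unfolding glue_def by (rule nn_integral_bind[OF f])
  also have "\<dots> = (\<integral>\<^sup>+x. \<integral>\<^sup>+u. f (x, u) \<partial>v x \<partial>\<pi>)"
  proof (rule nn_integral_cong)
    fix x
    have sets_v[measurable_cong]: "sets (v x) = sets borel"
      using measurable_space[OF v, of x] by (simp add: space_prob_algebra)
    show "(\<integral>\<^sup>+z. f z \<partial>distr (v x) borel (Pair x)) = (\<integral>\<^sup>+u. f (x, u) \<partial>v x)"
      by (rule nn_integral_distr) measurable
  qed
  finally show ?thesis .
qed

lemma glue_in_Prob:
  assumes \<pi>: "\<pi> \<in> Prob" and v: "v \<in> borel \<rightarrow>\<^sub>M prob_algebra borel"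
  shows "glue \<pi> v \<in> space (prob_algebra borel)"
  unfolding glue_def space_prob_algebra
  using prob_space_bind'[OF \<pi> glue_kernel[OF v]] sets_bind'[OF \<pi> glue_kernel[OF v]] by simp

lemma emeasure_glue_graph_eq:
  assumes "\<pi> \<in> Prob" "v \<in> borel \<rightarrow>\<^sub>M prob_algebra borel"
  shows "emeasure (glue \<pi> v) (graph U) = (\<integral>\<^sup>+x. emeasure (v x) (U x) \<partial>\<pi>)"
proof -
  have sets: "sets (glue \<pi> v) = sets borel"
    using glue_in_Prob[OF assms] by (simp add: space_prob_algebra)
  have "emeasure (glue \<pi> v) (graph U) = (\<integral>\<^sup>+z. indicator (graph U) z \<partial>glue \<pi> v)"
    by (simp add: sets)
  also have "\<dots> = (\<integral>\<^sup>+x. \<integral>\<^sup>+u. indicator (graph U) (x, u) \<partial>v x \<partial>\<pi>)"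
    by (intro nn_integral_glue assms) simp
  also have "\<dots> = (\<integral>\<^sup>+x. emeasure (v x) (U x) \<partial>\<pi>)"
  proof (rule nn_integral_cong)
    fix x
    have "sets (v x) = sets borel"
      using measurable_space[OF assms(2), of x] by (simp add: space_prob_algebra)
    then have "U x \<in> sets (v x)" by (simp add: U_borel)
    moreover have "indicator (graph U) (x, u) = (indicator (U x) u :: ennreal)" for u
      by (simp add: graph_def indicator_def)
    ultimately show "(\<integral>\<^sup>+u. indicator (graph U) (x, u) \<partial>v x) = emeasure (v x) (U x)" by simp
  qed
  finally show ?thesis .
qed

lemma emeasure_glue_graph:
  assumes "\<pi> \<in> Prob" "v \<in> borel \<rightarrow>\<^sub>M prob_algebra borel"
    and ae: "AE x in \<pi>. emeasure (v x) (U x) = 1"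
  shows "emeasure (glue \<pi> v) (graph U) = 1"
proof -
  interpret \<pi>: prob_space \<pi> using assms(1) by (simp add: space_prob_algebra)
  have "emeasure (glue \<pi> v) (graph U) = (\<integral>\<^sup>+x. 1 \<partial>\<pi>)"
    unfolding emeasure_glue_graph_eq[OF assms(1,2)] by (intro nn_integral_cong_AE ae)
  then show ?thesis by (simp add: \<pi>.emeasure_space_1)
qed

lemma restrict_graph_in_prob_algebra:
  assumes N: "N \<in> space (prob_algebra borel)" and "emeasure N (graph U) = 1"
  shows "restrict_space N (graph U) \<in> space (prob_algebra (borel_graph U))"
proof -
  have sets: "sets N = sets borel" and sp: "space N = UNIV"
    using N sets_eq_imp_space_eq[of N borel] by (auto simp: space_prob_algebra)
  have "prob_space (restrict_space N (graph U))"
    using assms(2) by (intro prob_spaceI) (simp add: space_restrict_space sp emeasure_restrict_space sets)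
  then show ?thesis
    using sets by (simp add: space_prob_algebra sets_restrict_space)
qed

lemma compose_kernel_in_prob_algebra:
  assumes "\<pi> \<in> Prob" "v \<in> borel \<rightarrow>\<^sub>M prob_algebra borel" "AE x in \<pi>. emeasure (v x) (U x) = 1"
  shows "compose_kernel U \<pi> v \<in> space (prob_algebra (borel_graph U))"
  unfolding compose_kernel_eq
  by (intro restrict_graph_in_prob_algebra glue_in_Prob emeasure_glue_graph assms)

lemma nn_integral_compose_kernel:
  assumes "\<pi> \<in> Prob" "v \<in> borel \<rightarrow>\<^sub>M prob_algebra borel" "f \<in> borel_measurable (borel_graph U)"
  shows "(\<integral>\<^sup>+z. f z \<partial>compose_kernel U \<pi> v) = (\<integral>\<^sup>+x. (\<integral>\<^sup>+u\<in>U x. f (x, u) \<partial>v x) \<partial>\<pi>)"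
proof -
  have sets: "sets (glue \<pi> v) = sets borel"
    using glue_in_Prob[OF assms(1,2)] by (simp add: space_prob_algebra)
  have "(\<integral>\<^sup>+z. f z \<partial>compose_kernel U \<pi> v) = (\<integral>\<^sup>+z. f z * indicator (graph U) z \<partial>glue \<pi> v)"
    unfolding compose_kernel_eq by (intro nn_integral_restrict_space) (simp add: sets)
  also have "\<dots> = (\<integral>\<^sup>+x. \<integral>\<^sup>+u. f (x, u) * indicator (graph U) (x, u) \<partial>v x \<partial>\<pi>)"
    using assms by (intro nn_integral_glue) (auto simp: borel_measurable_borel_graph_iff)
  finally show ?thesis by (simp add: graph_def indicator_def)
qed

lemma measurable_compose_kernel:
  assumes Q: "Q \<in> M \<rightarrow>\<^sub>M prob_algebra borel" and w: "w \<in> M \<Otimes>\<^sub>M borel \<rightarrow>\<^sub>M prob_algebra borel"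
    and ae: "\<And>h. h \<in> space M \<Longrightarrow> AE x in Q h. emeasure (w (h, x)) (U x) = 1"
  shows "(\<lambda>h. compose_kernel U (Q h) (\<lambda>x. w (h, x))) \<in> M \<rightarrow>\<^sub>M prob_algebra (borel_graph U)"
proof (rule measurable_prob_algebraI)
  show "(\<lambda>h. compose_kernel U (Q h) (\<lambda>x. w (h, x))) \<in> M \<rightarrow>\<^sub>M subprob_algebra (borel_graph U)"
    unfolding compose_kernel_eq
    by (intro restrict_space_measurable graph_nonempty sets_graph measurable_prob_algebraD measurable_glue Q w)
  show "prob_space (compose_kernel U (Q h) (\<lambda>x. w (h, x)))" if h: "h \<in> space M" for h
    using compose_kernel_in_prob_algebra[of "Q h" "\<lambda>x. w (h, x)"] measurable_space[OF Q h]
      measurable_compose_Pair1[OF h w] ae[OF h] by (simp add: space_prob_algebra)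
qed

lemma distr_compose_kernel_fst:
  assumes "\<pi> \<in> Prob" "v \<in> borel \<rightarrow>\<^sub>M prob_algebra borel" "AE x in \<pi>. emeasure (v x) (U x) = 1"
  shows "distr (compose_kernel U \<pi> v) borel fst = \<pi>"
proof (rule measure_eqI)
  have sets_ck: "sets (compose_kernel U \<pi> v) = sets (borel_graph U)"
    using compose_kernel_in_prob_algebra[OF assms] by (simp add: space_prob_algebra)
  have sets_\<pi>: "sets \<pi> = sets borel" using assms(1) by (simp add: space_prob_algebra)
  then show "sets (distr (compose_kernel U \<pi> v) borel fst) = sets \<pi>" by simp
  fix A assume "A \<in> sets (distr (compose_kernel U \<pi> v) borel fst)"
  then have A[measurable]: "A \<in> sets borel" by simp
  have m: "fst \<in> compose_kernel U \<pi> v \<rightarrow>\<^sub>M borel"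
    using sets_ck by (simp cong: measurable_cong_sets)
  have "emeasure (distr (compose_kernel U \<pi> v) borel fst) A = (\<integral>\<^sup>+z. indicator A (fst z) \<partial>compose_kernel U \<pi> v)"
    using nn_integral_distr[OF m, of "indicator A"] by simp
  also have "\<dots> = (\<integral>\<^sup>+x. (\<integral>\<^sup>+u\<in>U x. indicator A x \<partial>v x) \<partial>\<pi>)"
    by (subst nn_integral_compose_kernel) (use assms in auto)
  also have "\<dots> = (\<integral>\<^sup>+x. indicator A x \<partial>\<pi>)"
  proof (intro nn_integral_cong_AE, use assms(3) in eventually_elim)
    fix x assume "emeasure (v x) (U x) = 1"
    moreover have "U x \<in> sets (v x)"
      using measurable_space[OF assms(2), of x] by (simp add: space_prob_algebra U_borel)
    ultimately show "(\<integral>\<^sup>+u\<in>U x. indicator A x \<partial>v x) = indicator A x"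
      by (simp add: nn_integral_cmult_indicator)
  qed
  finally show "emeasure (distr (compose_kernel U \<pi> v) borel fst) A = emeasure \<pi> A"
    by (simp add: sets_\<pi>)
qed

text \<open>As a kernel into the graph, it turns the process under a stationary strategy into an
  alternation of two binds, with \<open>action_kernel v\<close> and with \<open>P\<close>.\<close>

definition action_kernel :: "('x \<Rightarrow> 'u measure) \<Rightarrow> 'x \<Rightarrow> ('x \<times> 'u) measure" where
  "action_kernel v x = compose_kernel U (return borel x) v"

lemma sm_strategiesD:
  assumes "v \<in> sm_strategies U"
  shows "v \<in> borel \<rightarrow>\<^sub>M prob_algebra borel" "emeasure (v x) (U x) = 1"
  using assms by (auto simp: sm_strategies_def)

lemma measurable_action_kernel:
  assumes "v \<in> sm_strategies U"
  shows "action_kernel v \<in> borel \<rightarrow>\<^sub>M prob_algebra (borel_graph U)"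
proof -
  have "(\<lambda>h. compose_kernel U (return borel h) (\<lambda>x. (v \<circ> snd) (h, x))) \<in> borel \<rightarrow>\<^sub>M prob_algebra (borel_graph U)"
    using sm_strategiesD[OF assms]
    by (intro measurable_compose_kernel measurable_return_prob_space measurable_comp[OF measurable_snd]) simp_all
  then show ?thesis by (simp add: action_kernel_def[abs_def])
qed

lemma action_kernel_eq:
  assumes "v \<in> sm_strategies U"
  shows "action_kernel v x = restrict_space (distr (v x) borel (Pair x)) (graph U)"
proof -
  have "glue (return borel x) v = distr (v x) borel (Pair x)"
    unfolding glue_def using glue_kernel[OF sm_strategiesD(1)[OF assms]]
    by (intro bind_return[OF measurable_prob_algebraD]) auto
  then show ?thesis by (simp add: action_kernel_def compose_kernel_eq)
qed

lemma nn_integral_action_kernel: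
  assumes v: "v \<in> sm_strategies U" and f: "f \<in> borel_measurable (borel_graph U)"
  shows "(\<integral>\<^sup>+z. f z \<partial>action_kernel v x) = cost_under U f v x"
proof -
  have "sets (v x) = sets borel"
    using measurable_space[OF sm_strategiesD(1)[OF v], of x] by (simp add: space_prob_algebra)
  then have P: "Pair x \<in> v x \<rightarrow>\<^sub>M (borel :: ('x \<times> 'u) measure)"
    by (simp cong: measurable_cong_sets)
  have "(\<integral>\<^sup>+z. f z \<partial>action_kernel v x) = (\<integral>\<^sup>+z. f z * indicator (graph U) z \<partial>distr (v x) borel (Pair x))"
    unfolding action_kernel_eq[OF v] by (intro nn_integral_restrict_space) simp
  also have "\<dots> = (\<integral>\<^sup>+u. f (x, u) * indicator (graph U) (x, u) \<partial>v x)"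
    using f by (intro nn_integral_distr P) (simp add: borel_measurable_borel_graph_iff)
  finally show ?thesis by (simp add: cost_under_def graph_def indicator_def)
qed

lemma measurable_cost_under:
  assumes "v \<in> sm_strategies U" "f \<in> borel_measurable (borel_graph U)"
  shows "cost_under U f v \<in> borel_measurable borel"
proof -
  have "(\<lambda>x. \<integral>\<^sup>+z. f z \<partial>action_kernel v x) \<in> borel_measurable borel"
    using measurable_prob_algebraD[OF measurable_action_kernel[OF assms(1)]] assms(2)
    by (rule measurable_compose[OF _ nn_integral_measurable_subprob_algebra])
  then show ?thesis by (simp add: nn_integral_action_kernel[OF assms])
qed

lemma compose_kernel_bind:
  assumes \<pi>: "\<pi> \<in> Prob" and v: "v \<in> sm_strategies U"
  shows "compose_kernel U \<pi> v = \<pi> \<bind> action_kernel v"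
proof -
  have sets: "sets \<pi> = sets borel" and ne: "space \<pi> \<noteq> {}"
    using \<pi> by (auto simp: space_prob_algebra prob_space.not_empty)
  have K: "(\<lambda>x. distr (v x) borel (Pair x)) \<in> \<pi> \<rightarrow>\<^sub>M subprob_algebra (borel :: ('x \<times> 'u) measure)"
    unfolding measurable_cong_sets[OF sets refl]
    by (rule measurable_prob_algebraD[OF glue_kernel[OF sm_strategiesD(1)[OF v]]])
  show ?thesis
    unfolding compose_kernel_eq glue_def restrict_space_bind[OF K ne sets_graph graph_nonempty]
    by (intro bind_cong refl) (simp add: action_kernel_eq[OF v])
qed

lemma stationary_in_strategies:
  assumes "v \<in> sm_strategies U"
  shows "stationary v \<in> strategies U"
  unfolding strategies_def
proof (intro CollectI allI conjI)
  show "stationary v t \<in> histories U t \<rightarrow>\<^sub>M prob_algebra borel" for t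
    unfolding stationary_def histories_def case_prod_unfold
    by (rule measurable_compose[OF measurable_snd sm_strategiesD(1)[OF assms]])
  show "\<forall>(h, x)\<in>space (histories U t). emeasure (stationary v t (h, x)) (U x) = 1" for t
    using sm_strategiesD(2)[OF assms] by (auto simp: stationary_def)
qed

lemma strategiesD:
  assumes "\<xi> \<in> strategies U"
  shows "\<xi> t \<in> PiM {0..<t} (\<lambda>_. borel_graph U) \<Otimes>\<^sub>M borel \<rightarrow>\<^sub>M prob_algebra borel"
    and "h \<in> space (PiM {0..<t} (\<lambda>_. borel_graph U)) \<Longrightarrow> emeasure (\<xi> t (h, x)) (U x) = 1"
  using assms by (auto simp: strategies_def histories_def space_pair_measure)

lemma measurable_previous_kernel:
  fixes t :: nat
  assumes "\<mu> \<in> Prob"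
  shows "(\<lambda>h. if t = 0 then \<mu> else P (h (t - 1))) \<in> PiM {0..<t} (\<lambda>_. borel_graph U) \<rightarrow>\<^sub>M prob_algebra borel"
proof (cases t)
  case (Suc s)
  have m: "(\<lambda>h. h s) \<in> PiM {0..<t} (\<lambda>_. borel_graph U) \<rightarrow>\<^sub>M borel_graph U"
    by (intro measurable_component_singleton) (simp add: Suc)
  then show ?thesis
    using measurable_compose[OF m P_kernel] by (simp add: Suc)
qed (use assms in simp)

lemma measurable_step_kernel:
  assumes "\<xi> \<in> strategies U" "\<mu> \<in> Prob"
  shows "step_kernel U P \<xi> \<mu> t \<in> PiM {0..<t} (\<lambda>_. borel_graph U) \<rightarrow>\<^sub>M prob_algebra (borel_graph U)"
  unfolding step_kernel_def[abs_def]
  by (intro measurable_compose_kernel measurable_previous_kernel strategiesD assms) (simp add: strategiesD assms)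

lemma Ionescu_Tulcea_step_kernel:
  assumes "\<xi> \<in> strategies U" "\<mu> \<in> Prob"
  shows "Ionescu_Tulcea (step_kernel U P \<xi> \<mu>) (\<lambda>_. borel_graph U)"
proof (rule Ionescu_Tulcea.intro)
  fix i :: nat
  show "step_kernel U P \<xi> \<mu> i \<in> PiM {0..<i} (\<lambda>_. borel_graph U) \<rightarrow>\<^sub>M subprob_algebra (borel_graph U)"
    by (intro measurable_prob_algebraD measurable_step_kernel assms)
  fix x assume "x \<in> space (PiM {0..<i} (\<lambda>_. borel_graph U))"
  then show "prob_space (step_kernel U P \<xi> \<mu> i x)"
    using measurable_space[OF measurable_step_kernel[OF assms]] by (simp add: space_prob_algebra)
qed

text \<open>The costs are expectations of sums of functions of one coordinate each, so these
  one-dimensional marginals carry all that is used about the path law.\<close>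

definition step_law :: "('x, 'u) strategy \<Rightarrow> 'x measure \<Rightarrow> nat \<Rightarrow> ('x \<times> 'u) measure" where
  "step_law \<xi> \<mu> n = distr (path_law U P \<xi> \<mu>) (borel_graph U) (\<lambda>\<omega>. \<omega> n)"

definition state_law :: "('x, 'u) strategy \<Rightarrow> 'x measure \<Rightarrow> nat \<Rightarrow> 'x measure" where
  "state_law \<xi> \<mu> n = distr (step_law \<xi> \<mu> n) borel fst"

context
  fixes \<xi> :: "('x, 'u) strategy" and \<mu> :: "'x measure"
  assumes \<xi>: "\<xi> \<in> strategies U" and \<mu>: "\<mu> \<in> Prob"
begin

interpretation IT: Ionescu_Tulcea "step_kernel U P \<xi> \<mu>" "\<lambda>_. borel_graph U"
  by (intro Ionescu_Tulcea_step_kernel \<xi> \<mu>)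

definition past_law :: "nat \<Rightarrow> (nat \<Rightarrow> 'x \<times> 'u) measure" where
  "past_law n = distr (path_law U P \<xi> \<mu>) (PiM {0..<n} (\<lambda>_. borel_graph U)) (\<lambda>\<omega>. restrict \<omega> {0..<n})"

lemma sets_path_law: "sets (path_law U P \<xi> \<mu>) = sets (PiM UNIV (\<lambda>_. borel_graph U))"
  unfolding path_law_def by (rule IT.PF.sets_lim)

text \<open>The image under projection to no coordinates is a probability measure, and a measure
  with such an image is one itself.\<close>

lemma prob_space_path_law: "prob_space (path_law U P \<xi> \<mu>)"
proof -
  have "distr (path_law U P \<xi> \<mu>) (PiM {} (\<lambda>_. borel_graph U)) (\<lambda>\<omega>. restrict \<omega> {}) = IT.CI {}"
    unfolding path_law_def by (rule IT.distr_lim) simp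
  moreover have "prob_space (IT.CI {})" by (rule IT.PF.prob_space_P) auto
  moreover have "(\<lambda>\<omega>. restrict \<omega> {}) \<in> path_law U P \<xi> \<mu> \<rightarrow>\<^sub>M PiM {} (\<lambda>_. borel_graph U)"
    by (intro measurable_restrict) simp
  ultimately show ?thesis
    by (metis prob_space_distrD)
qed

lemma measurable_path_component [measurable]: "(\<lambda>\<omega>. \<omega> n) \<in> path_law U P \<xi> \<mu> \<rightarrow>\<^sub>M borel_graph U"
  unfolding measurable_cong_sets[OF sets_path_law refl] by (rule measurable_component_singleton) simp

lemma measurable_path_restrict: "(\<lambda>\<omega>. restrict \<omega> {0..<n}) \<in> path_law U P \<xi> \<mu> \<rightarrow>\<^sub>M PiM {0..<n} (\<lambda>_. borel_graph U)"
  by (intro measurable_restrict measurable_path_component)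

text \<open>On an initial segment the embedding of events is the identity, so the projective limit
  has the iterated composition of step kernels as its marginal. This gives access to the recursion
  in n.\<close>

lemma past_law_eq: "past_law n = IT.C 0 n (\<lambda>_. undefined)"
proof -
  have "past_law n = IT.CI {0..<n}"
    unfolding past_law_def path_law_def by (rule IT.distr_lim) simp
  also have "\<dots> = IT.C 0 n (\<lambda>_. undefined)"
  proof (rule measure_eqI)
    show s: "sets (IT.CI {0..<n}) = sets (IT.C 0 n (\<lambda>_. undefined))"
      by (simp add: IT.CI_def IT.sets_C)
    fix A assume "A \<in> sets (IT.CI {0..<n})"
    then have A: "A \<in> sets (PiM {0..<n} (\<lambda>_. borel_graph U))" by (simp add: IT.CI_def)
    have "prod_emb {0..<n} (\<lambda>_. borel_graph U) {0..<n} A = A"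
      using sets.sets_into_space[OF A] by (intro prod_emb_id) (simp add: space_PiM)
    then show "emeasure (IT.CI {0..<n}) A = emeasure (IT.C 0 n (\<lambda>_. undefined)) A"
      using IT.emeasure_CI[OF order_refl A] by simp
  qed
  finally show ?thesis .
qed

lemma past_law_in: "past_law n \<in> space (prob_algebra (PiM {0..<n} (\<lambda>_. borel_graph U)))"
  unfolding space_prob_algebra past_law_def
  using prob_space.prob_space_distr[OF prob_space_path_law measurable_path_restrict] by simp

lemma distr_past_law: "i < n \<Longrightarrow> distr (past_law n) (borel_graph U) (\<lambda>h. h i) = step_law \<xi> \<mu> i"
  unfolding past_law_def step_law_def
  by (subst distr_distr[OF _ measurable_path_restrict]) (auto simp: comp_def)

lemma step_law_in: "step_law \<xi> \<mu> n \<in> space (prob_algebra (borel_graph U))"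
  unfolding space_prob_algebra step_law_def
  using prob_space.prob_space_distr[OF prob_space_path_law measurable_path_component] by simp

lemma state_law_in: "state_law \<xi> \<mu> n \<in> Prob"
  unfolding state_law_def using measurable_space[OF measurable_distr_prob_space[OF measurable_fst_borel_graph] step_law_in] by simp

text \<open>Extending a past of length n appends one coordinate distributed by the step kernel;
  projecting to that coordinate forgets the rest.\<close>

lemma step_law_eq: "step_law \<xi> \<mu> n = past_law n \<bind> step_kernel U P \<xi> \<mu> n"
proof -
  let ?M = "\<lambda>n. PiM {0..<n} (\<lambda>_. borel_graph U)"
  have sp: "space (past_law n) = space (?M n)" by (simp add: past_law_def)
  have sets: "sets (past_law n) = sets (?M n)" by (simp add: past_law_def)
  have ne: "space (past_law n) \<noteq> {}"
    using past_law_in[of n] by (auto simp: space_prob_algebra prob_space.not_empty)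
  have eP: "IT.eP n \<in> past_law n \<rightarrow>\<^sub>M subprob_algebra (?M (Suc n))"
    using IT.measurable_eP[of n] by (simp add: sets cong: measurable_cong_sets)
  have comp: "(\<lambda>h. h n) \<in> ?M (Suc n) \<rightarrow>\<^sub>M borel_graph U"
    by (rule measurable_component_singleton) simp
  have "step_law \<xi> \<mu> n = distr (past_law (Suc n)) (borel_graph U) (\<lambda>h. h n)"
    by (simp add: distr_past_law)
  also have "past_law (Suc n) = past_law n \<bind> IT.eP n"
    by (simp add: past_law_eq)
  also have "distr (past_law n \<bind> IT.eP n) (borel_graph U) (\<lambda>h. h n) =
      past_law n \<bind> (\<lambda>h. distr (IT.eP n h) (borel_graph U) (\<lambda>h. h n))"
    by (rule distr_bind[OF eP ne comp])
  also have "\<dots> = past_law n \<bind> step_kernel U P \<xi> \<mu> n"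
  proof (rule bind_cong[OF refl])
    fix h assume "h \<in> space (past_law n)"
    then have h: "h \<in> space (?M n)" by (simp add: sp)
    have upd: "fun_upd h n \<in> step_kernel U P \<xi> \<mu> n h \<rightarrow>\<^sub>M ?M (Suc n)"
      unfolding measurable_cong_sets[OF IT.sets_P[OF h] refl]
      using h by (intro measurable_fun_upd[where J="{0..<n}"]) auto
    have "distr (IT.eP n h) (borel_graph U) (\<lambda>h. h n) =
        distr (step_kernel U P \<xi> \<mu> n h) (borel_graph U) ((\<lambda>h. h n) \<circ> fun_upd h n)"
      unfolding IT.eP_def by (rule distr_distr[OF comp upd])
    also have "(\<lambda>h. h n) \<circ> fun_upd h n = (\<lambda>z. z)" by auto
    finally show "distr (IT.eP n h) (borel_graph U) (\<lambda>h. h n) = step_kernel U P \<xi> \<mu> n h"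
      using IT.sets_P[OF h] by (simp add: distr_id2)
  qed
  finally show ?thesis .
qed

text \<open>The action integrates out, which leaves the law from which the state was drawn, averaged
  over the past. Both the initial law and the one-step recursion are instances.\<close>

lemma state_law_eq: "state_law \<xi> \<mu> n = past_law n \<bind> (\<lambda>h. if n = 0 then \<mu> else P (h (n - 1)))"
proof -
  let ?M = "PiM {0..<n} (\<lambda>_. borel_graph U)"
  have sp: "space (past_law n) = space ?M" and sets: "sets (past_law n) = sets ?M"
    by (simp_all add: past_law_def)
  have ne: "space (past_law n) \<noteq> {}"
    using past_law_in[of n] by (auto simp: space_prob_algebra prob_space.not_empty)
  have K: "step_kernel U P \<xi> \<mu> n \<in> past_law n \<rightarrow>\<^sub>M subprob_algebra (borel_graph U)"
    using measurable_prob_algebraD[OF measurable_step_kernel[OF \<xi> \<mu>, of n]] by (simp add: sets cong: measurable_cong_sets)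
  have "state_law \<xi> \<mu> n = past_law n \<bind> (\<lambda>h. distr (step_kernel U P \<xi> \<mu> n h) borel fst)"
    unfolding state_law_def step_law_eq by (rule distr_bind[OF K ne measurable_fst_borel_graph])
  also have "\<dots> = past_law n \<bind> (\<lambda>h. if n = 0 then \<mu> else P (h (n - 1)))"
  proof (rule bind_cong[OF refl])
    fix h assume "h \<in> space (past_law n)"
    then have h: "h \<in> space ?M" by (simp add: sp)
    show "distr (step_kernel U P \<xi> \<mu> n h) borel fst = (if n = 0 then \<mu> else P (h (n - 1)))"
      unfolding step_kernel_def
      using measurable_space[OF measurable_previous_kernel[OF \<mu>] h] measurable_compose_Pair1[OF h strategiesD(1)[OF \<xi>]]
        strategiesD(2)[OF \<xi> h]
      by (intro distr_compose_kernel_fst) auto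
  qed
  finally show ?thesis .
qed

lemma state_law_0: "state_law \<xi> \<mu> 0 = \<mu>"
proof -
  have "state_law \<xi> \<mu> 0 = past_law 0 \<bind> (\<lambda>_. \<mu>)"
    using state_law_eq[of 0] by simp
  also have "\<dots> = \<mu>"
    using past_law_in[of 0] \<mu> by (intro bind_const') (auto simp: space_prob_algebra prob_space_imp_subprob_space)
  finally show ?thesis .
qed

text \<open>However much of the history the strategy remembers, the next state sees the past only
  through the current pair.\<close>

lemma state_law_Suc: "state_law \<xi> \<mu> (Suc n) = step_law \<xi> \<mu> n \<bind> P"
proof -
  let ?M = "PiM {0..<Suc n} (\<lambda>_. borel_graph U)"
  have sets: "sets (past_law (Suc n)) = sets ?M" by (simp add: past_law_def)
  have comp: "(\<lambda>h. h n) \<in> past_law (Suc n) \<rightarrow>\<^sub>M borel_graph U"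
    unfolding measurable_cong_sets[OF sets refl] by (rule measurable_component_singleton) simp
  have "state_law \<xi> \<mu> (Suc n) = past_law (Suc n) \<bind> (\<lambda>h. P (h n))"
    using state_law_eq[of "Suc n"] by simp
  also have "\<dots> = distr (past_law (Suc n)) (borel_graph U) (\<lambda>h. h n) \<bind> P"
    using past_law_in[of "Suc n"]
    by (intro bind_distr[OF comp measurable_prob_algebraD[OF P_kernel], symmetric])
      (auto simp: space_prob_algebra prob_space.not_empty)
  finally show ?thesis by (simp add: distr_past_law)
qed

lemma nn_integral_path_sum:
  assumes "f \<in> borel_measurable (borel_graph U)"
  shows "(\<integral>\<^sup>+\<omega>. (\<Sum>n<N. f (\<omega> n)) \<partial>path_law U P \<xi> \<mu>) = (\<Sum>n<N. \<integral>\<^sup>+z. f z \<partial>step_law \<xi> \<mu> n)"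
proof -
  have m: "(\<lambda>\<omega>. f (\<omega> n)) \<in> borel_measurable (path_law U P \<xi> \<mu>)" for n
    by (rule measurable_compose[OF measurable_path_component assms])
  have "(\<integral>\<^sup>+\<omega>. f (\<omega> n) \<partial>path_law U P \<xi> \<mu>) = (\<integral>\<^sup>+z. f z \<partial>step_law \<xi> \<mu> n)" for n
    unfolding step_law_def using assms by (intro nn_integral_distr[symmetric] measurable_path_component) simp
  then show ?thesis by (simp add: nn_integral_sum m)
qed

end

text \<open>A stationary action depends on the past only through the current state, so by
  associativity of bind the past can be averaged out before the action is drawn.\<close>

lemma step_law_stationary:
  assumes v: "v \<in> sm_strategies U" and \<mu>: "\<mu> \<in> Prob"
  shows "step_law (stationary v) \<mu> n = state_law (stationary v) \<mu> n \<bind> action_kernel v"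
proof -
  note \<xi> = stationary_in_strategies[OF v]
  let ?M = "PiM {0..<n} (\<lambda>_. borel_graph U)"
  let ?past = "past_law (stationary v) \<mu> n" and ?R = "\<lambda>h. if n = 0 then \<mu> else P (h (n - 1))"
  have sp: "space ?past = space ?M" and sets: "sets ?past = sets ?M"
    by (simp_all add: past_law_def[OF \<xi> \<mu>])
  have R: "?R \<in> ?past \<rightarrow>\<^sub>M subprob_algebra borel"
    using measurable_prob_algebraD[OF measurable_previous_kernel[OF \<mu>, of n]] by (simp add: sets cong: measurable_cong_sets)
  have "step_law (stationary v) \<mu> n = ?past \<bind> step_kernel U P (stationary v) \<mu> n"
    by (rule step_law_eq[OF \<xi> \<mu>])
  also have "\<dots> = ?past \<bind> (\<lambda>h. ?R h \<bind> action_kernel v)"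
  proof (rule bind_cong[OF refl])
    fix h assume "h \<in> space ?past"
    then have "?R h \<in> Prob"
      using measurable_space[OF measurable_previous_kernel[OF \<mu>], of h n] by (simp add: sp)
    then show "step_kernel U P (stationary v) \<mu> n h = ?R h \<bind> action_kernel v"
      unfolding step_kernel_def stationary_def case_prod_conv by (rule compose_kernel_bind[OF _ v])
  qed
  also have "\<dots> = (?past \<bind> ?R) \<bind> action_kernel v"
    by (rule bind_assoc[OF R measurable_prob_algebraD[OF measurable_action_kernel[OF v]], symmetric])
  also have "?past \<bind> ?R = state_law (stationary v) \<mu> n"
    by (rule state_law_eq[OF \<xi> \<mu>, symmetric])
  finally show ?thesis .
qed

end

section \<open>Stationary strategies and ergodic occupation measures\<close>

text \<open>Closed sets are a generator stable under intersection, and the indicator of a nonempty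
  closed set is a bounded pointwise limit of continuous functions of the distance to it.\<close>

lemma measure_eqI_bounded_continuous:
  fixes M N :: "'a::metric_space measure"
  assumes M: "prob_space M" "sets M = sets borel" and N: "prob_space N" "sets N = sets borel"
    and eq: "\<And>f :: 'a \<Rightarrow> real. continuous_on UNIV f \<Longrightarrow> bounded (range f) \<Longrightarrow> (\<integral>x. f x \<partial>M) = (\<integral>x. f x \<partial>N)"
  shows "M = N"
proof (rule measure_eqI_generator_eq[where \<Omega>=UNIV and E="Collect closed" and A="\<lambda>_. UNIV"])
  interpret M: prob_space M by fact
  interpret N: prob_space N by fact
  show "Int_stable (Collect (closed :: 'a set \<Rightarrow> bool))"
    by (auto simp: Int_stable_def)
  show "sets M = sigma_sets UNIV (Collect closed)" "sets N = sigma_sets UNIV (Collect closed)"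
    unfolding M N by (simp_all add: borel_eq_closed)
  show "emeasure M UNIV \<noteq> \<infinity>" by simp
  fix F :: "'a set" assume "F \<in> Collect closed"
  then have F: "closed F" by simp
  show "emeasure M F = emeasure N F"
  \<comment> \<open>By convention the distance to the empty set is 0, so the approximating functions
    would be wrong there.\<close>
  proof (cases "F = {}")
    case False
    define f where "f k x = max 0 (1 - real k * infdist x F)" for k x
    have cont: "continuous_on UNIV (f k)" for k
      unfolding f_def by (intro continuous_intros)
    have f01: "0 \<le> f k x" "f k x \<le> 1" for k x
      using infdist_nonneg[of x F] by (auto simp: f_def)
    have bd: "bounded (range (f k))" for k
      using f01 by (intro boundedI[of _ 1]) auto
    have meas: "f k \<in> borel_measurable borel" for k
      using cont by (rule borel_measurable_continuous_onI)
    have lim: "(\<lambda>k. f k x) \<longlonglongrightarrow> indicator F x" for x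
    proof (cases "x \<in> F")
      case True
      then show ?thesis by (simp add: f_def)
    next
      case F': False
      then have pos: "0 < infdist x F"
        using F False by (simp add: infdist_pos_not_in_closed)
      obtain k0 :: nat where "1 / infdist x F < real k0" using reals_Archimedean2 by blast
      then have "1 \<le> real k0 * infdist x F"
        using pos by (simp add: field_simps)
      moreover have "real k0 * infdist x F \<le> real k * infdist x F" if "k0 \<le> k" for k
        using that pos by (intro mult_right_mono) auto
      ultimately have "1 \<le> real k * infdist x F" if "k0 \<le> k" for k
        using that by (meson order_trans)
      then have "\<forall>\<^sub>F k in sequentially. f k x = 0"
        by (intro eventually_sequentiallyI[of k0]) (simp add: f_def)
      then show ?thesis using F' by (simp add: tendsto_eventually)
    qed
    have conv: "(\<lambda>k. \<integral>x. f k x \<partial>Q) \<longlonglongrightarrow> measure Q F" if Q: "prob_space Q" "sets Q = sets borel" for Q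
    proof -
      interpret Q: prob_space Q by fact
      have "(\<lambda>k. \<integral>x. f k x \<partial>Q) \<longlonglongrightarrow> (\<integral>x. indicator F x \<partial>Q)"
      proof (rule integral_dominated_convergence[where w="\<lambda>_. 1"])
        show "f k \<in> borel_measurable Q" for k
          using meas by (simp add: Q cong: measurable_cong_sets)
        have "F \<in> sets Q" using F by (simp add: Q)
        then show "(indicator F :: 'a \<Rightarrow> real) \<in> borel_measurable Q"
          by (rule borel_measurable_indicator)
      qed (use lim f01 in auto)
      also have "(\<integral>x. indicator F x \<partial>Q) = measure Q F"
        using F Q by simp
      finally show ?thesis .
    qed
    have "measure M F = measure N F"
      using conv[OF M] conv[OF N] eq[OF cont bd] by (simp add: LIMSEQ_unique)
    then show ?thesis
      by (simp add: M.emeasure_eq_measure N.emeasure_eq_measure)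
  qed simp
qed auto

lemma limsup_average_const: "limsup (\<lambda>N. (\<Sum>n<N. a) / of_nat N) = (a :: ennreal)"
proof -
  have "(\<lambda>N. (\<Sum>n<N. a) / of_nat N) \<longlonglongrightarrow> a"
  proof (rule tendsto_eventually, rule eventually_sequentiallyI)
    fix N :: nat assume "1 \<le> N"
    then show "(\<Sum>n<N. a) / of_nat N = a"
      by (simp add: mult.commute[of "of_nat N"] mult_divide_eq_ennreal)
  qed
  then show ?thesis by (intro lim_imp_Limsup) simp_all
qed

lemma AE_eq_const_if_nn_integral_le:
  fixes f :: "'a \<Rightarrow> ennreal"
  assumes M: "prob_space M" and f[measurable]: "f \<in> borel_measurable M"
    and ge: "AE x in M. b \<le> f x" and le: "(\<integral>\<^sup>+x. f x \<partial>M) \<le> b" and b: "b < \<infinity>"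
  shows "AE x in M. f x = b"
proof -
  interpret prob_space M by fact
  have "(\<integral>\<^sup>+x. f x - b \<partial>M) = (\<integral>\<^sup>+x. f x \<partial>M) - (\<integral>\<^sup>+x. b \<partial>M)"
    using ge b by (intro nn_integral_diff) (auto simp: emeasure_space_1)
  also have "\<dots> = 0"
    using le b by (simp add: emeasure_space_1 diff_eq_0_iff_ennreal le_less_trans)
  finally have "AE x in M. f x - b = 0"
    by (subst (asm) nn_integral_0_iff_AE) auto
  with ge show ?thesis
    by eventually_elim (auto simp: diff_eq_0_iff_ennreal)
qed

context feller_mdp
begin

lemma eom_in_prob_algebra:
  assumes "\<zeta> \<in> ergodic_occupation_measures U P"
  shows "\<zeta> \<in> space (prob_algebra (borel_graph U))"
  using assms by (simp add: ergodic_occupation_measures_def)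

lemma measurable_integral_P:
  fixes f :: "'x \<Rightarrow> real"
  assumes "f \<in> borel_measurable borel"
  shows "(\<lambda>z. \<integral>y. f y \<partial>P z) \<in> borel_measurable (borel_graph U)"
  by (rule measurable_compose[OF measurable_prob_algebraD[OF P_kernel] integral_measurable_subprob_algebra[OF assms]])

lemma integral_P_bounded:
  fixes f :: "'x \<Rightarrow> real"
  assumes z: "z \<in> graph U" and f: "f \<in> borel_measurable borel" "\<And>x. \<bar>f x\<bar> \<le> B"
  shows "integrable (P z) f" "\<bar>\<integral>y. f y \<partial>P z\<bar> \<le> B"
proof -
  have "P z \<in> Prob" using measurable_space[OF P_kernel, of z] z by simp
  then have sets: "sets (P z) = sets borel" and pr: "prob_space (P z)"
    by (simp_all add: space_prob_algebra)
  interpret prob_space "P z" by fact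
  have m: "f \<in> borel_measurable (P z)"
    using f(1) by (simp add: sets cong: measurable_cong_sets)
  show i: "integrable (P z) f"
    by (rule integrable_const_bound[of _ B]) (use f m in auto)
  have "\<bar>\<integral>y. f y \<partial>P z\<bar> \<le> (\<integral>y. \<bar>f y\<bar> \<partial>P z)"
    by (rule integral_abs_bound)
  also have "\<dots> \<le> (\<integral>y. B \<partial>P z)"
    using i f(2) by (intro integral_mono) auto
  finally show "\<bar>\<integral>y. f y \<partial>P z\<bar> \<le> B" by (simp add: prob_space)
qed

text \<open>Rewrites the defining expression as a difference between the state laws before and after
  a transition. It yields exact invariance here and the telescoping sum in
  \<open>near_optimal_occupation\<close>.\<close>

lemma integral_occupation:
  fixes f :: "'x \<Rightarrow> real"
  assumes \<zeta>: "\<zeta> \<in> space (prob_algebra (borel_graph U))"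
    and f: "f \<in> borel_measurable borel" "\<And>x. \<bar>f x\<bar> \<le> B"
  shows "(\<integral>z. f (fst z) - (\<integral>y. f y \<partial>P z) \<partial>\<zeta>) = (\<integral>x. f x \<partial>distr \<zeta> borel fst) - (\<integral>x. f x \<partial>(\<zeta> \<bind> P))"
proof -
  have sets: "sets \<zeta> = sets (borel_graph U)" and pr: "prob_space \<zeta>"
    using \<zeta> by (simp_all add: space_prob_algebra)
  have sp: "space \<zeta> = graph U" using sets_eq_imp_space_eq[OF sets] by simp
  interpret prob_space \<zeta> by fact
  have fst: "fst \<in> \<zeta> \<rightarrow>\<^sub>M borel" unfolding measurable_cong_sets[OF sets refl] by simp
  have i1: "integrable \<zeta> (\<lambda>z. f (fst z))"
    by (rule integrable_const_bound[of _ B]) (use f measurable_compose[OF fst f(1)] in auto)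
  have i2: "integrable \<zeta> (\<lambda>z. \<integral>y. f y \<partial>P z)"
  proof (rule integrable_const_bound[of _ B])
    show "AE z in \<zeta>. norm (\<integral>y. f y \<partial>P z) \<le> B"
      using integral_P_bounded(2)[OF _ f] by (intro AE_I2) (simp add: sp)
    show "(\<lambda>z. \<integral>y. f y \<partial>P z) \<in> borel_measurable \<zeta>"
      unfolding measurable_cong_sets[OF sets refl] by (rule measurable_integral_P[OF f(1)])
  qed
  have "(\<integral>x. f x \<partial>(\<zeta> \<bind> P)) = (\<integral>z. \<integral>y. f y \<partial>P z \<partial>\<zeta>)"
  proof (rule integral_bind[where K=borel and B=B and B'=1])
    show "P \<in> \<zeta> \<rightarrow>\<^sub>M subprob_algebra borel"
      unfolding measurable_cong_sets[OF sets refl] by (rule measurable_prob_algebraD[OF P_kernel])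
    show "finite_measure \<zeta>" by unfold_locales
    show "AE x in \<zeta>. emeasure (P x) (space (P x)) \<le> ennreal 1"
      using measurable_space[OF P_kernel] by (intro AE_I2) (auto simp: sp space_prob_algebra prob_space.emeasure_space_1)
  qed (use f in auto)
  then show ?thesis
    unfolding Bochner_Integration.integral_diff[OF i1 i2] integral_distr[OF fst f(1)] by simp
qed

text \<open>Bounded continuous functions determine a probability measure. The identity of measures
  then also applies to unbounded and infinite costs.\<close>

lemma eom_invariant:
  assumes \<zeta>: "\<zeta> \<in> ergodic_occupation_measures U P"
  shows "\<zeta> \<bind> P = distr \<zeta> borel fst"
proof (rule measure_eqI_bounded_continuous)
  note pa = eom_in_prob_algebra[OF \<zeta>]
  show "prob_space (\<zeta> \<bind> P)" "sets (\<zeta> \<bind> P) = sets borel"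
    using prob_space_bind'[OF pa P_kernel] sets_bind'[OF pa P_kernel] by auto
  show "prob_space (distr \<zeta> borel fst)"
    using measurable_space[OF measurable_distr_prob_space[OF measurable_fst_borel_graph] pa]
    by (simp add: space_prob_algebra)
  show "sets (distr \<zeta> borel fst) = sets borel" by simp
  fix f :: "'x \<Rightarrow> real" assume cont: "continuous_on UNIV f" and bd: "bounded (range f)"
  obtain B where B: "\<And>x. \<bar>f x\<bar> \<le> B" using bd by (auto simp: bounded_iff)
  have "(\<integral>z. f (fst z) - (\<integral>y. f y \<partial>P z) \<partial>\<zeta>) = 0"
    using \<zeta> cont bd by (simp add: ergodic_occupation_measures_def)
  then show "(\<integral>x. f x \<partial>(\<zeta> \<bind> P)) = (\<integral>x. f x \<partial>distr \<zeta> borel fst)"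
    using integral_occupation[OF pa borel_measurable_continuous_onI[OF cont] B] by simp
qed

lemma compose_kernel_cong_AE:
  assumes \<pi>: "\<pi> \<in> Prob" and v: "v \<in> borel \<rightarrow>\<^sub>M prob_algebra borel" and w: "w \<in> borel \<rightarrow>\<^sub>M prob_algebra borel"
    and ae: "AE x in \<pi>. v x = w x"
  shows "compose_kernel U \<pi> v = compose_kernel U \<pi> w"
proof -
  have "glue \<pi> v = glue \<pi> w"
    unfolding glue_def
    by (rule bind_cong_AE'[OF \<pi> glue_kernel[OF v] glue_kernel[OF w]]) (use ae in eventually_elim, simp)
  then show ?thesis by (simp add: compose_kernel_eq)
qed

text \<open>Drawing an action and then a transition maps \<open>\<pi>\<close> to itself, so a start
  from \<open>\<pi>\<close> makes all one-step laws equal.\<close>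

lemma stationary_state_law:
  assumes \<zeta>: "\<zeta> \<in> ergodic_occupation_measures U P" and \<pi>: "\<pi> \<in> Prob"
    and v: "v \<in> sm_strategies U" and eq: "\<zeta> = compose_kernel U \<pi> v"
  shows "\<pi> \<bind> action_kernel v = \<zeta>" "\<zeta> \<bind> P = \<pi>"
    "state_law (stationary v) \<pi> n = \<pi>" "step_law (stationary v) \<pi> n = \<zeta>"
proof -
  note \<xi> = stationary_in_strategies[OF v]
  show bind: "\<pi> \<bind> action_kernel v = \<zeta>"
    unfolding eq by (rule compose_kernel_bind[OF \<pi> v, symmetric])
  show inv: "\<zeta> \<bind> P = \<pi>"
    unfolding eom_invariant[OF \<zeta>] unfolding eq
    using sm_strategiesD[OF v] by (intro distr_compose_kernel_fst \<pi>) auto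
  show st: "state_law (stationary v) \<pi> n = \<pi>"
  proof (induction n)
    case (Suc n)
    then show ?case
      by (simp add: state_law_Suc[OF \<xi> \<pi>] step_law_stationary[OF v \<pi>] bind inv)
  qed (rule state_law_0[OF \<xi> \<pi>])
  show "step_law (stationary v) \<pi> n = \<zeta>"
    unfolding step_law_stationary[OF v \<pi>] st by (rule bind)
qed

lemma avg_cost_eq:
  assumes "\<xi> \<in> strategies U" "\<mu> \<in> Prob"
  shows "avg_cost U P c \<mu> \<xi> = limsup (\<lambda>N. (\<Sum>n<N. \<integral>\<^sup>+z. c z \<partial>step_law \<xi> \<mu> n) / of_nat N)"
  unfolding avg_cost_def by (simp add: nn_integral_path_sum[OF assms c_measurable])

lemma opt_value_le_avg_cost:
  assumes "\<xi> \<in> strategies U" "\<mu> \<in> Prob"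
  shows "opt_value U P c \<le> value_fn U P c \<mu>" "value_fn U P c \<mu> \<le> avg_cost U P c \<mu> \<xi>"
  using assms by (auto simp: opt_value_def value_fn_def intro: INF_lower)

text \<open>The first kernel of any strategy is stationary, which avoids a measurable selection theorem.\<close>

lemma sm_strategies_nonempty:
  assumes "strategies U \<noteq> {}"
  shows "sm_strategies U \<noteq> {}"
proof -
  obtain \<xi> where \<xi>: "\<xi> \<in> strategies U" using assms by auto
  let ?h = "\<lambda>_. undefined"
  have h: "?h \<in> space (PiM {0..<0::nat} (\<lambda>_. borel_graph U))" by (simp add: space_PiM)
  have "(\<lambda>x. \<xi> 0 (?h, x)) \<in> sm_strategies U"
    using measurable_compose_Pair1[OF h strategiesD(1)[OF \<xi>]] strategiesD(2)[OF \<xi> h]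
    by (auto simp: sm_strategies_def)
  then show ?thesis by auto
qed

text \<open>The disintegration kernel gives \<open>U x\<close> full mass only almost everywhere,
  because the graph has mass 1 and no kernel mass exceeds 1. On the exceptional set some strategy
  \<open>w\<close> takes over, as \<open>sm_strategies\<close> demands full mass at every x.\<close>

lemma eom_stationary_strategy:
  assumes ne: "strategies U \<noteq> {}" and \<zeta>: "\<zeta> \<in> space (prob_algebra (borel_graph U))"
  obtains \<pi> v where "\<pi> \<in> Prob" "v \<in> sm_strategies U" "\<zeta> = compose_kernel U \<pi> v"
proof -
  have sets: "sets \<zeta> = sets (borel_graph U)" and pr: "prob_space \<zeta>"
    using \<zeta> by (simp_all add: space_prob_algebra)
  have sp: "space \<zeta> = graph U" using sets_eq_imp_space_eq[OF sets] by simp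
  interpret prob_space \<zeta> by fact
  have id: "(\<lambda>z. z) \<in> \<zeta> \<rightarrow>\<^sub>M borel"
    unfolding measurable_cong_sets[OF sets refl] by (rule measurable_restrict_space1) simp
  \<comment> \<open>Disintegration is available on the full product, so the measure is first moved
    there from the graph.\<close>
  define \<eta> where "\<eta> = distr \<zeta> borel (\<lambda>z. z)"
  have \<eta>: "prob_space \<eta>" "sets \<eta> = sets (borel \<Otimes>\<^sub>M borel)"
    unfolding \<eta>_def by (rule prob_space_distr[OF id]) (simp only: sets_distr borel_prod)
  have \<eta>_graph: "emeasure \<eta> (graph U) = 1"
    unfolding \<eta>_def using emeasure_space_1 by (simp add: emeasure_distr[OF id] sp)
  obtain v where v: "v \<in> borel \<rightarrow>\<^sub>M prob_algebra borel"
    and \<eta>_eq: "\<eta> = distr \<eta> borel fst \<bind> (\<lambda>x. distr (v x) (borel \<Otimes>\<^sub>M borel) (Pair x))"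
    using disintegration[OF \<eta>] by blast
  define \<pi> where "\<pi> = distr \<eta> borel fst"
  have "fst \<in> \<eta> \<rightarrow>\<^sub>M borel" unfolding measurable_cong_sets[OF \<eta>(2) refl] by simp
  then have \<pi>: "\<pi> \<in> Prob"
    unfolding \<pi>_def space_prob_algebra using prob_space.prob_space_distr[OF \<eta>(1)] by auto
  have glue: "\<eta> = glue \<pi> v"
    using \<eta>_eq unfolding glue_def \<pi>_def borel_prod .
  have ms: "(\<lambda>x. emeasure (v x) (U x)) \<in> borel_measurable borel"
  proof (rule emeasure_measurable_subprob_algebra2)
    have "(SIGMA x:space borel. U x) = graph U" by (auto simp: graph_def)
    then show "(SIGMA x:space borel. U x) \<in> sets (borel \<Otimes>\<^sub>M borel)"
      unfolding borel_prod by simp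
    show "v \<in> borel \<rightarrow>\<^sub>M subprob_algebra borel" by (rule measurable_prob_algebraD[OF v])
  qed
  have le1: "emeasure (v x) (U x) \<le> 1" for x
    using measurable_space[OF v, of x] by (auto simp: space_prob_algebra intro: prob_space.emeasure_le_1)
  have ae: "AE x in \<pi>. emeasure (v x) (U x) = 1"
  proof -
    interpret \<pi>: prob_space \<pi> using \<pi> by (simp add: space_prob_algebra)
    have [measurable]: "(\<lambda>x. emeasure (v x) (U x)) \<in> borel_measurable \<pi>"
      using ms \<pi> by (simp add: space_prob_algebra cong: measurable_cong_sets)
    have one: "(\<integral>\<^sup>+x. emeasure (v x) (U x) \<partial>\<pi>) = 1"
      using \<eta>_graph unfolding glue emeasure_glue_graph_eq[OF \<pi> v] .
    have "(\<integral>\<^sup>+x. 1 - emeasure (v x) (U x) \<partial>\<pi>) = 0"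
      using le1 one by (subst nn_integral_diff) (simp_all add: \<pi>.emeasure_space_1)
    then have "AE x in \<pi>. 1 - emeasure (v x) (U x) = 0"
      by (subst (asm) nn_integral_0_iff_AE) auto
    then show ?thesis
      by eventually_elim (use le1 in \<open>auto intro!: antisym simp: diff_eq_0_iff_ennreal\<close>)
  qed
  obtain w where w: "w \<in> sm_strategies U" using sm_strategies_nonempty[OF ne] by auto
  define v' where "v' x = (if emeasure (v x) (U x) = 1 then v x else w x)" for x
  have v'_m: "v' \<in> borel \<rightarrow>\<^sub>M prob_algebra borel"
    unfolding v'_def using ms by (intro measurable_If v sm_strategiesD(1)[OF w]) measurable
  have v': "v' \<in> sm_strategies U"
    using v'_m sm_strategiesD(2)[OF w] by (auto simp: sm_strategies_def v'_def)
  have "compose_kernel U \<pi> v' = compose_kernel U \<pi> v"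
    by (rule compose_kernel_cong_AE[OF \<pi> v'_m v]) (use ae in eventually_elim, simp add: v'_def)
  also have "\<dots> = restrict_space \<eta> (graph U)"
    by (simp add: compose_kernel_eq glue)
  also have "\<dots> = \<zeta>"
  proof (rule measure_eqI)
    show s: "sets (restrict_space \<eta> (graph U)) = sets \<zeta>"
      using sets by (simp add: \<eta>_def sets_restrict_space)
    fix A assume "A \<in> sets (restrict_space \<eta> (graph U))"
    then have A: "A \<in> sets (borel_graph U)" using s sets by simp
    then have A': "A \<subseteq> graph U" "A \<in> sets borel"
      using sets.sets_into_space[OF A] sets_graph by (auto simp: sets_restrict_space)
    then show "emeasure (restrict_space \<eta> (graph U)) A = emeasure \<zeta> A"
      by (simp add: emeasure_restrict_space \<eta>_def emeasure_distr[OF id] sp Int_absorb2)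
  qed
  finally show thesis by (intro that[OF \<pi> v']) simp
qed

lemma opt_value_le_eom_cost:
  assumes ne: "strategies U \<noteq> {}" and \<zeta>: "\<zeta> \<in> ergodic_occupation_measures U P"
  shows "opt_value U P c \<le> (\<integral>\<^sup>+z. c z \<partial>\<zeta>)"
proof -
  obtain \<pi> v where \<pi>: "\<pi> \<in> Prob" and v: "v \<in> sm_strategies U" and eq: "\<zeta> = compose_kernel U \<pi> v"
    using eom_stationary_strategy[OF ne eom_in_prob_algebra[OF \<zeta>]] by blast
  note \<xi> = stationary_in_strategies[OF v]
  have "opt_value U P c \<le> avg_cost U P c \<pi> (stationary v)"
    using opt_value_le_avg_cost[OF \<xi> \<pi>] by (rule order_trans)
  also have "\<dots> = (\<integral>\<^sup>+z. c z \<partial>\<zeta>)"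
    unfolding avg_cost_eq[OF \<xi> \<pi>] stationary_state_law(4)[OF \<zeta> \<pi> v eq] by (rule limsup_average_const)
  finally show ?thesis .
qed

section \<open>The state chain of a stationary strategy and its long-run averages\<close>

definition chain_kernel :: "('x \<Rightarrow> 'u measure) \<Rightarrow> 'x \<Rightarrow> 'x measure" where
  "chain_kernel v x = action_kernel v x \<bind> P"

lemma measurable_chain_kernel:
  "v \<in> sm_strategies U \<Longrightarrow> chain_kernel v \<in> borel \<rightarrow>\<^sub>M prob_algebra borel"
  unfolding chain_kernel_def[abs_def]
  by (rule measurable_bind_prob_space[OF measurable_action_kernel P_kernel])

text \<open>The last transition is absorbed into the integrand, so the induction runs over all
  \<open>g\<close>. This identifies the time-n expectation with the n-th power of the Markov
  operator.\<close>

lemma nn_integral_state_law: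
  assumes v: "v \<in> sm_strategies U" and g: "g \<in> borel_measurable borel"
  shows "(\<integral>\<^sup>+y. g y \<partial>state_law (stationary v) (return borel x) n) =
    ((\<lambda>f x. \<integral>\<^sup>+y. f y \<partial>chain_kernel v x) ^^ n) g x"
  using g
proof (induction n arbitrary: g)
  note \<xi> = stationary_in_strategies[OF v]
  have \<mu>: "return borel x \<in> Prob" by (simp add: space_prob_algebra prob_space_return)
  {
    case 0
    then show ?case by (simp add: state_law_0[OF \<xi> \<mu>] nn_integral_return)
  next
    case (Suc n)
    let ?Q = "state_law (stationary v) (return borel x)"
    have sets: "sets (?Q n) = sets borel"
      using state_law_in[OF \<xi> \<mu>, of n] by (simp add: space_prob_algebra)
    have K: "chain_kernel v \<in> borel \<rightarrow>\<^sub>M subprob_algebra borel"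
      by (rule measurable_prob_algebraD[OF measurable_chain_kernel[OF v]])
    have K': "chain_kernel v \<in> ?Q n \<rightarrow>\<^sub>M subprob_algebra borel"
      unfolding measurable_cong_sets[OF sets refl] by (rule K)
    have A: "action_kernel v \<in> ?Q n \<rightarrow>\<^sub>M subprob_algebra (borel_graph U)"
      unfolding measurable_cong_sets[OF sets refl] by (rule measurable_prob_algebraD[OF measurable_action_kernel[OF v]])
    have "?Q (Suc n) = (?Q n \<bind> action_kernel v) \<bind> P"
      by (simp add: state_law_Suc[OF \<xi> \<mu>] step_law_stationary[OF v \<mu>])
    also have "\<dots> = ?Q n \<bind> chain_kernel v"
      unfolding chain_kernel_def[abs_def] by (rule bind_assoc[OF A measurable_prob_algebraD[OF P_kernel]])
    finally have "(\<integral>\<^sup>+y. g y \<partial>?Q (Suc n)) = (\<integral>\<^sup>+y. \<integral>\<^sup>+z. g z \<partial>chain_kernel v y \<partial>?Q n)"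
      using nn_integral_bind[OF Suc.prems K'] by simp
    also have "\<dots> = ((\<lambda>f x. \<integral>\<^sup>+y. f y \<partial>chain_kernel v x) ^^ n) (\<lambda>y. \<integral>\<^sup>+z. g z \<partial>chain_kernel v y) x"
      by (rule Suc.IH) (rule measurable_compose[OF K nn_integral_measurable_subprob_algebra[OF Suc.prems]])
    finally show ?case by (simp only: funpow_Suc_right o_apply)
  }
qed

lemma nn_integral_step_law_stationary:
  assumes v: "v \<in> sm_strategies U" and \<mu>: "\<mu> \<in> Prob" and f: "f \<in> borel_measurable (borel_graph U)"
  shows "(\<integral>\<^sup>+z. f z \<partial>step_law (stationary v) \<mu> n) = (\<integral>\<^sup>+x. cost_under U f v x \<partial>state_law (stationary v) \<mu> n)"
proof -
  note \<xi> = stationary_in_strategies[OF v]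
  have sets: "sets (state_law (stationary v) \<mu> n) = sets borel"
    using state_law_in[OF \<xi> \<mu>, of n] by (simp add: space_prob_algebra)
  have A: "action_kernel v \<in> state_law (stationary v) \<mu> n \<rightarrow>\<^sub>M subprob_algebra (borel_graph U)"
    unfolding measurable_cong_sets[OF sets refl] by (rule measurable_prob_algebraD[OF measurable_action_kernel[OF v]])
  show ?thesis
    unfolding step_law_stationary[OF v \<mu>] nn_integral_bind[OF f A] by (simp add: nn_integral_action_kernel[OF v f])
qed

lemma stationary_optimal:
  assumes \<zeta>: "\<zeta> \<in> optimal_eoms U P c" and fin: "opt_value U P c < \<infinity>"
    and \<pi>: "\<pi> \<in> Prob" and v: "v \<in> sm_strategies U" and eq: "\<zeta> = compose_kernel U \<pi> v"
  shows "AE x in \<pi>.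
    ((\<lambda>N. (\<integral>\<^sup>+\<omega>. (\<Sum>n<N. cost_under U c v (fst (\<omega> n))) \<partial>path_law U P (stationary v) (return borel x)) / of_nat N)
       \<longlonglongrightarrow> value_fn U P c (return borel x)) \<and> value_fn U P c (return borel x) = opt_value U P c"
proof -
  note \<xi> = stationary_in_strategies[OF v]
  have eom: "\<zeta> \<in> ergodic_occupation_measures U P" and opt: "(\<integral>\<^sup>+z. c z \<partial>\<zeta>) = opt_value U P c"
    using \<zeta> by (auto simp: optimal_eoms_def)
  note st = stationary_state_law[OF eom \<pi> v eq]
  have sets_\<pi>: "sets \<pi> = sets borel" and prob_\<pi>: "prob_space \<pi>"
    using \<pi> by (simp_all add: space_prob_algebra)
  let ?f = "cost_under U c v"
  have f: "?f \<in> borel_measurable borel" by (rule measurable_cost_under[OF v c_measurable])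
  interpret E: invariant_kernel \<pi> "chain_kernel v"
  proof (intro invariant_kernel.intro prob_\<pi> invariant_kernel_axioms.intro)
    show "chain_kernel v \<in> \<pi> \<rightarrow>\<^sub>M prob_algebra \<pi>"
      using measurable_chain_kernel[OF v] sets_\<pi>
      by (simp add: prob_algebra_def subprob_algebra_cong[OF sets_\<pi>] cong: measurable_cong_sets)
    have A: "action_kernel v \<in> \<pi> \<rightarrow>\<^sub>M subprob_algebra (borel_graph U)"
      unfolding measurable_cong_sets[OF sets_\<pi> refl] by (rule measurable_prob_algebraD[OF measurable_action_kernel[OF v]])
    show "\<pi> \<bind> chain_kernel v = \<pi>"
      unfolding chain_kernel_def[abs_def] bind_assoc[OF A measurable_prob_algebraD[OF P_kernel], symmetric]
      by (simp add: st)
  qed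
  have f_\<pi>: "?f \<in> borel_measurable \<pi>" using f by (simp add: sets_\<pi> cong: measurable_cong_sets)
  have int_f: "(\<integral>\<^sup>+x. ?f x \<partial>\<pi>) = opt_value U P c"
    using nn_integral_step_law_stationary[OF v \<pi> c_measurable, of 0] by (simp add: st opt)
  have S: "E.S ?f N x = (\<Sum>n<N. \<integral>\<^sup>+y. ?f y \<partial>state_law (stationary v) (return borel x) n)" for N x
    unfolding E.S_def by (simp add: nn_integral_state_law[OF v f] E.T_def[abs_def])
  have \<mu>: "return borel x \<in> Prob" for x by (simp add: space_prob_algebra prob_space_return)
  have avg: "avg_cost U P c (return borel x) (stationary v) = E.upp ?f x" for x
    unfolding avg_cost_eq[OF \<xi> \<mu>] E.upp_def S by (simp add: nn_integral_step_law_stationary[OF v \<mu> c_measurable])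
  \<comment> \<open>The claim averages \<open>c_v\<close> along the states, while
    \<open>avg_cost\<close> averages \<open>c\<close> along the pairs; both reduce to the sums
    \<open>E.S\<close>.\<close>
  have path: "(\<integral>\<^sup>+\<omega>. (\<Sum>n<N. ?f (fst (\<omega> n))) \<partial>path_law U P (stationary v) (return borel x)) = E.S ?f N x" for N x
  proof -
    have m: "(\<lambda>z. ?f (fst z)) \<in> borel_measurable (borel_graph U)"
      by (rule measurable_compose[OF measurable_fst_borel_graph f])
    have "(\<integral>\<^sup>+z. ?f (fst z) \<partial>step_law (stationary v) (return borel x) n) =
        (\<integral>\<^sup>+y. ?f y \<partial>state_law (stationary v) (return borel x) n)" for n
    proof -
      have "sets (step_law (stationary v) (return borel x) n) = sets (borel_graph U)"
        using step_law_in[OF \<xi> \<mu>] by (simp add: space_prob_algebra)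
      then show ?thesis
        unfolding state_law_def using f
        by (intro nn_integral_distr[symmetric]) (simp_all cong: measurable_cong_sets)
    qed
    then show ?thesis
      using nn_integral_path_sum[OF \<xi> \<mu> m] by (simp add: S)
  qed
  have conv: "AE x in \<pi>. (\<lambda>N. E.S ?f N x / of_nat N) \<longlonglongrightarrow> E.low ?f x"
    using fin int_f by (intro E.pointwise_ergodic f_\<pi>) simp
  then have upp: "AE x in \<pi>. E.upp ?f x = E.low ?f x"
    by eventually_elim (simp add: E.upp_def lim_imp_Limsup)
  \<comment> \<open>The value is squeezed between \<beta> and the upper average, so it equals
    \<beta> wherever the limit of the averages does.\<close>
  have ge: "opt_value U P c \<le> value_fn U P c (return borel x)" "value_fn U P c (return borel x) \<le> E.upp ?f x" for x
    using opt_value_le_avg_cost[OF \<xi> \<mu>[of x]] by (simp_all add: avg)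
  have "AE x in \<pi>. E.low ?f x = opt_value U P c"
  proof (rule AE_eq_const_if_nn_integral_le[OF prob_\<pi>])
    show "AE x in \<pi>. opt_value U P c \<le> E.low ?f x"
      using upp by eventually_elim (metis ge order_trans)
    show "(\<integral>\<^sup>+x. E.low ?f x \<partial>\<pi>) \<le> opt_value U P c"
      using E.nn_integral_low_le[OF f_\<pi>] by (simp add: int_f)
  qed (use f_\<pi> fin in auto)
  with conv upp show ?thesis
  proof eventually_elim
    case (elim x)
    then have "value_fn U P c (return borel x) = opt_value U P c"
      using ge[of x] by (intro antisym) simp_all
    with elim show ?case by (simp add: path)
  qed
qed

end

section \<open>Limits of near-optimal occupation measures\<close>

text \<open>A ball around a subsequential limit contains infinitely many terms, so it cannot be
  decided negatively; it therefore contains all late terms.\<close>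

lemma deciding_convergent:
  fixes z :: "nat \<Rightarrow> 'a::{metric_space, second_countable_topology}"
  assumes dec: "\<And>i k. eventually_decided z (sball i k)"
    and s: "strict_mono s" "(z \<circ> s) \<longlonglongrightarrow> l"
  shows "z \<longlonglongrightarrow> l"
proof (rule tendstoI)
  fix e :: real assume "0 < e"
  then obtain k where k: "inverse (real (Suc k)) < e / 2"
    using reals_Archimedean[of "e / 2"] by auto
  obtain i where i: "l \<in> sball i k" using mem_sball[of l k] by auto
  have "\<forall>\<^sub>F n in sequentially. (z \<circ> s) n \<in> sball i k"
    by (rule topological_tendstoD[OF s(2) _ i]) (simp add: sball_def)
  then have "\<not> (\<forall>\<^sub>F n in sequentially. z n \<notin> sball i k)"
    using eventually_subseq[OF s(1), of "\<lambda>n. z n \<notin> sball i k"] eventually_happens'[OF sequentially_bot]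
    by (metis (mono_tags, lifting) comp_apply eventually_conj sequentially_bot trivial_limit_sequentially eventually_happens')
  then have "\<forall>\<^sub>F n in sequentially. z n \<in> sball i k" using dec by blast
  then show "\<forall>\<^sub>F n in sequentially. dist (z n) l < e"
  proof eventually_elim
    case (elim n)
    have "dist (z n) l \<le> dist (dense_seq i) (z n) + dist (dense_seq i) l"
      by (rule dist_triangle3)
    then show ?case using elim i k by (simp add: sball_def)
  qed
qed

text \<open>Used contrapositively: a deciding sequence that does not converge eventually leaves
  every compact set.\<close>

lemma deciding_convergent_compact:
  fixes z :: "nat \<Rightarrow> 'a::{metric_space, second_countable_topology}"
  assumes dec: "\<And>i k. eventually_decided z (sball i k)"
    and C: "compact C" and fr: "\<exists>\<^sub>F n in sequentially. z n \<in> C"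
  shows "Cauchy z"
proof -
  have inf: "infinite {n. z n \<in> C}"
    using fr by (simp add: frequently_cofinite[symmetric] cofinite_eq_sequentially)
  let ?s = "enumerate {n. z n \<in> C}"
  have s: "strict_mono ?s" using inf by (rule strict_mono_enumerate)
  have "(z \<circ> ?s) n \<in> C" for n using enumerate_in_set[OF inf, of n] by simp
  then obtain l t where t: "strict_mono t" "((z \<circ> ?s) \<circ> t) \<longlonglongrightarrow> l"
    using C unfolding compact_eq_seq_compact_metric seq_compact_def by metis
  have "z \<longlonglongrightarrow> l"
    using dec strict_mono_o[OF s t(1)] t(2) by (intro deciding_convergent[of z "?s \<circ> t"]) (simp_all add: comp_assoc)
  then show ?thesis by (rule LIMSEQ_imp_Cauchy)
qed

lemma Cauchy_if_eventually_sball: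
  fixes x :: "nat \<Rightarrow> 'a::{metric_space, second_countable_topology}"
  assumes "\<And>k. \<exists>i. \<forall>\<^sub>F n in sequentially. x n \<in> sball i k"
  shows "Cauchy x"
proof (rule metric_CauchyI)
  fix e :: real assume "0 < e"
  then obtain k where k: "inverse (real (Suc k)) < e / 2"
    using reals_Archimedean[of "e / 2"] by auto
  obtain i N where N: "\<And>n. n \<ge> N \<Longrightarrow> x n \<in> sball i k"
    using assms[of k] by (auto simp: eventually_sequentially)
  have "dist (x m) (x n) < e" if "m \<ge> N" "n \<ge> N" for m n
  proof -
    have "dist (x m) (x n) \<le> dist (dense_seq i) (x m) + dist (dense_seq i) (x n)"
      by (rule dist_triangle3)
    then show ?thesis using N[OF that(1)] N[OF that(2)] k by (simp add: sball_def)
  qed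
  then show "\<exists>M. \<forall>m\<ge>M. \<forall>n\<ge>M. dist (x m) (x n) < e" by blast
qed

lemma lsc_on_liminf:
  assumes lsc: "lsc_on S f" and z: "\<And>n. z n \<in> S" "z \<longlonglongrightarrow> l" "l \<in> S"
  shows "f l \<le> liminf (\<lambda>n. f (z n))"
proof (rule dense_le)
  fix a assume a: "a < f l"
  obtain T where T: "open T" "{z \<in> S. a < f z} = S \<inter> T"
    using lsc unfolding lsc_on_def openin_open by meson
  then have "l \<in> T" using z(3) a by blast
  then have "\<forall>\<^sub>F n in sequentially. z n \<in> T"
    using z(2) T(1) by (simp add: topological_tendstoD)
  then have "\<forall>\<^sub>F n in sequentially. a \<le> f (z n)"
    by eventually_elim (use T(2) z(1) in \<open>auto intro: less_imp_le\<close>)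
  then show "a \<le> liminf (\<lambda>n. f (z n))" by (rule Liminf_bounded)
qed

section \<open>Continuous cut-offs to finitely many small balls\<close>

definition ball_gap :: "nat \<Rightarrow> nat \<Rightarrow> 'a::{metric_space, second_countable_topology} \<Rightarrow> real" where
  "ball_gap M k x = (\<Prod>i\<le>M. min 1 (real (Suc k) * dist x (dense_seq i)))"

lemma ball_gap_bounds: "0 \<le> ball_gap M k x" "ball_gap M k x \<le> 1"
  unfolding ball_gap_def by (auto intro!: prod_nonneg prod_le_1)

lemma continuous_ball_gap: "continuous_on UNIV (ball_gap M k)"
  unfolding ball_gap_def[abs_def] by (intro continuous_intros)

lemma ball_gap_outside:
  assumes "\<And>i. i \<le> M \<Longrightarrow> x \<notin> sball i k"
  shows "ball_gap M k x = 1"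
  unfolding ball_gap_def
proof (rule prod.neutral, intro ballI)
  fix i assume "i \<in> {..M}"
  then have "inverse (real (Suc k)) \<le> dist x (dense_seq i)"
    using assms[of i] by (simp add: sball_def dist_commute)
  then have "1 \<le> real (Suc k) * dist x (dense_seq i)"
    by (simp add: field_simps)
  then show "min 1 (real (Suc k) * dist x (dense_seq i)) = 1" by simp
qed

text \<open>By density some centre is within e/(k+1) of x, which makes its factor less than e; the
  other factors are at most 1.\<close>

lemma ball_gap_tendsto_0: "(\<lambda>M. ball_gap M k x) \<longlonglongrightarrow> 0"
proof (rule LIMSEQ_I)
  fix e :: real assume e: "0 < e"
  obtain i where i: "dense_seq i \<in> ball x (e / real (Suc k))"
    using dense_seq_in_open[of "ball x (e / real (Suc k))"] e by (auto simp: add_pos_nonneg not_le)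
  have "norm (ball_gap M k x - 0) < e" if "M \<ge> i" for M
  proof -
    have "ball_gap M k x = min 1 (real (Suc k) * dist x (dense_seq i)) *
        (\<Prod>j\<in>{..M} - {i}. min 1 (real (Suc k) * dist x (dense_seq j)))"
      unfolding ball_gap_def using that by (intro prod.remove) auto
    also have "\<dots> \<le> min 1 (real (Suc k) * dist x (dense_seq i)) * 1"
      by (intro mult_left_mono prod_le_1) auto
    also have "\<dots> < e" using i by (simp add: field_simps min_less_iff_disj)
    finally show ?thesis using ball_gap_bounds(1)[of M k x] by simp
  qed
  then show "\<exists>no. \<forall>M\<ge>no. norm (ball_gap M k x - 0) < e" by blast
qed

lemma bounded_range_if_between:
  fixes f :: "'a \<Rightarrow> real"
  assumes "\<And>x. 0 \<le> f x" "\<And>x. f x \<le> B"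
  shows "bounded (range f)"
  using assms by (intro boundedI[of _ B]) auto

text \<open>Continuous, and zero outside finitely many balls of radius 1/(k+1): a substitute for
  compact support that does not rely on local compactness.\<close>

definition cutoff :: "nat \<Rightarrow> nat \<Rightarrow> ('a::{metric_space, second_countable_topology} \<Rightarrow> real) \<Rightarrow> 'a \<Rightarrow> real" where
  "cutoff M k f x = f x * (1 - ball_gap M k x)"

lemma cutoff_bounds:
  assumes "0 \<le> f x"
  shows "0 \<le> cutoff M k f x" "cutoff M k f x \<le> f x"
  using assms ball_gap_bounds[of M k x] by (simp_all add: cutoff_def mult_left_le)

lemma continuous_cutoff: "continuous_on UNIV f \<Longrightarrow> continuous_on UNIV (cutoff M k f)"
  unfolding cutoff_def[abs_def] by (intro continuous_intros continuous_ball_gap)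

lemma cutoff_tendsto: "(\<lambda>M. cutoff M k f x) \<longlonglongrightarrow> f x"
  using tendsto_mult[OF tendsto_const tendsto_diff[OF tendsto_const ball_gap_tendsto_0], of "f x" 1 k x]
  by (simp add: cutoff_def)

text \<open>Decisions hold at every sample point, not just almost surely;
  \<open>graph_representation\<close> arranges this by redefining the points on a null set. States
  are decided separately because escaping actions can keep a pair out of every ball without settling
  where its state goes.\<close>

locale deciding_limit = feller_mdp U P c + \<Omega>: prob_space \<Omega>
  for U :: "'x::polish_space \<Rightarrow> 'u::polish_space set"
    and P :: "'x \<times> 'u \<Rightarrow> 'x measure"
    and c :: "'x \<times> 'u \<Rightarrow> ennreal"
    and \<Omega> :: "'w measure" +
  fixes Z :: "nat \<Rightarrow> 'w \<Rightarrow> 'x \<times> 'u" and K :: "('x \<times> 'u) set" and \<epsilon> :: real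
  assumes Z: "Z n \<in> \<Omega> \<rightarrow>\<^sub>M borel_graph U"
    and decides: "\<omega> \<in> space \<Omega> \<Longrightarrow>
      eventually_decided (\<lambda>n. Z n \<omega>) (sball i k)"
    and decides_fst: "\<omega> \<in> space \<Omega> \<Longrightarrow>
      eventually_decided (\<lambda>n. fst (Z n \<omega>)) (sball i k)"
    and asymp_invariant: "continuous_on UNIV f \<Longrightarrow> bounded (range f) \<Longrightarrow>
      (\<lambda>n. \<integral>\<omega>. f (fst (Z n \<omega>)) - (\<integral>y. f y \<partial>P (Z n \<omega>)) \<partial>\<Omega>) \<longlonglongrightarrow> (0 :: real)"
    and asymp_cost: "liminf (\<lambda>n. \<integral>\<^sup>+\<omega>. c (Z n \<omega>) \<partial>\<Omega>) \<le> opt_value U P c"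
    and K: "compact K" "0 < \<epsilon>" "\<And>z. z \<in> graph U \<Longrightarrow> z \<notin> K \<Longrightarrow> opt_value U P c + ennreal \<epsilon> \<le> c z"
    and inf_compact: "K_inf_compact U c"
    and finite_value: "opt_value U P c < \<infinity>"
begin

lemma Z_graph: "\<omega> \<in> space \<Omega> \<Longrightarrow> Z n \<omega> \<in> graph U"
  using measurable_space[OF Z] by simp

lemma measurable_Z [measurable]: "Z n \<in> \<Omega> \<rightarrow>\<^sub>M borel"
  using Z by (simp add: measurable_restrict_space2_iff)

lemma measurable_fst_Z [measurable]: "(\<lambda>\<omega>. fst (Z n \<omega>)) \<in> \<Omega> \<rightarrow>\<^sub>M borel"
  by (rule measurable_compose[OF Z measurable_fst_borel_graph])

definition lim_set :: "'w set" where
  "lim_set = {\<omega> \<in> space \<Omega>. Cauchy (\<lambda>n. Z n \<omega>)}"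

text \<open>The default is a point of the graph, so that \<open>c\<close> and \<open>P\<close> are
  only ever evaluated where they are meaningful.\<close>

definition limit :: "'w \<Rightarrow> 'x \<times> 'u" where
  "limit \<omega> = (if \<omega> \<in> lim_set then lim (\<lambda>n. Z n \<omega>) else (SOME z. z \<in> graph U))"

lemma sets_lim_set [measurable]: "lim_set \<in> sets \<Omega>"
  unfolding lim_set_def by measurable

lemma limit: "\<omega> \<in> lim_set \<Longrightarrow> (\<lambda>n. Z n \<omega>) \<longlonglongrightarrow> limit \<omega>"
  by (simp add: limit_def lim_set_def Cauchy_convergent_iff convergent_LIMSEQ_iff)

lemma limit_graph: "limit \<omega> \<in> graph U"
proof (cases "\<omega> \<in> lim_set")
  case True
  then have "\<omega> \<in> space \<Omega>" by (simp add: lim_set_def)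
  then show ?thesis
    using closed_sequentially[OF closed_graph _ limit[OF True]] Z_graph by blast
next
  case False
  then show ?thesis using graph_nonempty by (simp add: limit_def some_in_eq)
qed

lemma measurable_limit: "limit \<in> \<Omega> \<rightarrow>\<^sub>M borel_graph U"
proof -
  have "limit \<in> \<Omega> \<rightarrow>\<^sub>M borel"
  proof (rule borel_measurable_LIMSEQ_metric)
    show "(\<lambda>\<omega>. if \<omega> \<in> lim_set then Z n \<omega> else (SOME z. z \<in> graph U)) \<in> \<Omega> \<rightarrow>\<^sub>M borel" for n
      by measurable
    show "(\<lambda>n. if \<omega> \<in> lim_set then Z n \<omega> else (SOME z. z \<in> graph U)) \<longlonglongrightarrow> limit \<omega>" for \<omega>
      using limit[of \<omega>] by (auto simp: limit_def)
  qed
  then show ?thesis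
    using limit_graph by (intro measurable_restrict_space2) auto
qed

lemma measurable_fst_limit [measurable]: "(\<lambda>\<omega>. fst (limit \<omega>)) \<in> \<Omega> \<rightarrow>\<^sub>M borel"
  by (rule measurable_compose[OF measurable_limit measurable_fst_borel_graph])

lemma measurable_cost_limit [measurable]: "(\<lambda>\<omega>. c (limit \<omega>)) \<in> borel_measurable \<Omega>"
  by (rule measurable_compose[OF measurable_limit c_measurable])

lemma liminf_cost_limit:
  assumes "\<omega> \<in> lim_set" shows "c (limit \<omega>) \<le> liminf (\<lambda>n. c (Z n \<omega>))"
  using assms by (intro lsc_on_liminf[OF c_lsc] limit limit_graph Z_graph) (simp add: lim_set_def)

lemma liminf_cost_off:
  assumes "\<omega> \<in> space \<Omega>" "\<omega> \<notin> lim_set"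
  shows "opt_value U P c + ennreal \<epsilon> \<le> liminf (\<lambda>n. c (Z n \<omega>))"
proof -
  have "\<not> (\<exists>\<^sub>F n in sequentially. Z n \<omega> \<in> K)"
    using deciding_convergent_compact[OF decides K(1)] assms by (auto simp: lim_set_def)
  then have "\<forall>\<^sub>F n in sequentially. Z n \<omega> \<notin> K" by (simp add: not_frequently)
  then show ?thesis
    by (intro Liminf_bounded, eventually_elim) (use K(3) Z_graph[OF assms(1)] in auto)
qed

text \<open>Convergent states together with their limit form a compact set \<open>C\<close>. By
  \<open>K_inf_compact\<close> each cost sublevel set over \<open>C\<close> is compact, so the
  nonconvergent pairs leave it, whatever the level.\<close>

lemma liminf_cost_escape:
  assumes \<omega>: "\<omega> \<in> space \<Omega>" "\<omega> \<notin> lim_set" and cv: "Cauchy (\<lambda>n. fst (Z n \<omega>))"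
  shows "liminf (\<lambda>n. c (Z n \<omega>)) = \<infinity>"
proof -
  obtain x where x: "(\<lambda>n. fst (Z n \<omega>)) \<longlonglongrightarrow> x"
    using cv by (auto simp: Cauchy_convergent_iff convergent_def)
  let ?C = "insert x (range (\<lambda>n. fst (Z n \<omega>)))"
  have C: "compact ?C"
    using compactin_sequence_with_limit[of euclidean "\<lambda>n. fst (Z n \<omega>)" x] x by simp
  have "ennreal r \<le> liminf (\<lambda>n. c (Z n \<omega>))" for r
  proof -
    have "compact {z \<in> graph U. fst z \<in> ?C \<and> c z \<le> ennreal r}"
      using inf_compact C unfolding K_inf_compact_def by blast
    then have "\<not> (\<exists>\<^sub>F n in sequentially. Z n \<omega> \<in> {z \<in> graph U. fst z \<in> ?C \<and> c z \<le> ennreal r})"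
      using deciding_convergent_compact[OF decides] \<omega> by (auto simp: lim_set_def)
    then have "\<forall>\<^sub>F n in sequentially. Z n \<omega> \<notin> {z \<in> graph U. fst z \<in> ?C \<and> c z \<le> ennreal r}"
      by (simp add: not_frequently)
    then show ?thesis
      by (intro Liminf_bounded, eventually_elim) (use Z_graph[OF \<omega>(1)] in auto)
  qed
  then have "of_nat n \<le> liminf (\<lambda>n. c (Z n \<omega>))" for n
    by (simp add: ennreal_of_nat_eq_real_of_nat)
  then show ?thesis
    using ennreal_Ex_less_of_nat by (metis infinity_ennreal_def leD less_top)
qed

text \<open>Fatou, with the pointwise bounds on and off \<open>lim_set\<close>. The lower limit of
  the costs then has finite integral and is finite almost everywhere, so
  \<open>liminf_cost_escape\<close> excludes convergence of the states alone.\<close>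

lemma cost_balance:
  "(\<integral>\<^sup>+\<omega>\<in>lim_set. c (limit \<omega>) \<partial>\<Omega>) + (opt_value U P c + ennreal \<epsilon>) * emeasure \<Omega> (space \<Omega> - lim_set) \<le> opt_value U P c"
  "AE \<omega> in \<Omega>. \<omega> \<notin> lim_set \<longrightarrow> \<not> Cauchy (\<lambda>n. fst (Z n \<omega>))"
proof -
  let ?l = "\<lambda>\<omega>. liminf (\<lambda>n. c (Z n \<omega>))"
  have m: "(\<lambda>\<omega>. c (Z n \<omega>)) \<in> borel_measurable \<Omega>" for n
    by (rule measurable_compose[OF Z c_measurable])
  then have ml: "?l \<in> borel_measurable \<Omega>" by measurable
  have "(\<integral>\<^sup>+\<omega>. ?l \<omega> \<partial>\<Omega>) \<le> liminf (\<lambda>n. \<integral>\<^sup>+\<omega>. c (Z n \<omega>) \<partial>\<Omega>)"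
    by (rule nn_integral_liminf[OF m])
  also note asymp_cost
  finally have le: "(\<integral>\<^sup>+\<omega>. ?l \<omega> \<partial>\<Omega>) \<le> opt_value U P c" .
  have "(\<integral>\<^sup>+\<omega>\<in>lim_set. c (limit \<omega>) \<partial>\<Omega>) + (opt_value U P c + ennreal \<epsilon>) * emeasure \<Omega> (space \<Omega> - lim_set) =
      (\<integral>\<^sup>+\<omega>. c (limit \<omega>) * indicator lim_set \<omega> + (opt_value U P c + ennreal \<epsilon>) * indicator (space \<Omega> - lim_set) \<omega> \<partial>\<Omega>)"
    by (subst nn_integral_add) (auto simp: nn_integral_cmult_indicator)
  also have "\<dots> \<le> (\<integral>\<^sup>+\<omega>. ?l \<omega> \<partial>\<Omega>)"
    using liminf_cost_limit liminf_cost_off by (intro nn_integral_mono) (auto simp: indicator_def)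
  also note le
  finally show "(\<integral>\<^sup>+\<omega>\<in>lim_set. c (limit \<omega>) \<partial>\<Omega>) + (opt_value U P c + ennreal \<epsilon>) * emeasure \<Omega> (space \<Omega> - lim_set) \<le> opt_value U P c" .
  have "(\<integral>\<^sup>+\<omega>. ?l \<omega> \<partial>\<Omega>) \<noteq> \<infinity>" using le finite_value by auto
  then have "AE \<omega> in \<Omega>. ?l \<omega> \<noteq> \<infinity>"
    by (intro nn_integral_noteq_infinite ml)
  then show "AE \<omega> in \<Omega>. \<omega> \<notin> lim_set \<longrightarrow> \<not> Cauchy (\<lambda>n. fst (Z n \<omega>))"
    using AE_space by eventually_elim (use liminf_cost_escape in blast)
qed

text \<open>
  The mass that the cut-offs \<open>1 - ball_gap M k\<close> fail to remove from the escaping part.  It vanishes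
  as \<open>k \<rightarrow> \<infinity>\<close>, because states that settle in arbitrarily small balls converge.
\<close>

definition near :: "nat \<Rightarrow> 'w set" where
  "near k = {\<omega> \<in> space \<Omega>. \<omega> \<notin> lim_set \<and> (\<exists>i. \<forall>\<^sub>F n in sequentially. fst (Z n \<omega>) \<in> sball i k)}"

lemma sets_near [measurable]: "near k \<in> sets \<Omega>"
  unfolding near_def eventually_sequentially by measurable

lemma measure_near_tendsto_0: "(\<lambda>k. measure \<Omega> (near k)) \<longlonglongrightarrow> 0"
proof -
  have "decseq near"
  proof (rule decseq_SucI, rule subsetI)
    fix k \<omega> assume "\<omega> \<in> near (Suc k)"
    moreover have "sball i (Suc k) \<subseteq> (sball i k :: 'x set)" for i
      unfolding sball_def by (intro subset_ball) (simp add: field_simps)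
    ultimately show "\<omega> \<in> near k"
      unfolding near_def by (auto elim!: eventually_mono) (blast intro: eventually_mono)
  qed
  then have "(\<lambda>k. measure \<Omega> (near k)) \<longlonglongrightarrow> measure \<Omega> (\<Inter>k. near k)"
    by (intro \<Omega>.finite_Lim_measure_decseq) auto
  also have "measure \<Omega> (\<Inter>k. near k) = 0"
  \<comment> \<open>A sample point in all these sets has Cauchy states but lies off
    \<open>lim_set\<close>, which \<open>cost_balance\<close> makes null.\<close>
  proof -
    have "AE \<omega> in \<Omega>. \<omega> \<notin> (\<Inter>k. near k)"
      using cost_balance(2) by eventually_elim (auto simp: near_def intro: Cauchy_if_eventually_sball)
    then show ?thesis by (subst \<Omega>.prob_eq_0) auto
  qed
  finally show ?thesis .
qed

definition mean :: "('x \<Rightarrow> real) \<Rightarrow> 'x \<times> 'u \<Rightarrow> real" where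
  "mean f z = (\<integral>y. f y \<partial>P z)"

lemma mean_bounds:
  assumes f: "continuous_on UNIV f" "\<And>x. 0 \<le> f x" "\<And>x. f x \<le> B" and z: "z \<in> graph U"
  shows "0 \<le> mean f z" "mean f z \<le> B" "\<bar>mean f z\<bar> \<le> B"
proof -
  have "\<bar>f x\<bar> \<le> B" for x using f(2)[of x] f(3)[of x] by simp
  then show "\<bar>mean f z\<bar> \<le> B"
    unfolding mean_def by (intro integral_P_bounded(2)[OF z borel_measurable_continuous_onI[OF f(1)]])
  then show "mean f z \<le> B" by simp
  show "0 \<le> mean f z" unfolding mean_def using f(2) by (rule Bochner_Integration.integral_nonneg)
qed

lemma measurable_mean:
  assumes f: "continuous_on UNIV f" and Y: "Y \<in> \<Omega> \<rightarrow>\<^sub>M borel_graph U"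
  shows "(\<lambda>\<omega>. mean f (Y \<omega>)) \<in> borel_measurable \<Omega>"
  unfolding mean_def
  by (rule measurable_compose[OF Y measurable_integral_P[OF borel_measurable_continuous_onI[OF f]]])

text \<open>The Feller property enters here: the one-step mean is continuous on the graph, which
  contains the points and their limit.\<close>

lemma mean_limit:
  assumes f: "continuous_on UNIV f" "\<And>x. 0 \<le> f x" "\<And>x. f x \<le> B" and "\<omega> \<in> lim_set"
  shows "(\<lambda>n. mean f (Z n \<omega>)) \<longlonglongrightarrow> mean f (limit \<omega>)"
proof -
  have "continuous_on (graph U) (mean f)"
    unfolding mean_def[abs_def] by (intro P_feller f(1) bounded_range_if_between[OF f(2,3)])
  then show ?thesis
    by (rule continuous_on_tendsto_compose[OF _ limit[OF assms(4)] limit_graph])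
      (use assms(4) Z_graph in \<open>auto simp: lim_set_def\<close>)
qed

lemma integrable_if_bounded:
  fixes h :: "'w \<Rightarrow> real"
  assumes "h \<in> borel_measurable \<Omega>" "\<And>\<omega>. \<omega> \<in> space \<Omega> \<Longrightarrow> \<bar>h \<omega>\<bar> \<le> C"
  shows "integrable \<Omega> h"
  by (rule \<Omega>.integrable_const_bound[where B=C]) (use assms in auto)

text \<open>Asymptotic invariance equates the limits of the integrals of \<open>mean g (Z n)\<close>
  and of \<open>g\<close> at the state. In the former the part off \<open>lim_set\<close> is
  dropped, as \<open>g\<close> is nonnegative. In the latter \<open>g\<close> is at most
  \<open>f\<close> on \<open>lim_set\<close>, and off it \<open>g\<close> vanishes unless the state
  is in one of the first M + 1 balls, where it is at most \<open>B\<close>; in the limit this error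
  sits inside \<open>near k\<close>.\<close>

lemma limit_subinvariant_cutoff:
  fixes M k :: nat
  assumes f: "continuous_on UNIV f" "\<And>x. 0 \<le> f x" "\<And>x. f x \<le> B"
  defines "g \<equiv> cutoff M k f"
  shows "(\<integral>\<omega>. indicator lim_set \<omega> * mean g (limit \<omega>) \<partial>\<Omega>)
    \<le> (\<integral>\<omega>. indicator lim_set \<omega> * f (fst (limit \<omega>)) \<partial>\<Omega>) + B * measure \<Omega> (near k)"
proof -
  have B: "0 \<le> B" using f(2,3) by (rule order_trans)
  have gf: "0 \<le> g x" "g x \<le> f x" "g x \<le> B" for x
    using cutoff_bounds[of f, OF f(2)] order_trans[OF cutoff_bounds(2)[of f, OF f(2)] f(3)] by (simp_all add: g_def)
  have cont_g: "continuous_on UNIV g"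
    unfolding g_def by (rule continuous_cutoff[OF f(1)])
  have [measurable]: "f \<in> borel_measurable borel" "g \<in> borel_measurable borel"
    using f(1) cont_g by (simp_all add: borel_measurable_continuous_onI)
  have [measurable]: "(\<lambda>\<omega>. mean g (Z n \<omega>)) \<in> borel_measurable \<Omega>" for n
    by (rule measurable_mean[OF cont_g Z])
  have [measurable]: "(\<lambda>\<omega>. mean g (limit \<omega>)) \<in> borel_measurable \<Omega>"
    by (rule measurable_mean[OF cont_g measurable_limit])
  have mean_g: "0 \<le> mean g z" "mean g z \<le> B" "\<bar>mean g z\<bar> \<le> B" if "z \<in> graph U" for z
    using mean_bounds[OF cont_g gf(1,3) that] by auto
  define E where "E n = {\<omega> \<in> space \<Omega>. \<omega> \<notin> lim_set \<and> (\<exists>i\<le>M. fst (Z n \<omega>) \<in> sball i k)}" for n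
  define F where "F = {\<omega> \<in> space \<Omega>. \<omega> \<notin> lim_set \<and> (\<exists>i\<le>M. \<forall>\<^sub>F n in sequentially. fst (Z n \<omega>) \<in> sball i k)}"
  have [measurable]: "E n \<in> sets \<Omega>" for n unfolding E_def by measurable
  have [measurable]: "F \<in> sets \<Omega>" unfolding F_def eventually_sequentially by measurable
  have lim1: "(\<lambda>n. \<integral>\<omega>. indicator lim_set \<omega> * mean g (Z n \<omega>) \<partial>\<Omega>)
      \<longlonglongrightarrow> (\<integral>\<omega>. indicator lim_set \<omega> * mean g (limit \<omega>) \<partial>\<Omega>)"
  proof (rule integral_dominated_convergence[where w="\<lambda>_. B"])
    show "AE \<omega> in \<Omega>. (\<lambda>n. indicator lim_set \<omega> * mean g (Z n \<omega>)) \<longlonglongrightarrow> indicator lim_set \<omega> * mean g (limit \<omega>)"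
      using mean_limit[OF cont_g gf(1,3)] by (auto simp: indicator_def)
    show "AE \<omega> in \<Omega>. norm (indicator lim_set \<omega> * mean g (Z n \<omega>)) \<le> B" for n
      using mean_g(3) Z_graph B by (intro AE_I2) (simp add: indicator_def)
  qed measurable
  have lim2: "(\<lambda>n. \<integral>\<omega>. indicator lim_set \<omega> * f (fst (Z n \<omega>)) \<partial>\<Omega>)
      \<longlonglongrightarrow> (\<integral>\<omega>. indicator lim_set \<omega> * f (fst (limit \<omega>)) \<partial>\<Omega>)"
  proof (rule integral_dominated_convergence[where w="\<lambda>_. B"])
    have "(\<lambda>n. f (fst (Z n \<omega>))) \<longlonglongrightarrow> f (fst (limit \<omega>))" if "\<omega> \<in> lim_set" for \<omega>
      by (rule continuous_on_tendsto_compose[OF f(1) tendsto_fst[OF limit[OF that]]]) auto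
    then show "AE \<omega> in \<Omega>. (\<lambda>n. indicator lim_set \<omega> * f (fst (Z n \<omega>))) \<longlonglongrightarrow> indicator lim_set \<omega> * f (fst (limit \<omega>))"
      by (auto simp: indicator_def)
    show "AE \<omega> in \<Omega>. norm (indicator lim_set \<omega> * f (fst (Z n \<omega>))) \<le> B" for n
      using f(2,3) B by (intro AE_I2) (simp add: indicator_def)
  qed measurable
  have lim3: "(\<lambda>n. \<integral>\<omega>. (indicator (E n) \<omega> :: real) \<partial>\<Omega>) \<longlonglongrightarrow> (\<integral>\<omega>. indicator F \<omega> \<partial>\<Omega>)"
  proof (rule integral_dominated_convergence[where w="\<lambda>_. 1"])
    have "(\<lambda>n. indicator (E n) \<omega>) \<longlonglongrightarrow> (indicator F \<omega> :: real)" if \<omega>: "\<omega> \<in> space \<Omega>" for \<omega>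
    proof (rule tendsto_eventually)
      \<comment> \<open>Finitely many decided balls share one index after which all decisions are
        final; hence the indicators of \<open>E n\<close> converge to that of
        \<open>F\<close>.\<close>
      have "\<forall>\<^sub>F n in sequentially. \<forall>i\<in>{..M}. fst (Z n \<omega>) \<in> sball i k \<longleftrightarrow> (\<forall>\<^sub>F n in sequentially. fst (Z n \<omega>) \<in> sball i k)"
      proof (intro eventually_ball_finite ballI)
        fix i
        show "\<forall>\<^sub>F n in sequentially. fst (Z n \<omega>) \<in> sball i k \<longleftrightarrow> (\<forall>\<^sub>F n in sequentially. fst (Z n \<omega>) \<in> sball i k)"
        proof (cases "\<forall>\<^sub>F n in sequentially. fst (Z n \<omega>) \<in> sball i k")
          case True
          then show ?thesis by eventually_elim (use True in simp)
        next
          case False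
          then have "\<forall>\<^sub>F n in sequentially. fst (Z n \<omega>) \<notin> sball i k" using decides_fst[OF \<omega>] by blast
          then show ?thesis by eventually_elim (use False in simp)
        qed
      qed simp
      then show "\<forall>\<^sub>F n in sequentially. indicator (E n) \<omega> = (indicator F \<omega> :: real)"
        by eventually_elim (auto simp: E_def F_def indicator_def)
    qed
    then show "AE \<omega> in \<Omega>. (\<lambda>n. indicator (E n) \<omega>) \<longlonglongrightarrow> (indicator F \<omega> :: real)" by auto
  qed (auto simp: indicator_def)
  have lim4: "(\<lambda>n. \<integral>\<omega>. g (fst (Z n \<omega>)) - mean g (Z n \<omega>) \<partial>\<Omega>) \<longlonglongrightarrow> 0"
    using asymp_invariant[OF cont_g bounded_range_if_between[OF gf(1,3)]] by (simp add: mean_def)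
  have ints: "integrable \<Omega> (\<lambda>\<omega>. indicator lim_set \<omega> * mean g (Z n \<omega>))" "integrable \<Omega> (\<lambda>\<omega>. mean g (Z n \<omega>))"
    "integrable \<Omega> (\<lambda>\<omega>. g (fst (Z n \<omega>)))" "integrable \<Omega> (\<lambda>\<omega>. indicator lim_set \<omega> * f (fst (Z n \<omega>)))"
    for n
    by (rule integrable_if_bounded[where C=B], measurable,
        use mean_g(3) Z_graph B f(2,3) gf in \<open>simp add: indicator_def\<close>)+
  have int_E: "integrable \<Omega> (\<lambda>\<omega>. indicator (E n) \<omega> :: real)" for n
    using \<Omega>.emeasure_finite[of "E n"] by (intro integrable_real_indicator) (simp_all add: less_top[symmetric])
  have step: "(\<integral>\<omega>. indicator lim_set \<omega> * mean g (Z n \<omega>) \<partial>\<Omega>) \<le>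
      (\<integral>\<omega>. indicator lim_set \<omega> * f (fst (Z n \<omega>)) \<partial>\<Omega>) + B * (\<integral>\<omega>. indicator (E n) \<omega> \<partial>\<Omega>)
      - (\<integral>\<omega>. g (fst (Z n \<omega>)) - mean g (Z n \<omega>) \<partial>\<Omega>)" for n
  proof -
    have "(\<integral>\<omega>. indicator lim_set \<omega> * mean g (Z n \<omega>) \<partial>\<Omega>) \<le> (\<integral>\<omega>. mean g (Z n \<omega>) \<partial>\<Omega>)"
      using ints mean_g(1) Z_graph by (intro integral_mono) (auto simp: indicator_def)
    also have "\<dots> = (\<integral>\<omega>. g (fst (Z n \<omega>)) \<partial>\<Omega>) - (\<integral>\<omega>. g (fst (Z n \<omega>)) - mean g (Z n \<omega>) \<partial>\<Omega>)"
      using ints by simp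
    also have "(\<integral>\<omega>. g (fst (Z n \<omega>)) \<partial>\<Omega>) \<le> (\<integral>\<omega>. indicator lim_set \<omega> * f (fst (Z n \<omega>)) + B * indicator (E n) \<omega> \<partial>\<Omega>)"
    proof (intro integral_mono ints int_E Bochner_Integration.integrable_add integrable_mult_right)
      fix \<omega> assume \<omega>: "\<omega> \<in> space \<Omega>"
      show "g (fst (Z n \<omega>)) \<le> indicator lim_set \<omega> * f (fst (Z n \<omega>)) + B * indicator (E n) \<omega>"
      proof (cases "\<omega> \<in> lim_set \<or> \<omega> \<in> E n")
        case True
        then show ?thesis using gf f(2) B by (auto simp: indicator_def add_increasing add_increasing2)
      next
        case False
        then have "ball_gap M k (fst (Z n \<omega>)) = 1"
          using \<omega> by (intro ball_gap_outside) (auto simp: E_def)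
        then show ?thesis using False by (simp add: g_def cutoff_def)
      qed
    qed
    also have "\<dots> = (\<integral>\<omega>. indicator lim_set \<omega> * f (fst (Z n \<omega>)) \<partial>\<Omega>) + B * (\<integral>\<omega>. indicator (E n) \<omega> \<partial>\<Omega>)"
      using ints int_E by simp
    finally show ?thesis by simp
  qed
  have "(\<integral>\<omega>. indicator lim_set \<omega> * mean g (limit \<omega>) \<partial>\<Omega>) \<le>
      (\<integral>\<omega>. indicator lim_set \<omega> * f (fst (limit \<omega>)) \<partial>\<Omega>) + B * (\<integral>\<omega>. indicator F \<omega> \<partial>\<Omega>) - 0"
    by (rule LIMSEQ_le[OF lim1 tendsto_diff[OF tendsto_add[OF lim2 tendsto_mult[OF tendsto_const lim3]] lim4]])
      (use step in blast)
  also have "(\<integral>\<omega>. indicator F \<omega> \<partial>\<Omega>) \<le> measure \<Omega> (near k)"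
    by (auto intro!: \<Omega>.finite_measure_mono simp: F_def near_def)
  finally show ?thesis using B by (simp add: mult_left_mono)
qed

text \<open>The order of limits matters: the error for fixed k is uniform in M, so M grows first and
  removes the cut-off; then k grows and removes the error.\<close>

lemma limit_subinvariant:
  assumes f: "continuous_on UNIV f" "\<And>x. 0 \<le> f x" "\<And>x. f x \<le> B"
  shows "(\<integral>\<omega>. indicator lim_set \<omega> * mean f (limit \<omega>) \<partial>\<Omega>)
    \<le> (\<integral>\<omega>. indicator lim_set \<omega> * f (fst (limit \<omega>)) \<partial>\<Omega>)"
proof -
  have B: "0 \<le> B" using f(2,3) by (rule order_trans)
  have [measurable]: "f \<in> borel_measurable borel" using f(1) by (rule borel_measurable_continuous_onI)
  define g where "g k M = cutoff M k f" for k M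
  have g: "0 \<le> g k M x" "g k M x \<le> B" for k M x
    using cutoff_bounds[of f, OF f(2)] order_trans[OF cutoff_bounds(2)[of f, OF f(2)] f(3)] by (simp_all add: g_def)
  have cont_g: "continuous_on UNIV (g k M)" for k M
    unfolding g_def by (rule continuous_cutoff[OF f(1)])
  have lim_mean: "(\<lambda>M. mean (g k M) z) \<longlonglongrightarrow> mean f z" if z: "z \<in> graph U" for k z
    unfolding mean_def
  proof (rule integral_dominated_convergence[where w="\<lambda>_. B"])
    have "P z \<in> Prob" using measurable_space[OF P_kernel, of z] z by simp
    then have sets: "sets (P z) = sets borel" and "prob_space (P z)" by (simp_all add: space_prob_algebra)
    interpret prob_space "P z" by fact
    show "f \<in> borel_measurable (P z)" "g k M \<in> borel_measurable (P z)" for M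
      using borel_measurable_continuous_onI[OF cont_g[of k M]] by (simp_all add: sets cong: measurable_cong_sets)
    show "integrable (P z) (\<lambda>_. B)" by simp
    show "AE x in P z. (\<lambda>M. g k M x) \<longlonglongrightarrow> f x"
      unfolding g_def by (intro AE_I2 cutoff_tendsto)
    show "AE x in P z. norm (g k M x) \<le> B" for M using g by simp
  qed
  have "(\<integral>\<omega>. indicator lim_set \<omega> * mean f (limit \<omega>) \<partial>\<Omega>)
      \<le> (\<integral>\<omega>. indicator lim_set \<omega> * f (fst (limit \<omega>)) \<partial>\<Omega>) + B * measure \<Omega> (near k)" for k
  proof (rule LIMSEQ_le_const2)
    show "(\<lambda>M. \<integral>\<omega>. indicator lim_set \<omega> * mean (g k M) (limit \<omega>) \<partial>\<Omega>)
      \<longlonglongrightarrow> (\<integral>\<omega>. indicator lim_set \<omega> * mean f (limit \<omega>) \<partial>\<Omega>)"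
    proof (rule integral_dominated_convergence[where w="\<lambda>_. B"])
      show "AE \<omega> in \<Omega>. (\<lambda>M. indicator lim_set \<omega> * mean (g k M) (limit \<omega>)) \<longlonglongrightarrow> indicator lim_set \<omega> * mean f (limit \<omega>)"
        by (intro AE_I2 tendsto_mult tendsto_const lim_mean limit_graph)
      show "AE \<omega> in \<Omega>. norm (indicator lim_set \<omega> * mean (g k M) (limit \<omega>)) \<le> B" for M
        using mean_bounds(3)[OF cont_g g limit_graph] B by (intro AE_I2) (simp add: indicator_def)
    qed (auto intro!: borel_measurable_times measurable_mean cont_g f(1) measurable_limit)
    show "\<exists>N. \<forall>M\<ge>N. (\<integral>\<omega>. indicator lim_set \<omega> * mean (g k M) (limit \<omega>) \<partial>\<Omega>)
        \<le> (\<integral>\<omega>. indicator lim_set \<omega> * f (fst (limit \<omega>)) \<partial>\<Omega>) + B * measure \<Omega> (near k)"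
      using limit_subinvariant_cutoff[OF f] unfolding g_def by blast
  qed
  moreover have "(\<lambda>k. (\<integral>\<omega>. indicator lim_set \<omega> * f (fst (limit \<omega>)) \<partial>\<Omega>) + B * measure \<Omega> (near k))
      \<longlonglongrightarrow> (\<integral>\<omega>. indicator lim_set \<omega> * f (fst (limit \<omega>)) \<partial>\<Omega>) + B * 0"
    by (intro tendsto_intros measure_near_tendsto_0)
  ultimately show ?thesis
    by (intro LIMSEQ_le_const[where a="\<integral>\<omega>. indicator lim_set \<omega> * mean f (limit \<omega>) \<partial>\<Omega>"]) auto
qed

text \<open>Subinvariance of the nonnegative functions \<open>f + B\<close> and \<open>B - f\<close>
  gives the two opposite inequalities; the constants cancel because \<open>P z\<close> has mass
  1.\<close>

lemma limit_invariant:
  assumes f: "continuous_on UNIV f" "bounded (range f)"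
  shows "(\<integral>\<omega>. indicator lim_set \<omega> * (f (fst (limit \<omega>)) - mean f (limit \<omega>)) \<partial>\<Omega>) = 0"
proof -
  obtain B where B: "\<And>x. \<bar>f x\<bar> \<le> B" using f(2) by (auto simp: bounded_iff)
  have [measurable]: "f \<in> borel_measurable borel" using f(1) by (rule borel_measurable_continuous_onI)
  have [measurable]: "(\<lambda>\<omega>. mean f (limit \<omega>)) \<in> borel_measurable \<Omega>"
    by (rule measurable_mean[OF f(1) measurable_limit])
  have fm: "f \<in> borel_measurable borel" using f(1) by (rule borel_measurable_continuous_onI)
  have mean_f: "\<bar>mean f z\<bar> \<le> B" and int_P: "integrable (P z) f" if "z \<in> graph U" for z
    unfolding mean_def by (rule integral_P_bounded[OF that fm B])+
  have prob_P: "prob_space (P z)" if "z \<in> graph U" for z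
    using measurable_space[OF P_kernel, of z] that by (simp add: space_prob_algebra)
  have mean_plus: "mean (\<lambda>x. f x + B) z = mean f z + B" and mean_minus: "mean (\<lambda>x. B - f x) z = B - mean f z"
    if z: "z \<in> graph U" for z
  proof -
    interpret prob_space "P z" by (rule prob_P[OF z])
    show "mean (\<lambda>x. f x + B) z = mean f z + B" "mean (\<lambda>x. B - f x) z = B - mean f z"
      using int_P[OF z] by (simp_all add: mean_def prob_space)
  qed
  have B0: "0 \<le> B" using B[of undefined] by simp
  have ints: "integrable \<Omega> (\<lambda>\<omega>. indicator lim_set \<omega> * mean f (limit \<omega>))"
    "integrable \<Omega> (\<lambda>\<omega>. indicator lim_set \<omega> * f (fst (limit \<omega>)))"
    "integrable \<Omega> (\<lambda>\<omega>. indicator lim_set \<omega> * B)"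
    by (rule integrable_if_bounded[where C=B], measurable,
        use mean_f[OF limit_graph] B B0 in \<open>simp add: indicator_def\<close>)+
  have fB: "0 \<le> f x + B" "f x + B \<le> 2 * B" "0 \<le> B - f x" "B - f x \<le> 2 * B" for x
    using B[of x] by linarith+
  have "(\<integral>\<omega>. indicator lim_set \<omega> * mean (\<lambda>x. f x + B) (limit \<omega>) \<partial>\<Omega>) \<le> (\<integral>\<omega>. indicator lim_set \<omega> * (f (fst (limit \<omega>)) + B) \<partial>\<Omega>)"
    by (rule limit_subinvariant[OF _ fB(1,2)]) (intro continuous_intros f(1))
  moreover have "(\<integral>\<omega>. indicator lim_set \<omega> * mean (\<lambda>x. B - f x) (limit \<omega>) \<partial>\<Omega>) \<le> (\<integral>\<omega>. indicator lim_set \<omega> * (B - f (fst (limit \<omega>))) \<partial>\<Omega>)"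
    by (rule limit_subinvariant[OF _ fB(3,4)]) (intro continuous_intros f(1))
  ultimately show ?thesis
    unfolding mean_plus[OF limit_graph] mean_minus[OF limit_graph]
    using ints by (simp add: distrib_left right_diff_distrib)
qed

text \<open>Otherwise the balance would read \<beta> + \<epsilon> \<le> \<beta> for a finite
  \<beta>. Conditioning on \<open>lim_set\<close> is thus legitimate.\<close>

lemma lim_set_positive: "emeasure \<Omega> lim_set \<noteq> 0"
proof
  assume "emeasure \<Omega> lim_set = 0"
  then have "emeasure \<Omega> (space \<Omega> - lim_set) = 1"
    by (simp add: emeasure_compl \<Omega>.emeasure_space_1)
  then have "opt_value U P c + ennreal \<epsilon> \<le> opt_value U P c"
    using cost_balance(1) by (auto intro: order_trans[rotated] simp: add_increasing)
  then show False
    using finite_value K(2) by (metis add.right_neutral ennreal_add_left_cancel_le ennreal_eq_0_iff infinity_ennreal_def le_zero_eq not_le less_irrefl)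
qed

definition limit_law :: "('x \<times> 'u) measure" where
  "limit_law = distr (uniform_measure \<Omega> lim_set) (borel_graph U) limit"

lemma limit_measurable_uniform: "limit \<in> uniform_measure \<Omega> lim_set \<rightarrow>\<^sub>M borel_graph U"
  using measurable_limit by (simp cong: measurable_cong_sets)

lemma limit_law_in: "limit_law \<in> space (prob_algebra (borel_graph U))"
proof -
  have "prob_space (uniform_measure \<Omega> lim_set)"
    using lim_set_positive by (intro prob_space_uniform_measure) auto
  then show ?thesis
    unfolding limit_law_def space_prob_algebra
    using prob_space.prob_space_distr limit_measurable_uniform by auto
qed

lemma limit_law_eom: "limit_law \<in> ergodic_occupation_measures U P"
  unfolding ergodic_occupation_measures_def
proof (intro CollectI conjI limit_law_in allI impI)
  fix f :: "'x \<Rightarrow> real" assume f: "continuous_on UNIV f" "bounded (range f)"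
  have fm[measurable]: "f \<in> borel_measurable borel" using f(1) by (rule borel_measurable_continuous_onI)
  let ?h = "\<lambda>z. f (fst z) - (\<integral>y. f y \<partial>P z)"
  have h: "?h \<in> borel_measurable (borel_graph U)"
    by (intro borel_measurable_diff measurable_compose[OF measurable_fst_borel_graph fm] measurable_integral_P fm)
  \<comment> \<open>A real-valued density is required to unfold the Bochner integral.\<close>
  have dens: "uniform_measure \<Omega> lim_set = density \<Omega> (\<lambda>\<omega>. ennreal (indicator lim_set \<omega> / measure \<Omega> lim_set))"
    unfolding uniform_measure_def using lim_set_positive
    by (intro density_cong) (auto simp: indicator_def \<Omega>.emeasure_eq_measure divide_ennreal zero_less_measure_iff
      ennreal_1[symmetric] simp del: ennreal_1)
  have "(\<integral>z. ?h z \<partial>limit_law) = (\<integral>\<omega>. ?h (limit \<omega>) \<partial>uniform_measure \<Omega> lim_set)"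
    unfolding limit_law_def by (rule integral_distr[OF limit_measurable_uniform h])
  also have "\<dots> = (\<integral>\<omega>. (indicator lim_set \<omega> / measure \<Omega> lim_set) *\<^sub>R ?h (limit \<omega>) \<partial>\<Omega>)"
    unfolding dens by (rule integral_density) (use measurable_compose[OF measurable_limit h] in auto)
  also have "\<dots> = (\<integral>\<omega>. indicator lim_set \<omega> * (f (fst (limit \<omega>)) - mean f (limit \<omega>)) \<partial>\<Omega>) / measure \<Omega> lim_set"
    by (simp add: mean_def)
  also have "\<dots> = 0"
    by (simp add: limit_invariant[OF f])
  finally show "(\<integral>z. ?h z \<partial>limit_law) = 0" .
qed

lemma nn_integral_limit_law:
  "(\<integral>\<^sup>+z. c z \<partial>limit_law) = (\<integral>\<^sup>+\<omega>\<in>lim_set. c (limit \<omega>) \<partial>\<Omega>) / emeasure \<Omega> lim_set"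
  unfolding limit_law_def
  by (subst nn_integral_distr[OF limit_measurable_uniform]) (simp_all add: c_measurable nn_integral_uniform_measure)

theorem limit_law_optimal:
  assumes "strategies U \<noteq> {}"
  shows "limit_law \<in> optimal_eoms U P c"
proof -
  define d where "d = measure \<Omega> lim_set"
  have em: "emeasure \<Omega> lim_set = ennreal d" by (simp add: d_def \<Omega>.emeasure_eq_measure)
  have d: "0 < d" "d \<le> 1"
    using lim_set_positive by (auto simp: em d_def ennreal_eq_0_iff not_le)
  have em': "emeasure \<Omega> (space \<Omega> - lim_set) = ennreal (1 - d)"
    by (simp add: \<Omega>.emeasure_eq_measure \<Omega>.prob_compl d_def)
  \<comment> \<open>The balance is moved to real numbers, where its terms can be subtracted.\<close>
  obtain b where b: "opt_value U P c = ennreal b" "0 \<le> b"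
    using finite_value by (cases "opt_value U P c") auto
  let ?I = "\<integral>\<^sup>+z. c z \<partial>limit_law"
  have ge: "opt_value U P c \<le> ?I" by (rule opt_value_le_eom_cost[OF assms limit_law_eom])
  have I: "(\<integral>\<^sup>+\<omega>\<in>lim_set. c (limit \<omega>) \<partial>\<Omega>) = ?I * ennreal d"
    using d unfolding nn_integral_limit_law em
    by (simp add: ennreal_divide_times mult_divide_eq_ennreal)
  have bal: "?I * ennreal d + ennreal ((b + \<epsilon>) * (1 - d)) \<le> ennreal b"
    using cost_balance(1) d K(2) b(2) unfolding I em' b(1) by (simp add: ennreal_mult)
  then have "?I * ennreal d \<noteq> top" by (auto simp: top_unique)
  then have "?I \<noteq> top" using d by (auto simp: ennreal_top_mult ennreal_eq_0_iff)
  then obtain i where i: "?I = ennreal i" "0 \<le> i" by (cases ?I) auto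
  have "ennreal (i * d + (b + \<epsilon>) * (1 - d)) \<le> ennreal b"
    using bal d b(2) i(2) K(2) unfolding i(1) by (simp add: ennreal_mult ennreal_plus)
  then have le: "i * d + (b + \<epsilon>) * (1 - d) \<le> b"
    using b(2) by (simp add: ennreal_le_iff)
  have bi: "b \<le> i" using ge i b by (simp add: ennreal_le_iff)
  \<comment> \<open>Putting \<open>b\<close> for \<open>i\<close> in the balance turns its left side
    into b + \<epsilon>(1 - d), which leaves \<epsilon>(1 - d) \<le> 0.\<close>
  have "b * d \<le> i * d" using bi d by (intro mult_right_mono) auto
  then have "\<epsilon> * (1 - d) \<le> 0" using le by (simp add: algebra_simps)
  then have "d = 1" using K(2) d by (simp add: mult_le_0_iff)
  then have "i \<le> b" using le by simp
  then have "?I = opt_value U P c" using bi i b by simp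
  then show ?thesis using limit_law_eom by (simp add: optimal_eoms_def)
qed

end

section \<open>Near-optimal averaged occupation measures and existence\<close>

context feller_mdp
begin

text \<open>Average the one-step laws of a near-optimal strategy over N steps. The defect of
  invariance telescopes to the difference of two expectations of \<open>f\<close> divided by N, so
  it is at most 2B/N; a horizon beyond 1/e makes this at most 2Be.\<close>

lemma near_optimal_occupation:
  assumes fin: "opt_value U P c < \<infinity>" and e: "0 < e"
  obtains \<zeta> where "\<zeta> \<in> space (prob_algebra (borel_graph U))"
    "(\<integral>\<^sup>+z. c z \<partial>\<zeta>) \<le> opt_value U P c + ennreal e"
    "\<And>f B. f \<in> borel_measurable borel \<Longrightarrow> (\<And>x. \<bar>f x\<bar> \<le> B) \<Longrightarrow>
      \<bar>\<integral>z. f (fst z) - (\<integral>y. f y \<partial>P z) \<partial>\<zeta>\<bar> \<le> 2 * B * e"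
proof -
  have "opt_value U P c < opt_value U P c + ennreal e"
    using fin e by (metis add.right_neutral ennreal_add_left_cancel_less ennreal_less_zero_iff infinity_ennreal_def less_irrefl)
  then obtain \<mu> where \<mu>: "\<mu> \<in> Prob" "value_fn U P c \<mu> < opt_value U P c + ennreal e"
    unfolding opt_value_def by (auto simp: INF_less_iff)
  then obtain \<xi> where \<xi>: "\<xi> \<in> strategies U" "avg_cost U P c \<mu> \<xi> < opt_value U P c + ennreal e"
    unfolding value_fn_def by (auto simp: INF_less_iff)
  let ?step = "step_law \<xi> \<mu>" and ?state = "state_law \<xi> \<mu>"
  have "\<forall>\<^sub>F N in sequentially. (\<Sum>n<N. \<integral>\<^sup>+z. c z \<partial>?step n) / of_nat N < opt_value U P c + ennreal e"
    using \<xi>(2) unfolding avg_cost_eq[OF \<xi>(1) \<mu>(1)] by (rule Limsup_lessD)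
  moreover obtain N0 :: nat where N0: "1 / e < real N0" using reals_Archimedean2 by blast
  ultimately have "\<forall>\<^sub>F N in sequentially. (\<Sum>n<N. \<integral>\<^sup>+z. c z \<partial>?step n) / of_nat N < opt_value U P c + ennreal e \<and> N0 \<le> N"
    using eventually_ge_at_top[of N0] by (intro eventually_conj)
  then obtain N where N: "(\<Sum>n<N. \<integral>\<^sup>+z. c z \<partial>?step n) / of_nat N < opt_value U P c + ennreal e" "N0 \<le> N"
    using eventually_happens'[OF sequentially_bot] by blast
  have "1 / e < real N" using N0 N(2) by (meson of_nat_mono order_less_le_trans)
  then have "1 < real N * e" using e by (simp add: field_simps)
  then have Npos: "0 < N" by (intro gr0I) simp
  have Ne: "1 / real N \<le> e"
    using \<open>1 < real N * e\<close> Npos by (simp add: field_simps)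
  \<comment> \<open>The average over times is a bind with the uniform law on the first N
    times.\<close>
  let ?p = "measure_pmf (pmf_of_set {..<N})"
  have ne: "{..<N} \<noteq> {}" using Npos by auto
  have p: "?p \<in> space (prob_algebra (count_space UNIV))"
    by (simp add: space_prob_algebra prob_space_measure_pmf)
  have step: "?step \<in> count_space UNIV \<rightarrow>\<^sub>M prob_algebra (borel_graph U)"
    using step_law_in[OF \<xi>(1) \<mu>(1)] by auto
  have step': "?step \<in> ?p \<rightarrow>\<^sub>M subprob_algebra (borel_graph U)"
    using measurable_prob_algebraD[OF step] by simp
  define \<zeta> where "\<zeta> = ?p \<bind> ?step"
  have \<zeta>: "\<zeta> \<in> space (prob_algebra (borel_graph U))"
    unfolding \<zeta>_def space_prob_algebra using prob_space_bind'[OF p step] sets_bind'[OF p step] by simp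
  have cost: "(\<integral>\<^sup>+z. c z \<partial>\<zeta>) \<le> opt_value U P c + ennreal e"
  proof -
    have "(\<integral>\<^sup>+z. c z \<partial>\<zeta>) = (\<Sum>n<N. \<integral>\<^sup>+z. c z \<partial>?step n) / of_nat N"
      unfolding \<zeta>_def nn_integral_bind[OF c_measurable step']
      by (subst nn_integral_pmf_of_set) (use ne in auto)
    then show ?thesis using N(1) by simp
  qed
  have inv: "\<bar>\<integral>z. f (fst z) - (\<integral>y. f y \<partial>P z) \<partial>\<zeta>\<bar> \<le> 2 * B * e"
    if f: "f \<in> borel_measurable borel" and B: "\<And>x. \<bar>f x\<bar> \<le> B" for f B
  proof -
    let ?h = "\<lambda>z. f (fst z) - (\<integral>y. f y \<partial>P z)"
    let ?s = "\<lambda>n. \<integral>x. f x \<partial>?state n"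
    have h: "?h \<in> borel_measurable (borel_graph U)"
      by (intro borel_measurable_diff measurable_compose[OF measurable_fst_borel_graph f] measurable_integral_P f)
    have hB: "\<bar>?h z\<bar> \<le> 2 * B" if "z \<in> graph U" for z
      using integral_P_bounded(2)[OF that f B] B[of "fst z"] by linarith
    have B0: "0 \<le> B" using B[of undefined] by simp
    have state_prob: "prob_space (?state n)" "sets (?state n) = sets borel" for n
      using state_law_in[OF \<xi>(1) \<mu>(1), of n] by (simp_all add: space_prob_algebra)
    have sB: "\<bar>?s n\<bar> \<le> B" for n
    proof -
      interpret prob_space "?state n" by (rule state_prob)
      have "f \<in> borel_measurable (?state n)" using f by (simp add: state_prob cong: measurable_cong_sets)
      then have i: "integrable (?state n) f" by (rule integrable_const_bound[of _ B, rotated]) (use B in auto)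
      have "\<bar>?s n\<bar> \<le> (\<integral>x. \<bar>f x\<bar> \<partial>?state n)" by (rule integral_abs_bound)
      also have "\<dots> \<le> (\<integral>x. B \<partial>?state n)" using i B by (intro integral_mono) auto
      finally show ?thesis by (simp add: prob_space)
    qed
    have diff: "(\<integral>z. ?h z \<partial>?step n) = ?s n - ?s (Suc n)" for n
      using integral_occupation[OF step_law_in[OF \<xi>(1) \<mu>(1)] f B]
      by (simp add: state_law_Suc[OF \<xi>(1) \<mu>(1)] flip: state_law_def)
    have "(\<integral>z. ?h z \<partial>\<zeta>) = (\<integral>n. \<integral>z. ?h z \<partial>?step n \<partial>?p)"
      unfolding \<zeta>_def
    proof (rule integral_bind[where K="borel_graph U" and B="2 * B" and B'=1])
      show "finite_measure ?p" by unfold_locales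
      show "AE n in ?p. emeasure (?step n) (space (?step n)) \<le> ennreal 1"
        using step_law_in[OF \<xi>(1) \<mu>(1)] by (intro AE_I2) (auto simp: space_prob_algebra prob_space.emeasure_space_1)
    qed (use hB h step' in auto)
    also have "\<dots> = (\<Sum>n<N. ?s n - ?s (Suc n)) / N"
      by (subst integral_pmf_of_set) (use ne in \<open>auto simp: diff\<close>)
    also have "(\<Sum>n<N. ?s n - ?s (Suc n)) = ?s 0 - ?s N"
      by (rule sum_lessThan_telescope')
    finally have "\<bar>\<integral>z. ?h z \<partial>\<zeta>\<bar> = \<bar>?s 0 - ?s N\<bar> * (1 / N)"
      by (simp add: abs_divide)
    also have "\<dots> \<le> (2 * B) * e"
      using sB[of 0] sB[of N] Ne B0 by (intro mult_mono) auto
    finally show ?thesis .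
  qed
  show thesis by (rule that[OF \<zeta> cost inv])
qed

lemma graph_representation:
  fixes \<zeta> :: "nat \<Rightarrow> ('x \<times> 'u) measure"
  assumes \<zeta>: "\<And>n. \<zeta> n \<in> space (prob_algebra (borel_graph U))"
  obtains \<Omega> :: "real measure" and r :: "nat \<Rightarrow> nat" and Z :: "nat \<Rightarrow> real \<Rightarrow> 'x \<times> 'u"
    where "prob_space \<Omega>" "strict_mono r"
    "\<And>n. Z n \<in> \<Omega> \<rightarrow>\<^sub>M borel_graph U" "\<And>n. distr \<Omega> (borel_graph U) (Z n) = \<zeta> (r n)"
    "\<And>\<omega> i k. \<omega> \<in> space \<Omega> \<Longrightarrow>
      eventually_decided (\<lambda>n. Z n \<omega>) (sball i k)"
    "\<And>\<omega> i k. \<omega> \<in> space \<Omega> \<Longrightarrow>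
      eventually_decided (\<lambda>n. fst (Z n \<omega>)) (sball i k)"
proof -
  have sets: "sets (\<zeta> n) = sets (borel_graph U)" and pr: "prob_space (\<zeta> n)" for n
    using \<zeta>[of n] by (simp_all add: space_prob_algebra)
  have sp: "space (\<zeta> n) = graph U" for n using sets_eq_imp_space_eq[OF sets] by simp
  define \<mu> where "\<mu> n = distr (\<zeta> n) borel (\<lambda>z. z)" for n
  have id: "(\<lambda>z. z) \<in> \<zeta> n \<rightarrow>\<^sub>M borel" for n
    unfolding measurable_cong_sets[OF sets refl] by (rule measurable_restrict_space1) simp
  have \<mu>: "prob_space (\<mu> n)" "sets (\<mu> n) = sets borel" for n
    unfolding \<mu>_def by (rule prob_space.prob_space_distr[OF pr id]) simp
  \<comment> \<open>Even positions carry balls of pairs and odd positions balls of states, so one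
    code decides both.\<close>
  define B :: "nat \<Rightarrow> ('x \<times> 'u) set" where "B k = (case prod_decode (k div 2) of (i, n) \<Rightarrow>
    if even k then sball i n else fst -` sball i n)" for k
  define d where "d i n = 2 * prod_encode (i, n)" for i n
  have B_sball: "B (d i n) = sball i n" and B_fst: "B (Suc (d i n)) = fst -` sball i n" for i n
    by (simp_all add: B_def d_def)
  have "fst -` sball i n \<in> sets (borel :: ('x \<times> 'u) measure)" for i n
  proof -
    have "open (fst -` sball i n :: ('x \<times> 'u) set)"
      unfolding sball_def by (intro open_vimage_fst open_ball)
    then show ?thesis by simp
  qed
  then have B: "B k \<in> sets borel" for k
    by (simp add: B_def sets_sball split: prod.split)
  obtain \<Omega> :: "real measure" and Y :: "nat \<Rightarrow> real \<Rightarrow> 'x \<times> 'u" and r :: "nat \<Rightarrow> nat" where \<Omega>: "prob_space \<Omega>" "strict_mono r" "\<And>n. Y n \<in> \<Omega> \<rightarrow>\<^sub>M borel"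
      "\<And>n. distr \<Omega> borel (Y n) = \<mu> (r n)"
      "AE \<omega> in \<Omega>. \<forall>k. eventually_decided (\<lambda>n. Y n \<omega>) (B k)"
    using eventually_deciding_representation[of \<mu> B d, OF \<mu> B B_sball] by blast
  interpret \<Omega>: prob_space \<Omega> by fact
  note \<Omega>(3)[measurable]
  have "AE \<omega> in \<Omega>. \<forall>n. Y n \<omega> \<in> graph U"
    unfolding AE_all_countable
  proof
    fix n
    have "AE z in \<mu> (r n). z \<in> graph U"
      unfolding \<mu>_def using AE_space[of "\<zeta> (r n)"] by (subst AE_distr_iff[OF id]) (simp_all add: sp)
    then show "AE \<omega> in \<Omega>. Y n \<omega> \<in> graph U"
      unfolding \<Omega>(4)[symmetric] by (subst (asm) AE_distr_iff) auto
  qed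
  with \<Omega>(5) have "AE \<omega> in \<Omega>. (\<forall>n. Y n \<omega> \<in> graph U) \<and>
      (\<forall>k. eventually_decided (\<lambda>n. Y n \<omega>) (B k))"
    by eventually_elim simp
  then obtain N where N: "N \<in> null_sets \<Omega>" and good: "\<And>\<omega>. \<omega> \<in> space \<Omega> - N \<Longrightarrow> (\<forall>n. Y n \<omega> \<in> graph U) \<and>
      (\<forall>k. eventually_decided (\<lambda>n. Y n \<omega>) (B k))"
    by (rule AE_E3) blast
  have N_sets: "N \<in> sets \<Omega>" using N by auto
  obtain z0 where z0: "z0 \<in> graph U" using graph_nonempty by auto
  \<comment> \<open>The constant sequence at \<open>z0\<close> decides every set, so all properties
    hold at every sample point while the laws are unchanged.\<close>
  define Z where "Z n \<omega> = (if \<omega> \<in> space \<Omega> - N then Y n \<omega> else z0)" for n \<omega>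
  have Z: "Z n \<in> \<Omega> \<rightarrow>\<^sub>M borel_graph U" for n
  proof (rule measurable_restrict_space2)
    show "Z n \<in> space \<Omega> \<rightarrow> graph U" using good z0 by (auto simp: Z_def)
    show "Z n \<in> \<Omega> \<rightarrow>\<^sub>M borel" unfolding Z_def using N_sets by measurable
  qed
  have law: "distr \<Omega> (borel_graph U) (Z n) = \<zeta> (r n)" for n
  proof (rule measure_eqI)
    show "sets (distr \<Omega> (borel_graph U) (Z n)) = sets (\<zeta> (r n))" by (simp add: sets)
    fix A assume "A \<in> sets (distr \<Omega> (borel_graph U) (Z n))"
    then have A: "A \<in> sets (borel_graph U)" by simp
    then have A': "A \<subseteq> graph U" "A \<in> sets borel"
      using sets.sets_into_space[OF A] sets_graph by (auto simp: sets_restrict_space)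
    have "emeasure (distr \<Omega> (borel_graph U) (Z n)) A = emeasure \<Omega> (Z n -` A \<inter> space \<Omega>)"
      by (rule emeasure_distr[OF Z A])
    also have "\<dots> = emeasure \<Omega> (Y n -` A \<inter> space \<Omega>)"
    proof (rule emeasure_eq_AE)
      show "AE \<omega> in \<Omega>. \<omega> \<in> Z n -` A \<inter> space \<Omega> \<longleftrightarrow> \<omega> \<in> Y n -` A \<inter> space \<Omega>"
        using AE_not_in[OF N] AE_space by eventually_elim (simp add: Z_def)
    qed (use measurable_sets[OF Z A] measurable_sets[OF \<Omega>(3) A'(2)] in auto)
    also have "\<dots> = emeasure (\<mu> (r n)) A"
      unfolding \<Omega>(4)[symmetric] by (rule emeasure_distr[OF \<Omega>(3) A'(2), symmetric])
    also have "\<dots> = emeasure (\<zeta> (r n)) A"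
      unfolding \<mu>_def using A' by (simp add: emeasure_distr[OF id] sp Int_absorb2)
    finally show "emeasure (distr \<Omega> (borel_graph U) (Z n)) A = emeasure (\<zeta> (r n)) A" .
  qed
  have dec: "eventually_decided (\<lambda>n. Z n \<omega>) (B k)" for \<omega> k
    using good[of \<omega>] by (cases "\<omega> \<in> space \<Omega> - N"; cases "z0 \<in> B k") (auto simp: Z_def)
  show thesis
    using dec[of _ "d _ _"] dec[of _ "Suc (d _ _)"]
    by (intro that[OF \<Omega>(1,2) Z law]) (simp_all add: B_sball B_fst)
qed

lemma optimal_eoms_nonempty:
  assumes nm: "near_monotone U P c \<phi> \<psi>" and ic: "K_inf_compact U c" and fin: "opt_value U P c < \<infinity>"
  shows "optimal_eoms U P c \<noteq> {}"
proof -
  let ?e = "\<lambda>n. 1 / real (Suc n)"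
  have "\<forall>n. \<exists>\<zeta>. \<zeta> \<in> space (prob_algebra (borel_graph U)) \<and>
      (\<integral>\<^sup>+z. c z \<partial>\<zeta>) \<le> opt_value U P c + ennreal (?e n) \<and>
      (\<forall>f B. f \<in> borel_measurable borel \<longrightarrow> (\<forall>x. \<bar>f x\<bar> \<le> B) \<longrightarrow>
        \<bar>\<integral>z. f (fst z) - (\<integral>y. f y \<partial>P z) \<partial>\<zeta>\<bar> \<le> 2 * B * ?e n)"
    by (rule allI, rule near_optimal_occupation[OF fin, of "?e _"]) auto
  from choice[OF this] obtain \<zeta> where all: "\<forall>n. \<zeta> n \<in> space (prob_algebra (borel_graph U)) \<and>
      (\<integral>\<^sup>+z. c z \<partial>\<zeta> n) \<le> opt_value U P c + ennreal (?e n) \<and>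
      (\<forall>f B. f \<in> borel_measurable borel \<longrightarrow> (\<forall>x. \<bar>f x\<bar> \<le> B) \<longrightarrow>
        \<bar>\<integral>z. f (fst z) - (\<integral>y. f y \<partial>P z) \<partial>\<zeta> n\<bar> \<le> 2 * B * ?e n)" ..
  then have \<zeta>: "\<zeta> n \<in> space (prob_algebra (borel_graph U))"
    and cost: "(\<integral>\<^sup>+z. c z \<partial>\<zeta> n) \<le> opt_value U P c + ennreal (?e n)" for n
    by blast+
  have inv: "\<bar>\<integral>z. f (fst z) - (\<integral>y. f y \<partial>P z) \<partial>\<zeta> n\<bar> \<le> 2 * B * ?e n"
    if "f \<in> borel_measurable borel" "\<And>x. \<bar>f x\<bar> \<le> B" for n f B
    using all that by blast
  obtain \<Omega> :: "real measure" and Z :: "nat \<Rightarrow> real \<Rightarrow> 'x \<times> 'u" and r :: "nat \<Rightarrow> nat" where \<Omega>: "prob_space \<Omega>" and r: "strict_mono r"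
    and Z: "\<And>n. Z n \<in> \<Omega> \<rightarrow>\<^sub>M borel_graph U" and law: "\<And>n. distr \<Omega> (borel_graph U) (Z n) = \<zeta> (r n)"
    and dec: "\<And>\<omega> i k. \<omega> \<in> space \<Omega> \<Longrightarrow>
      eventually_decided (\<lambda>n. Z n \<omega>) (sball i k)"
      "\<And>\<omega> i k. \<omega> \<in> space \<Omega> \<Longrightarrow>
      eventually_decided (\<lambda>n. fst (Z n \<omega>)) (sball i k)"
    using graph_representation[of \<zeta>, OF \<zeta>] by blast
  obtain K \<epsilon> where K: "compact K" "0 < \<epsilon>" "\<And>z. z \<in> graph U \<Longrightarrow> z \<notin> K \<Longrightarrow> opt_value U P c + ennreal \<epsilon> \<le> c z"
    using nm unfolding near_monotone_def by blast
  have e0: "(\<lambda>n. ?e (r n)) \<longlonglongrightarrow> 0"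
    using LIMSEQ_subseq_LIMSEQ[OF LIMSEQ_inverse_real_of_nat r] by (simp add: comp_def inverse_eq_divide)
  interpret prob_space \<Omega> by (rule \<Omega>)
  interpret D: deciding_limit U P c \<Omega> Z K \<epsilon>
  proof unfold_locales
    show "liminf (\<lambda>n. \<integral>\<^sup>+\<omega>. c (Z n \<omega>) \<partial>\<Omega>) \<le> opt_value U P c"
    proof -
      have "(\<integral>\<^sup>+\<omega>. c (Z n \<omega>) \<partial>\<Omega>) = (\<integral>\<^sup>+z. c z \<partial>\<zeta> (r n))" for n
        unfolding law[symmetric] by (rule nn_integral_distr[OF Z, symmetric]) (simp add: c_measurable)
      then have "(\<integral>\<^sup>+\<omega>. c (Z n \<omega>) \<partial>\<Omega>) \<le> opt_value U P c + ennreal (?e (r n))" for n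
        using cost by simp
      then have "liminf (\<lambda>n. \<integral>\<^sup>+\<omega>. c (Z n \<omega>) \<partial>\<Omega>) \<le> liminf (\<lambda>n. opt_value U P c + ennreal (?e (r n)))"
        by (intro Liminf_mono always_eventually allI)
      also have "\<dots> = opt_value U P c + ennreal 0"
        by (intro lim_imp_Liminf tendsto_add tendsto_const tendsto_ennrealI e0) simp
      finally show ?thesis by simp
    qed
    fix f :: "'x \<Rightarrow> real" assume f: "continuous_on UNIV f" "bounded (range f)"
    obtain B where B: "\<And>x. \<bar>f x\<bar> \<le> B" using f(2) by (auto simp: bounded_iff)
    have fm: "f \<in> borel_measurable borel" using f(1) by (rule borel_measurable_continuous_onI)
    have h: "(\<lambda>z. f (fst z) - (\<integral>y. f y \<partial>P z)) \<in> borel_measurable (borel_graph U)"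
      by (intro borel_measurable_diff measurable_compose[OF measurable_fst_borel_graph fm] measurable_integral_P fm)
    have eq: "(\<integral>\<omega>. f (fst (Z n \<omega>)) - (\<integral>y. f y \<partial>P (Z n \<omega>)) \<partial>\<Omega>) = (\<integral>z. f (fst z) - (\<integral>y. f y \<partial>P z) \<partial>\<zeta> (r n))" for n
      unfolding law[symmetric] by (rule integral_distr[OF Z h, symmetric])
    show "(\<lambda>n. \<integral>\<omega>. f (fst (Z n \<omega>)) - (\<integral>y. f y \<partial>P (Z n \<omega>)) \<partial>\<Omega>) \<longlonglongrightarrow> 0"
    proof (rule Lim_null_comparison)
      show "\<forall>\<^sub>F n in sequentially. norm (\<integral>\<omega>. f (fst (Z n \<omega>)) - (\<integral>y. f y \<partial>P (Z n \<omega>)) \<partial>\<Omega>) \<le> 2 * B * ?e (r n)"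
        unfolding eq real_norm_def by (intro always_eventually allI inv fm B)
      show "(\<lambda>n. 2 * B * ?e (r n)) \<longlonglongrightarrow> 0"
        using tendsto_mult_right_zero[OF e0, of "2 * B"] by simp
    qed
  qed (use Z dec K ic fin in auto)
  \<comment> \<open>Infima over an empty set of strategies would be infinite, so a finite value
    already provides a strategy.\<close>
  have "strategies U \<noteq> {}"
  proof
    assume "strategies U = {}"
    then have "opt_value U P c = \<infinity>"
      by (simp add: opt_value_def value_fn_def)
    then show False using fin by simp
  qed
  then show ?thesis using D.limit_law_optimal by auto
qed

end

theorem theorem2p1:
  fixes U :: "'x::polish_space \<Rightarrow> 'u::polish_space set"
    and P :: "'x \<times> 'u \<Rightarrow> 'x measure"
    and c :: "'x \<times> 'u \<Rightarrow> ennreal"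
    and \<phi> :: "'x \<Rightarrow> 'xs::polish_space"
    and \<psi> :: "'u \<Rightarrow> 'us::polish_space"
  assumes "feller_mdp U P c"
    and "near_monotone U P c \<phi> \<psi>"
    and "opt_value U P c < \<infinity>"
  shows "(K_inf_compact U c \<longrightarrow> optimal_eoms U P c \<noteq> {}) \<and>
    (\<forall>\<zeta> \<in> optimal_eoms U P c. \<forall>\<pi> v. \<forall>v' \<in> sm_strategies U.
       disintegrates U \<zeta> \<pi> v \<longrightarrow> (AE x in \<pi>. v' x = v x) \<longrightarrow>
       (AE x in \<pi>.
          ((\<lambda>N. (\<integral>\<^sup>+\<omega>. (\<Sum>n<N. cost_under U c v' (fst (\<omega> n)))
                   \<partial>path_law U P (stationary v') (return borel x)) / of_nat N)
             \<longlonglongrightarrow> value_fn U P c (return borel x)) \<and>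
          value_fn U P c (return borel x) = opt_value U P c))"
proof (intro conjI impI ballI allI)
  interpret feller_mdp U P c by fact
  show "optimal_eoms U P c \<noteq> {}" if "K_inf_compact U c"
    using assms(2) that assms(3) by (rule optimal_eoms_nonempty)
  fix \<zeta> \<pi> v v'
  assume \<zeta>: "\<zeta> \<in> optimal_eoms U P c" and v': "v' \<in> sm_strategies U"
    and dis: "disintegrates U \<zeta> \<pi> v" and ae: "AE x in \<pi>. v' x = v x"
  have \<pi>: "\<pi> \<in> Prob" and v: "v \<in> borel \<rightarrow>\<^sub>M prob_algebra borel" and eq: "\<zeta> = compose_kernel U \<pi> v"
    using dis by (auto simp: disintegrates_def)
  \<comment> \<open>Agreement almost everywhere lets the everywhere admissible \<open>v'\<close>
    disintegrate the same measure.\<close>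
  have "\<zeta> = compose_kernel U \<pi> v'"
    unfolding eq by (rule compose_kernel_cong_AE[OF \<pi> sm_strategiesD(1)[OF v'] v ae, symmetric])
  then show "AE x in \<pi>.
      ((\<lambda>N. (\<integral>\<^sup>+\<omega>. (\<Sum>n<N. cost_under U c v' (fst (\<omega> n)))
               \<partial>path_law U P (stationary v') (return borel x)) / of_nat N)
         \<longlonglongrightarrow> value_fn U P c (return borel x)) \<and>
      value_fn U P c (return borel x) = opt_value U P c"
    by (rule stationary_optimal[OF \<zeta> assms(3) \<pi> v'])
qed

end
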